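(* Let $\beta\in(1,2)$. 1. Assume that either $\alpha\in(0,1)$, or $\alpha\in(1,2)$ with $\mu=\mathbb E[\xi_1]=0$. For $t\in[0,+\infty)$ and $n\in\mathbb Z^+$ set $$\hat Y^{(n)}(t):=\frac{Y_{\lfloor nt\rfloor}}{n^{1/\alpha}}.$$ Then, as $n\to\infty$, $\ \hat Y^{(n)}\xrightarrow{\ d\ }\nu\,W^{(\alpha)}$ in $(\mathcal D^+,J_1)$. 2. Assume $\alpha\in(1,2)$ and $\mu=\mathbb E[\xi_1]\ne0$. For $t\in[0,+\infty)$ and $n\in\mathbb Z^+$ set $$\bar Y^{(n)}(t):=\frac{Y_{\lfloor nt\rfloor}}{n}.$$ Then, as $n\to\infty$, $\ \bar Y^{(n)}\xrightarrow{\ d\ }\nu\mu\,\mathrm{id}$ in $(\mathcal D^+,J_1)$, where $\mathrm{id}(t)=t$.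
   Context: Medium: $\zeta=(\zeta_i)_{i\in\mathbb Z}$ are i.i.d. positive random variables in the normal domain of attraction of a $\beta$-stable law, which for $\beta\in(1,2)$ means $n^{-1/\beta}\sum_{i=1}^n(\zeta_i-\nu)\xrightarrow{d}\tilde Z^{(\beta)}_1$, where $\nu=\mathbb E[\zeta_1]\in(0,\infty)$ and $\tilde Z^{(\beta)}_1$ is a (non-degenerate) stable variable of index $\beta$. Put $\omega_0=0$, $\omega_k=\sum_{i=1}^k\zeta_i$ for $k>0$, $\omega_k=-\sum_{i=k}^{-1}\zeta_i$ for $k<0$. Underlying random walk: $S_0=0$, $S_n=\sum_{i=1}^n\xi_i$, where $(\xi_i)_{i\ge1}$ are i.i.d. $\mathbb Z$-valued random variables, independent of $\zeta$, in the normal domain of attraction of an $\alpha$-stable law. If $\alpha\in(0,1)$, or $\alpha\in(1,2)$ and $\mu:=\mathbb E[\xi_1]=0$, this means $n^{-1/\alpha}\sum_{i=1}^n\xi_i\xrightarrow{d}W^{(\alpha)}_1$; if $\alpha\in(1,2)$ and $\mu\neq0$, it means $n^{-1/\alpha}\sum_{i=1}^n(\xi_i-\mu)\xrightarrow{d}\widetilde W^{(\alpha)}_1$; here $W^{(\alpha)}_1,\widetilde W^{(\alpha)}_1$ are (non-degenerate) stable variables of index $\alpha$. Random walk on the random medium: $Y_n:=\omega_{S_n}$, $n\in\mathbb N$. All laws are with respect to the probability governing both $\zeta$ and $(\xi_i)$ (annealed law). Limit process: $(W^{(\alpha)}(t))_{t\ge0}$ is a càdlàg Lévy $\alpha$-stable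 process with $W^{(\alpha)}(0)=0$ and $W^{(\alpha)}(1)$ distributed like $W^{(\alpha)}_1$. Topology: $\mathcal D^+$ is the space of càdlàg functions $f:[0,+\infty)\to\mathbb R$. For a bounded interval $I\subset[0,+\infty)$ and càdlàg $f,g$ on $I$, the $J_1$ distance is $d_{J_1,I}(f,g):=\inf_\lambda\max\{\sup_{t\in I}|f(\lambda(t))-g(t)|,\ \sup_{t\in I}|\lambda(t)-t|\}$, the infimum being over all increasing homeomorphisms $\lambda:I\to I$. $f_n\to f$ in $(\mathcal D^+,J_1)$ means $d_{J_1,[0,T]}(f_n,f)\to0$ for every $T>0$ at which $f$ is continuous; this is a metrizable topology, and $\xrightarrow{d}$ in $(\mathcal D^+,J_1)$ denotes convergence in distribution with respect to it. *)

theory Defs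
  imports "HOL-Probability.Probability"
begin

section \<open>The Skorokhod space of cadlag functions on the half-line\<close>

text \<open>
  A function on $[0,\infty)$ is an element of \<^const>\<open>extensional\<close> over \<open>{0..}\<close>, so that two
  elements of \<open>cadlag_fun\<close> are equal iff they agree on \<open>{0..}\<close>.
\<close>

definition cadlag_fun :: "(real \<Rightarrow> real) set" where
  "cadlag_fun = {f \<in> extensional {0..}.
     (\<forall>t\<ge>0. continuous (at_right t) f) \<and> (\<forall>t>0. \<exists>l. (f \<longlongrightarrow> l) (at_left t))}"

definition time_changes :: "real set \<Rightarrow> (real \<Rightarrow> real) set" where
  "time_changes I = {l. strict_mono_on I l \<and> (\<exists>l'. homeomorphism I I l l')}"

definition J1_dist :: "real set \<Rightarrow> (real \<Rightarrow> real) \<Rightarrow> (real \<Rightarrow> real) \<Rightarrow> real" where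
  "J1_dist I f g =
     (INF l\<in>time_changes I. max (SUP t\<in>I. \<bar>f (l t) - g t\<bar>) (SUP t\<in>I. \<bar>l t - t\<bar>))"

definition J1_converges :: "(nat \<Rightarrow> real \<Rightarrow> real) \<Rightarrow> (real \<Rightarrow> real) \<Rightarrow> bool" where
  "J1_converges f g \<longleftrightarrow>
     (\<forall>T>0. isCont g T \<longrightarrow> (\<lambda>n. J1_dist {0..T} (f n) g) \<longlonglongrightarrow> 0)"

text \<open>
  \<open>J1_converges\<close> is the sequential convergence of a metrizable topology on \<open>cadlag_fun\<close>.
  A metrizable topology is sequential, hence it is the topology whose open sets are the
  sequentially open ones.
\<close>

definition J1_topology :: "(real \<Rightarrow> real) topology" where
  "J1_topology = topology (\<lambda>U. U \<subseteq> cadlag_fun \<and>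
     (\<forall>g\<in>U. \<forall>f. (\<forall>n. f n \<in> cadlag_fun) \<and> J1_converges f g \<longrightarrow>
        (\<forall>\<^sub>F n in sequentially. f n \<in> U)))"

lemma openin_J1_topology:
  "openin J1_topology U \<longleftrightarrow> U \<subseteq> cadlag_fun \<and>
     (\<forall>g\<in>U. \<forall>f. (\<forall>n. f n \<in> cadlag_fun) \<and> J1_converges f g \<longrightarrow>
        (\<forall>\<^sub>F n in sequentially. f n \<in> U))"
proof -
  have "istopology (\<lambda>U. U \<subseteq> cadlag_fun \<and>
     (\<forall>g\<in>U. \<forall>f. (\<forall>n. f n \<in> cadlag_fun) \<and> J1_converges f g \<longrightarrow>
        (\<forall>\<^sub>F n in sequentially. f n \<in> U)))"
    (is "istopology ?P")
    unfolding istopology_def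
  proof (intro conjI allI impI)
    fix S T assume "?P S" "?P T"
    then show "S \<inter> T \<subseteq> cadlag_fun"
      and "\<forall>g\<in>S \<inter> T. \<forall>f. (\<forall>n. f n \<in> cadlag_fun) \<and> J1_converges f g \<longrightarrow>
        (\<forall>\<^sub>F n in sequentially. f n \<in> S \<inter> T)"
      by (auto simp: eventually_conj_iff)
  next
    fix K assume K: "\<forall>S\<in>K. ?P S"
    then show "\<Union>K \<subseteq> cadlag_fun" by blast
    show "\<forall>g\<in>\<Union>K. \<forall>f. (\<forall>n. f n \<in> cadlag_fun) \<and> J1_converges f g \<longrightarrow>
        (\<forall>\<^sub>F n in sequentially. f n \<in> \<Union>K)"
    proof (intro ballI allI impI)
      fix g f assume "g \<in> \<Union>K" and f: "(\<forall>n. f n \<in> cadlag_fun) \<and> J1_converges f g"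
      then obtain S where S: "S \<in> K" "g \<in> S" by blast
      with K f have "\<forall>\<^sub>F n in sequentially. f n \<in> S" by blast
      then show "\<forall>\<^sub>F n in sequentially. f n \<in> \<Union>K"
        by (rule eventually_mono) (use S in blast)
    qed
  qed
  then show ?thesis
    unfolding J1_topology_def by (simp add: topology_inverse')
qed

lemma topspace_J1_topology: "topspace J1_topology = cadlag_fun"
proof
  show "topspace J1_topology \<subseteq> cadlag_fun"
    using openin_topspace[of J1_topology] openin_J1_topology by blast
  have "openin J1_topology cadlag_fun"
    by (simp add: openin_J1_topology)
  then show "cadlag_fun \<subseteq> topspace J1_topology"
    by (rule openin_subset)
qed

definition J1_borel :: "(real \<Rightarrow> real) measure" where
  "J1_borel = sigma cadlag_fun {U. openin J1_topology U}"

definition J1_converges_in_distribution ::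
    "'w measure \<Rightarrow> (nat \<Rightarrow> 'w \<Rightarrow> real \<Rightarrow> real) \<Rightarrow> 'v measure \<Rightarrow> ('v \<Rightarrow> real \<Rightarrow> real) \<Rightarrow> bool" where
  "J1_converges_in_distribution M X N Y \<longleftrightarrow>
     (\<forall>n. X n \<in> measurable M J1_borel) \<and> Y \<in> measurable N J1_borel \<and>
     (\<forall>F. continuous_map J1_topology euclideanreal F \<and> bounded (F ` cadlag_fun) \<longrightarrow>
        (\<lambda>n. \<integral>w. F (X n w) \<partial>M) \<longlonglongrightarrow> (\<integral>v. F (Y v) \<partial>N))"


section \<open>Stable laws and Levy processes\<close>

text \<open>
  If $X_1, X_2$ are independent with law $L$, then for all $a, b > 0$ the variable
  $a X_1 + b X_2$ has the law of $(a^\alpha + b^\alpha)^{1/\alpha} X_1 + d$ for some real $d$.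
\<close>

definition stable_law :: "real \<Rightarrow> real measure \<Rightarrow> bool" where
  "stable_law \<alpha> L \<longleftrightarrow> real_distribution L \<and> (\<nexists>c. L = return borel c) \<and>
     (\<forall>a>0. \<forall>b>0. \<exists>d.
        distr (L \<Otimes>\<^sub>M L) borel (\<lambda>(x, y). a * x + b * y) =
        distr L borel (\<lambda>x. (a powr \<alpha> + b powr \<alpha>) powr (1 / \<alpha>) * x + d))"

definition iid :: "'w measure \<Rightarrow> 'b measure \<Rightarrow> ('i \<Rightarrow> 'w \<Rightarrow> 'b) \<Rightarrow> 'i set \<Rightarrow> bool" where
  "iid M E X I \<longleftrightarrow> prob_space.indep_vars M (\<lambda>_. E) X I \<and>
     (\<forall>i\<in>I. \<forall>j\<in>I. distr M E (X i) = distr M E (X j))"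

definition normal_attraction ::
    "'w measure \<Rightarrow> (nat \<Rightarrow> 'w \<Rightarrow> real) \<Rightarrow> real \<Rightarrow> real \<Rightarrow> real measure \<Rightarrow> bool" where
  "normal_attraction M X c \<alpha> L \<longleftrightarrow> stable_law \<alpha> L \<and>
     weak_conv_m
       (\<lambda>n. distr M borel (\<lambda>w. real n powr (- 1 / \<alpha>) * (\<Sum>i=1..n. X i w - c))) L"

definition levy_process :: "'v measure \<Rightarrow> (real \<Rightarrow> 'v \<Rightarrow> real) \<Rightarrow> bool" where
  "levy_process N W \<longleftrightarrow> prob_space N \<and>
     (\<forall>t\<ge>0. W t \<in> borel_measurable N) \<and>
     (AE v in N. W 0 v = 0) \<and>
     (\<forall>t :: nat \<Rightarrow> real. \<forall>k. 0 \<le> t 0 \<and> mono t \<longrightarrow>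
        prob_space.indep_vars N (\<lambda>_. borel) (\<lambda>i v. W (t (Suc i)) v - W (t i) v) {..<k}) \<and>
     (\<forall>s\<ge>0. \<forall>t\<ge>0. distr N borel (\<lambda>v. W (s + t) v - W s v) = distr N borel (W t)) \<and>
     (\<forall>v\<in>space N. (\<lambda>t\<in>{0..}. W t v) \<in> cadlag_fun)"


section \<open>Random walk on a random medium\<close>

definition medium :: "(int \<Rightarrow> 'w \<Rightarrow> real) \<Rightarrow> int \<Rightarrow> 'w \<Rightarrow> real" where
  "medium \<zeta> k w =
     (if k > 0 then \<Sum>i=1..k. \<zeta> i w else if k < 0 then - (\<Sum>i=k..-1. \<zeta> i w) else 0)"

definition walk :: "(nat \<Rightarrow> 'w \<Rightarrow> int) \<Rightarrow> nat \<Rightarrow> 'w \<Rightarrow> int" where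
  "walk \<xi> n w = (\<Sum>i=1..n. \<xi> i w)"

definition walk_on_medium ::
    "(int \<Rightarrow> 'w \<Rightarrow> real) \<Rightarrow> (nat \<Rightarrow> 'w \<Rightarrow> int) \<Rightarrow> nat \<Rightarrow> 'w \<Rightarrow> real" where
  "walk_on_medium \<zeta> \<xi> n w = medium \<zeta> (walk \<xi> n w) w"

text \<open>The sigma-algebras generated by the two families are independent.\<close>

definition medium_walk_indep ::
    "'w measure \<Rightarrow> (int \<Rightarrow> 'w \<Rightarrow> real) \<Rightarrow> (nat \<Rightarrow> 'w \<Rightarrow> int) \<Rightarrow> bool" where
  "medium_walk_indep M \<zeta> \<xi> \<longleftrightarrow> prob_space.indep_set M
     (sets (vimage_algebra (space M) (\<lambda>w i. \<zeta> i w) (\<Pi>\<^sub>M i\<in>UNIV. borel)))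
     (sets (vimage_algebra (space M) (\<lambda>w. \<lambda>i\<in>{1..}. \<xi> i w) (\<Pi>\<^sub>M i\<in>{1..}. count_space UNIV)))"

text \<open>
  For \<open>n = 0\<close> the scaled paths below are identically 0 (division by zero); this does not
  affect limits as \<open>n\<close> tends to infinity.
\<close>

definition scaled_path ::
    "(int \<Rightarrow> 'w \<Rightarrow> real) \<Rightarrow> (nat \<Rightarrow> 'w \<Rightarrow> int) \<Rightarrow> (nat \<Rightarrow> real) \<Rightarrow> nat \<Rightarrow> 'w \<Rightarrow> real \<Rightarrow> real" where
  "scaled_path \<zeta> \<xi> a n w = (\<lambda>t\<in>{0..}. walk_on_medium \<zeta> \<xi> (nat \<lfloor>real n * t\<rfloor>) w / a n)"

end

theory Submission
  imports Defs
begin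

text \<open>
  Since \<open>\<beta> > 1\<close>, the fluctuations of \<open>\<omega>\<^sub>k - \<nu> k\<close> are of order \<open>\<bar>k\<bar> powr (1 / \<beta>)\<close>, hence negligible
  compared with \<open>\<bar>k\<bar>\<close>, and the path of \<open>Y\<close> is uniformly close to that of \<open>\<nu> S\<close>. Both parts thus reduce to one
  functional limit theorem: if \<open>n powr -a * S n\<close> converges in law to \<open>W 1\<close> for a cadlag Levy process \<open>W\<close>, then
  the rescaled walk converges to \<open>W\<close> in \<open>J\<^sub>1\<close> (with \<open>a = 1\<close> and the deterministic process \<open>W t = \<mu> t\<close> in the second part).

  For the latter, walk and limit are discretised on the grid of mesh \<open>1 / m\<close>. The increments of the discretised walk
  are independent and converge in law to those of \<open>W\<close>. The discretisation is close to the walk in \<open>J\<^sub>1\<close>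
  unless some cell contains two macroscopic displacements. A macroscopic displacement in a given cell has probability
  \<open>O(1 / m)\<close>, because \<open>W\<close> is cadlag and hence makes only finitely many large jumps; so two of them in one of the
  \<open>O(m)\<close> cells have probability \<open>O(1 / m)\<close>.
\<close>

section \<open>Cadlag functions\<close>

text \<open>The topology is given only through sequential convergence on horizons at which the limit
  is continuous, and these depend on the limit. A pseudometric \<open>jdist\<close> on paths over
  the half-line has the same convergent sequences of cadlag paths, so bounded Lipschitz functionals
  suffice both for measurability and for convergence in distribution. The walk is known to converge
  at time 1 only. At time \<open>1 / m\<close> the law of \<open>W (1 / m)\<close> is identified
  with that of \<open>m powr -a\<close> times \<open>W 1\<close>, so that the tail bound drawn from
  the paths of \<open>W\<close> passes to the walk over a block of \<open>n / m\<close> steps.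
  Ottaviani's inequality then turns the tail at the end of a block into a bound on the maximum over
  it. The limit in \<open>n\<close> is taken before the one in \<open>m\<close>. A single large
  displacement in a cell is harmless because a time change can move it to the cell boundary. The
  medium is controlled uniformly: with high probability the walk stays in a window of deterministic
  size of order \<open>n powr a\<close>, on which the fluctuations to the left and to the right obey
  maximal inequalities.\<close>

lemma cadlag_funI:
  assumes "\<And>t. 0 \<le> t \<Longrightarrow> (f \<longlongrightarrow> f t) (at_right t)" "\<And>t. 0 < t \<Longrightarrow> \<exists>l. (f \<longlongrightarrow> l) (at_left t)"
  shows "restrict f {0..} \<in> cadlag_fun"
proof -
  have 1: "\<forall>\<^sub>F s in at_right t. f s = restrict f {0..} s" if "0 \<le> t" for t
    using that by (auto simp: eventually_at_right_field intro!: exI[of _ "t + 1"])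
  have 2: "\<forall>\<^sub>F s in at_left t. f s = restrict f {0..} s" if "0 < t" for t
    using that by (auto simp: eventually_at_left_field intro!: exI[of _ 0])
  have "(restrict f {0..} \<longlongrightarrow> f t) (at_right t)" if "0 \<le> t" for t
    by (rule Lim_transform_eventually[OF assms(1)[OF that] 1[OF that]])
  moreover have "\<exists>l. (restrict f {0..} \<longlongrightarrow> l) (at_left t)" if t: "0 < t" for t
  proof -
    obtain l where "(f \<longlongrightarrow> l) (at_left t)" using assms(2)[OF t] by blast
    from Lim_transform_eventually[OF this 2[OF t]] show ?thesis by (rule exI)
  qed
  ultimately show ?thesis by (simp add: cadlag_fun_def continuous_within)
qed

text \<open>Oscillation is measured on each side of \<open>p\<close> separately, with
  \<open>p\<close> in the right piece, so a jump at \<open>p\<close> is permitted. The left piece is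
  cut off at 0, below which paths are not controlled.\<close>

definition small_osc :: "(real \<Rightarrow> real) \<Rightarrow> real \<Rightarrow> real \<Rightarrow> real \<Rightarrow> bool" where
  "small_osc f e p d \<longleftrightarrow>
    (\<forall>s u. p \<le> s \<and> s < p + d \<and> p \<le> u \<and> u < p + d \<longrightarrow> \<bar>f s - f u\<bar> \<le> e) \<and>
    (\<forall>s u. 0 \<le> s \<and> p - d < s \<and> s < p \<and> 0 \<le> u \<and> p - d < u \<and> u < p \<longrightarrow> \<bar>f s - f u\<bar> \<le> e)"

lemma small_oscD:
  assumes "small_osc f e p d"
  shows "p \<le> s \<Longrightarrow> s < p + d \<Longrightarrow> p \<le> u \<Longrightarrow> u < p + d \<Longrightarrow> \<bar>f s - f u\<bar> \<le> e"
    "0 \<le> s \<Longrightarrow> p - d < s \<Longrightarrow> s < p \<Longrightarrow> 0 \<le> u \<Longrightarrow> p - d < u \<Longrightarrow> u < p \<Longrightarrow> \<bar>f s - f u\<bar> \<le> e"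
  using assms unfolding small_osc_def by blast+

lemma cadlag_local_osc:
  assumes f: "f \<in> cadlag_fun" and p: "0 \<le> p" and e: "0 < e"
  obtains d where "0 < d" "small_osc f e p d"
proof -
  have "(f \<longlongrightarrow> f p) (at_right p)" using f p by (simp add: cadlag_fun_def continuous_within)
  then have "\<forall>\<^sub>F t in at_right p. dist (f t) (f p) < e / 2" using e by (intro tendstoD) auto
  then obtain b where b: "b > p" "\<And>y. p < y \<Longrightarrow> y < b \<Longrightarrow> dist (f y) (f p) < e / 2"
    by (auto simp: eventually_at_right_field)
  have right: "\<bar>f s - f p\<bar> < e / 2" if "p \<le> s" "s < b" for s
    using b(2)[of s] that e by (cases "s = p") (auto simp: dist_real_def)
  obtain a where a: "a < p" "\<And>s u. 0 \<le> s \<Longrightarrow> a < s \<Longrightarrow> s < p \<Longrightarrow> 0 \<le> u \<Longrightarrow> a < u \<Longrightarrow> u < p \<Longrightarrow> \<bar>f s - f u\<bar> \<le> e"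
  \<comment> \<open>At 0 there is no left limit; the left piece is empty there, so any negative
    \<open>a\<close> will do.\<close>
  proof (cases "p = 0")
    case True
    then show ?thesis using that[of "-1"] by auto
  next
    case False
    then have "0 < p" using p by simp
    then obtain l where "(f \<longlongrightarrow> l) (at_left p)" using f unfolding cadlag_fun_def by blast
    then have "\<forall>\<^sub>F t in at_left p. dist (f t) l < e / 2" using e by (intro tendstoD) auto
    then obtain a where a: "a < p" "\<And>y. a < y \<Longrightarrow> y < p \<Longrightarrow> dist (f y) l < e / 2"
      by (auto simp: eventually_at_left_field)
    show ?thesis
    proof (rule that[OF a(1)])
      fix s u assume "a < s" "s < p" "a < u" "u < p"
      then show "\<bar>f s - f u\<bar> \<le> e"
        using a(2)[of s] a(2)[of u] unfolding dist_real_def by linarith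
    qed
  qed
  have "\<bar>f s - f u\<bar> \<le> e" if "p \<le> s" "s < b" "p \<le> u" "u < b" for s u
    using right[of s] right[of u] that by linarith
  then have "small_osc f e p (min (b - p) (p - a))" unfolding small_osc_def using a(2) by auto
  then show ?thesis using a(1) b(1) by (intro that[of "min (b - p) (p - a)"]) auto
qed

text \<open>Comparison is with the values at the two end points because these are the values a grid
  discretisation reads. Strictness in \<open>a < \<tau>\<close> later keeps the nodes of a time
  change strictly increasing.\<close>

definition one_jump :: "real \<Rightarrow> (real \<Rightarrow> real) \<Rightarrow> real \<Rightarrow> real \<Rightarrow> bool" where
  "one_jump e f a b \<longleftrightarrow> (\<exists>\<tau>. a < \<tau> \<and> \<tau> \<le> b \<and> (\<forall>t. a \<le> t \<and> t < \<tau> \<longrightarrow> \<bar>f t - f a\<bar> \<le> e) \<and>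
     (\<forall>t. \<tau> \<le> t \<and> t \<le> b \<longrightarrow> \<bar>f t - f b\<bar> \<le> e))"

text \<open>Lebesgue's number lemma for the balls of \<open>small_osc\<close> around points of a
  compact interval: a short interval lies in a single ball, and only the centre of that ball can
  split it into two pieces of small oscillation.\<close>

lemma cadlag_one_jump:
  assumes f: "f \<in> cadlag_fun" and e: "0 < e"
  obtains d where "0 < d" "\<And>a b. 0 \<le> a \<Longrightarrow> a < b \<Longrightarrow> a \<le> K \<Longrightarrow> b - a < d \<Longrightarrow> one_jump e f a b"
proof -
  have "\<forall>p\<in>{0..K}. \<exists>d>0. small_osc f e p d"
    using cadlag_local_osc[OF f _ e] by (metis atLeastAtMost_iff)
  from bchoice[OF this] obtain D where D: "\<And>p. p \<in> {0..K} \<Longrightarrow> 0 < D p"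
    "\<And>p. p \<in> {0..K} \<Longrightarrow> small_osc f e p (D p)" by blast
  obtain d where d: "0 < d" "\<And>x. x \<in> {0..K} \<Longrightarrow> \<exists>G \<in> (\<lambda>p. ball p (D p)) ` {0..K}. ball x d \<subseteq> G"
  proof (rule Heine_Borel_lemma[of "{0..K}" "(\<lambda>p. ball p (D p)) ` {0..K}"])
    show "{0..K} \<subseteq> \<Union> ((\<lambda>p. ball p (D p)) ` {0..K})" using D(1) by fastforce
  qed auto
  show ?thesis
  proof (rule that[OF d(1)])
    fix a b assume ab: "0 \<le> a" "a < b" "a \<le> K" "b - a < d"
    obtain p where p: "p \<in> {0..K}" "ball a d \<subseteq> ball p (D p)" using d(2)[of a] ab by auto
    \<comment> \<open>Only \<open>a\<close> has to lie in \<open>[0, K]\<close>: as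
      \<open>b - a < d\<close>, the whole interval is inside \<open>ball a d\<close>.\<close>
    have in_ball: "p - D p < t \<and> t < p + D p" if "a \<le> t" "t \<le> b" for t
    proof -
      have "t \<in> ball a d" using that ab by (auto simp: dist_real_def)
      with p(2) have "t \<in> ball p (D p)" by blast
      then show ?thesis by (auto simp: dist_real_def)
    qed
    note osc = small_oscD[OF D(2)[OF p(1)]]
    show "one_jump e f a b"
    proof (cases "a < p \<and> p \<le> b")
      case True
      then show ?thesis unfolding one_jump_def using ab in_ball osc by (intro exI[of _ p]) auto
    next
      case False
      have "\<bar>f t - f a\<bar> \<le> e" if "a \<le> t" "t \<le> b" for t
        using False that ab in_ball[of t] in_ball[of a] osc(1)[of t a] osc(2)[of t a]
        by (cases "p \<le> a") auto
      then show ?thesis unfolding one_jump_def using ab e by (intro exI[of _ b]) auto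
    qed
  qed
qed

text \<open>Cells of half the one-jump threshold cover the interval, and each value is within 1 of
  the value at an end point of its cell; there are finitely many such end points.\<close>

lemma cadlag_bounded:
  assumes f: "f \<in> cadlag_fun"
  shows "bounded (f ` {0..K})"
proof -
  obtain d where d: "0 < d" "\<And>a b. 0 \<le> a \<Longrightarrow> a < b \<Longrightarrow> a \<le> K \<Longrightarrow> b - a < d \<Longrightarrow> one_jump 1 f a b"
    using cadlag_one_jump[OF f zero_less_one] by blast
  define h where "h = d / 2"
  have h: "0 < h" "h < d" using d(1) by (auto simp: h_def)
  define B where "B n = \<bar>f 0\<bar> + (\<Sum>i\<le>n. \<bar>f (real i * h)\<bar>) + 1" for n
  have B_ge: "\<bar>f (real i * h)\<bar> + 1 \<le> B n" if "i \<le> n" for i n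
  proof -
    have "\<bar>f (real i * h)\<bar> \<le> (\<Sum>i\<le>n. \<bar>f (real i * h)\<bar>)" using that by (intro member_le_sum) auto
    then show ?thesis by (simp add: B_def)
  qed
  define n where "n = nat \<lfloor>K / h\<rfloor> + 1"
  have "\<bar>f t\<bar> \<le> B n" if t: "0 \<le> t" "t \<le> K" for t
  proof -
    define i where "i = nat \<lfloor>t / h\<rfloor>"
    have "0 \<le> t / h" using t h by simp
    then have "real i \<le> t / h" "t / h < real i + 1" by (simp_all add: i_def)
    then have it: "real i * h \<le> t" "t \<le> real (Suc i) * h" using h by (simp_all add: field_simps)
    have "t / h \<le> K / h" using t h by (intro divide_right_mono) auto
    then have "Suc i \<le> n" unfolding i_def n_def by (simp add: nat_mono floor_mono)
    moreover have "one_jump 1 f (real i * h) (real (Suc i) * h)"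
      using it t h by (intro d(2)) (auto simp: algebra_simps)
    then have "\<bar>f t\<bar> \<le> \<bar>f (real i * h)\<bar> + 1 \<or> \<bar>f t\<bar> \<le> \<bar>f (real (Suc i) * h)\<bar> + 1"
      unfolding one_jump_def using it by (smt (verit))
    ultimately show ?thesis using B_ge[of i n] B_ge[of "Suc i" n] by linarith
  qed
  then show ?thesis by (intro boundedI[of _ "B n"]) auto
qed

text \<open>Points of \<open>[K, K + 1]\<close> with persistent oscillation above a fixed level
  cannot accumulate: near an accumulation point \<open>p\<close>, a small ball around any other
  point sees only one side of \<open>p\<close>. So the discontinuities there are countable. Such
  points are wanted because \<open>J1_converges\<close> speaks only of continuity horizons.\<close>

lemma cadlag_continuity_point:
  assumes f: "f \<in> cadlag_fun" and K: "0 \<le> K"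
  obtains T where "K < T" "isCont f T"
proof -
  define B where "B k = {t\<in>{K..K+1}. \<forall>d>0. \<exists>s u. 0 \<le> s \<and> 0 \<le> u \<and> \<bar>s - t\<bar> < d \<and> \<bar>u - t\<bar> < d \<and> \<bar>f s - f u\<bar> > 1 / real (Suc k)}" for k
  have fin: "finite (B k)" for k
  proof (rule ccontr)
    assume inf: "infinite (B k)"
    have "B k \<subseteq> {K..K+1}" by (auto simp: B_def)
    with inf compact_eq_Bolzano_Weierstrass[of "{K..K+1}"] obtain p where p: "p \<in> {K..K+1}" "p islimpt B k"
      by auto
    have "0 \<le> p" "0 < 1 / real (Suc k)" using p K by auto
    from cadlag_local_osc[OF f this] obtain d where d: "0 < d" "small_osc f (1 / real (Suc k)) p d"
      by blast
    obtain t where t: "t \<in> B k" "t \<noteq> p" "dist t p < d"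
      using p(2) d(1) unfolding islimpt_approachable by blast
    \<comment> \<open>Radius for which the ball around \<open>t\<close> stays on one side of
      \<open>p\<close> and within distance \<open>d\<close> of \<open>p\<close>.\<close>
    define r where "r = min \<bar>t - p\<bar> (d - \<bar>t - p\<bar>)"
    have "r > 0" using t by (auto simp: r_def dist_real_def)
    then obtain s u where su: "0 \<le> s" "0 \<le> u" "\<bar>s - t\<bar> < r" "\<bar>u - t\<bar> < r" "\<bar>f s - f u\<bar> > 1 / real (Suc k)"
      using t(1) unfolding B_def by blast
    have "\<bar>f s - f u\<bar> \<le> 1 / real (Suc k)"
    proof (cases "p < t")
      case True
      then show ?thesis using su t by (intro small_oscD(1)[OF d(2)]) (auto simp: r_def)
    next
      case False
      then show ?thesis using su t by (intro small_oscD(2)[OF d(2)]) (auto simp: r_def)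
    qed
    then show False using su by simp
  qed
  have "countable (\<Union>k. B k)" using fin by (intro countable_UN) (auto intro: countable_finite)
  moreover have "uncountable {K<..<K+1}" by (simp add: uncountable_open_interval)
  ultimately have "\<not> {K<..<K+1} \<subseteq> (\<Union>k. B k)" using countable_subset by blast
  then obtain T where "T \<in> {K<..<K+1}" "T \<notin> (\<Union>k. B k)" by blast
  then have T: "K < T" "T < K + 1" "\<And>k. T \<notin> B k" by auto
  have "isCont f T" unfolding continuous_at_eps_delta
  proof (intro allI impI)
    fix e :: real assume "0 < e"
    then obtain k where k: "1 / real (Suc k) < e" using nat_approx_posE by blast
    obtain d where d: "0 < d" "\<And>s u. 0 \<le> s \<Longrightarrow> 0 \<le> u \<Longrightarrow> \<bar>s - T\<bar> < d \<Longrightarrow> \<bar>u - T\<bar> < d \<Longrightarrow> \<bar>f s - f u\<bar> \<le> 1 / real (Suc k)"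
      using T(1,2) T(3)[of k] unfolding B_def by (simp add: not_less) (metis linorder_not_le)
    show "\<exists>d>0. \<forall>x'. dist x' T < d \<longrightarrow> dist (f x') (f T) < e"
    proof (intro exI[of _ "min d T"] conjI allI impI)
      show "0 < min d T" using d T K by auto
      fix x' assume "dist x' T < min d T"
      then have "\<bar>f x' - f T\<bar> \<le> 1 / real (Suc k)" using T K d(1)
        by (intro d(2)) (auto simp: dist_real_def)
      then show "dist (f x') (f T) < e" using k by (simp add: dist_real_def)
    qed
  qed
  with T that show ?thesis by blast
qed

section \<open>A metric for the Skorokhod topology\<close>

text \<open>A strictly increasing surjection is continuous: extended by the identity it becomes a
  monotone surjection of the line. Compactness then makes its inverse continuous.\<close>

lemma time_changes_Icc_iff:
  fixes T :: real
  shows "l \<in> time_changes {0..T} \<longleftrightarrow> strict_mono_on {0..T} l \<and> l ` {0..T} = {0..T}"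
proof
  assume "l \<in> time_changes {0..T}"
  then show "strict_mono_on {0..T} l \<and> l ` {0..T} = {0..T}"
    unfolding time_changes_def using homeomorphism_image1 by blast
next
  assume l: "strict_mono_on {0..T} l \<and> l ` {0..T} = {0..T}"
  have maps: "0 \<le> l t \<and> l t \<le> T" if "0 \<le> t" "t \<le> T" for t
    using l that by (metis atLeastAtMost_iff imageI)
  define h where "h t = (if 0 \<le> t \<and> t \<le> T then l t else t)" for t
  have less: "h s < h t" if "s < t" for s t
    using that maps[of s] maps[of t] strict_mono_onD[OF conjunct1[OF l], of s t]
    by (cases "0 \<le> s"; cases "t \<le> T") (auto simp: h_def)
  have "\<exists>s. h s = t" for t
  proof (cases "0 \<le> t \<and> t \<le> T")
    case True
    then obtain s where "s \<in> {0..T}" "t = l s" using l by (metis atLeastAtMost_iff imageE)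
    then show ?thesis by (intro exI[of _ s]) (simp add: h_def)
  qed (auto simp: h_def)
  then have "range h = UNIV" by (metis surj_def)
  then have "continuous_on UNIV h"
    by (intro continuous_onI_mono) (auto simp: le_less intro: less)
  then have "continuous_on {0..T} h" using continuous_on_subset by blast
  then have "continuous_on {0..T} l" by (rule continuous_on_eq) (simp add: h_def)
  then show "l \<in> time_changes {0..T}" unfolding time_changes_def
    using l homeomorphism_compact[OF compact_Icc, of 0 T l "{0..T}"] strict_mono_on_imp_inj_on
    by blast
qed

lemma sup_time_change_nonneg:
  assumes T: "0 < T" and "l \<in> time_changes {0..T}"
  shows "0 \<le> (SUP t\<in>{0..T}. \<bar>l t - t\<bar>)"
proof -
  have l: "l ` {0..T} = {0..T}" using assms(2) by (simp add: time_changes_Icc_iff)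
  have "0 \<le> \<bar>l 0 - 0\<bar>" by simp
  also have "\<dots> \<le> (SUP t\<in>{0..T}. \<bar>l t - t\<bar>)"
  proof (rule cSUP_upper)
    have "\<bar>l t - t\<bar> \<le> T" if "t \<in> {0..T}" for t
    proof -
      have "l t \<in> {0..T}" using l that by blast
      then show ?thesis using that by auto
    qed
    then show "bdd_above ((\<lambda>t. \<bar>l t - t\<bar>) ` {0..T})" by (rule bdd_aboveI2)
  qed (use T in auto)
  finally show ?thesis .
qed

lemma J1_dist_nonneg:
  assumes T: "0 < T"
  shows "0 \<le> J1_dist {0..T} f g" unfolding J1_dist_def
proof (rule cINF_greatest)
  show "time_changes {0..T} \<noteq> {}"
    using time_changes_Icc_iff[of "\<lambda>x. x" T] by (auto simp: strict_mono_on_ident)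
next
  fix l assume "l \<in> time_changes {0..T}"
  then show "0 \<le> max (SUP t\<in>{0..T}. \<bar>f (l t) - g t\<bar>) (SUP t\<in>{0..T}. \<bar>l t - t\<bar>)"
    using sup_time_change_nonneg[OF T] by (simp add: le_max_iff_disj)
qed

lemma J1_dist_le:
  assumes T: "0 < T" and l: "l \<in> time_changes {0..T}"
    and le: "\<And>t. 0 \<le> t \<Longrightarrow> t \<le> T \<Longrightarrow> \<bar>f (l t) - g t\<bar> \<le> e \<and> \<bar>l t - t\<bar> \<le> e"
  shows "J1_dist {0..T} f g \<le> e"
proof -
  have "J1_dist {0..T} f g \<le> max (SUP t\<in>{0..T}. \<bar>f (l t) - g t\<bar>) (SUP t\<in>{0..T}. \<bar>l t - t\<bar>)"
    unfolding J1_dist_def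
  proof (rule cINF_lower[OF _ l], rule bdd_belowI2)
    fix l assume "l \<in> time_changes {0..T}"
    then show "0 \<le> max (SUP t\<in>{0..T}. \<bar>f (l t) - g t\<bar>) (SUP t\<in>{0..T}. \<bar>l t - t\<bar>)"
      using sup_time_change_nonneg[OF T] by (simp add: le_max_iff_disj)
  qed
  also have "\<dots> \<le> e" using T le by (intro max.boundedI cSUP_least) auto
  finally show ?thesis .
qed

text \<open>Real suprema dominate their terms only over bounded families, so boundedness of cadlag
  functions on \<open>[0, T]\<close> has to enter before pointwise bounds can be extracted from the
  infimum.\<close>

lemma J1_dist_less:
  assumes f: "f \<in> cadlag_fun" and g: "g \<in> cadlag_fun" and T: "0 < T"
    and less: "J1_dist {0..T} f g < e"
  obtains l where "l \<in> time_changes {0..T}"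
    "\<And>t. 0 \<le> t \<Longrightarrow> t \<le> T \<Longrightarrow> \<bar>f (l t) - g t\<bar> < e \<and> \<bar>l t - t\<bar> < e"
proof -
  have "time_changes {0..T} \<noteq> {}"
    using time_changes_Icc_iff[of "\<lambda>x. x" T] by (auto simp: strict_mono_on_ident)
  with less cInf_lessD obtain l where l: "l \<in> time_changes {0..T}"
    "max (SUP t\<in>{0..T}. \<bar>f (l t) - g t\<bar>) (SUP t\<in>{0..T}. \<bar>l t - t\<bar>) < e"
    unfolding J1_dist_def by (smt (verit) image_iff image_is_empty)
  have img: "l t \<in> {0..T}" if "t \<in> {0..T}" for t
    using l(1) that by (auto simp: time_changes_Icc_iff)
  obtain A B where A: "\<And>t. t \<in> {0..T} \<Longrightarrow> \<bar>f t\<bar> \<le> A" and B: "\<And>t. t \<in> {0..T} \<Longrightarrow> \<bar>g t\<bar> \<le> B"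
    using cadlag_bounded[OF f, of T, unfolded bounded_iff ball_simps, unfolded real_norm_def]
      cadlag_bounded[OF g, of T, unfolded bounded_iff ball_simps, unfolded real_norm_def]
    by blast
  have bdd1: "bdd_above ((\<lambda>t. \<bar>f (l t) - g t\<bar>) ` {0..T})"
  proof (rule bdd_aboveI2)
    fix t assume t: "t \<in> {0..T}"
    show "\<bar>f (l t) - g t\<bar> \<le> A + B" using A[OF img[OF t]] B[OF t] by linarith
  qed
  have bdd2: "bdd_above ((\<lambda>t. \<bar>l t - t\<bar>) ` {0..T})"
  proof (rule bdd_aboveI2)
    fix t assume t: "t \<in> {0..T}"
    show "\<bar>l t - t\<bar> \<le> T" using img[OF t] t by auto
  qed
  show ?thesis
  proof (rule that[OF l(1)])
    fix t assume "0 \<le> t" "t \<le> T"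
    then have "\<bar>f (l t) - g t\<bar> \<le> (SUP t\<in>{0..T}. \<bar>f (l t) - g t\<bar>)"
      "\<bar>l t - t\<bar> \<le> (SUP t\<in>{0..T}. \<bar>l t - t\<bar>)"
      by (auto intro!: cSUP_upper2[OF bdd1] cSUP_upper2[OF bdd2])
    with l(2) show "\<bar>f (l t) - g t\<bar> < e \<and> \<bar>l t - t\<bar> < e" by auto
  qed
qed

section \<open>A truncated pseudometric on paths over the half-line\<close>

definition half_line_change :: "(real \<Rightarrow> real) \<Rightarrow> bool" where
  "half_line_change l \<longleftrightarrow> strict_mono_on {0..} l \<and> l ` {0..} = {0..}"

lemma half_line_change_id: "half_line_change (\<lambda>t. t)"
  by (simp add: half_line_change_def strict_mono_on_ident)

lemma half_line_change_nonneg: "half_line_change l \<Longrightarrow> 0 \<le> t \<Longrightarrow> 0 \<le> l t"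
  unfolding half_line_change_def by (metis atLeast_iff imageI)

lemma half_line_change_less_iff:
  "half_line_change l \<Longrightarrow> 0 \<le> s \<Longrightarrow> 0 \<le> t \<Longrightarrow> l s < l t \<longleftrightarrow> s < t" unfolding half_line_change_def
  by (metis atLeast_iff strict_mono_onD linorder_neqE_linordered_idom order_less_asym order_less_irrefl)

lemma half_line_change_comp:
  assumes l: "half_line_change l" and l': "half_line_change l'"
  shows "half_line_change (\<lambda>t. l (l' t))" unfolding half_line_change_def
proof
  show "strict_mono_on {0..} (\<lambda>t. l (l' t))" by (intro strict_mono_onI)
      (simp add: half_line_change_less_iff[OF l] half_line_change_less_iff[OF l'] half_line_change_nonneg[OF l'])
  show "(\<lambda>t. l (l' t)) ` {0..} = {0..}"
    using l l' by (simp add: half_line_change_def image_image[symmetric])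
qed

lemma half_line_change_inverse:
  assumes l: "half_line_change l"
  obtains l' where "half_line_change l'" "\<And>t. 0 \<le> t \<Longrightarrow> l' (l t) = t" "\<And>t. 0 \<le> t \<Longrightarrow> l (l' t) = t"
proof -
  have inj: "inj_on l {0..}" using l by (auto simp: half_line_change_def intro: strict_mono_on_imp_inj_on)
  have img: "l ` {0..} = {0..}" using l by (simp add: half_line_change_def)
  define l' where "l' = inv_into {0..} l"
  have 1: "l' (l t) = t" if "0 \<le> t" for t using inj that by (simp add: l'_def)
  have 2: "l (l' t) = t" "0 \<le> l' t" if "0 \<le> t" for t
    using that img f_inv_into_f[of t l "{0..}"] inv_into_into[of t l "{0..}"] by (auto simp: l'_def)
  have "l' s < l' t" if "0 \<le> s" "0 \<le> t" "s < t" for s t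
    using half_line_change_less_iff[OF l, of "l' s" "l' t"] 2 that by simp
  moreover have "l' ` {0..} = {0..}"
    using 1 2 half_line_change_nonneg[OF l] by (force simp: image_iff)
  ultimately have "half_line_change l'" by (auto simp: half_line_change_def intro!: strict_mono_onI)
  with 1 2 that show ?thesis by blast
qed

text \<open>One number bounds both errors and sets the horizon, so no right end point has to be
  fixed by \<open>l\<close>. The relation is not symmetric, as the time change acts on
  \<open>f\<close>; exchanging the paths costs a factor 2.\<close>

definition J1_close :: "real \<Rightarrow> (real \<Rightarrow> real) \<Rightarrow> (real \<Rightarrow> real) \<Rightarrow> bool" where
  "J1_close e f g \<longleftrightarrow> (\<exists>l. half_line_change l \<and>
     (\<forall>t. 0 \<le> t \<and> t \<le> 1 / e \<longrightarrow> \<bar>l t - t\<bar> \<le> e \<and> \<bar>f (l t) - g t\<bar> \<le> e))"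

lemma J1_close_uniform:
  "(\<And>t. 0 \<le> t \<Longrightarrow> t \<le> 1 / e \<Longrightarrow> \<bar>f t - g t\<bar> \<le> e) \<Longrightarrow> 0 \<le> e \<Longrightarrow> J1_close e f g"
  unfolding J1_close_def using half_line_change_id by auto

lemma J1_close_mono:
  assumes "J1_close e f g" "0 < e" "e \<le> e'"
  shows "J1_close e' f g"
proof -
  have "1 / e' \<le> 1 / e" using assms by (simp add: frac_le)
  with assms show ?thesis unfolding J1_close_def by (meson order_trans)
qed

lemma J1_close_trans:
  assumes 1: "J1_close d f g" and 2: "J1_close e g h" and pos: "0 < d" "0 < e" and le: "d + e \<le> 1"
  shows "J1_close (d + e) f h"
proof -
  obtain l where l: "half_line_change l" "\<And>t. 0 \<le> t \<Longrightarrow> t \<le> 1 / d \<Longrightarrow> \<bar>l t - t\<bar> \<le> d \<and> \<bar>f (l t) - g t\<bar> \<le> d"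
    using 1 unfolding J1_close_def by auto
  obtain k where k: "half_line_change k" "\<And>t. 0 \<le> t \<Longrightarrow> t \<le> 1 / e \<Longrightarrow> \<bar>k t - t\<bar> \<le> e \<and> \<bar>g (k t) - h t\<bar> \<le> e"
    using 2 unfolding J1_close_def by auto
  \<comment> \<open>\<open>1 / d - 1 / (d + e)\<close> equals \<open>e / (d * (d + e))\<close>,
    which is at least \<open>e\<close> because \<open>d\<close> and \<open>d + e\<close> are at most
    1. Hence \<open>k t\<close> stays in the window of \<open>l\<close>.\<close>
  have "d * (d + e) \<le> 1 * 1" using pos le by (intro mult_mono) auto
  then have "e * (d * (d + e)) \<le> e * 1" using pos by (intro mult_left_mono) auto
  then have bound: "1 / (d + e) + e \<le> 1 / d" using pos by (simp add: field_simps)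
  have "\<bar>l (k t) - t\<bar> \<le> d + e \<and> \<bar>f (l (k t)) - h t\<bar> \<le> d + e" if t: "0 \<le> t" "t \<le> 1 / (d + e)" for t
  proof -
    have "1 / (d + e) \<le> 1 / e" using pos by (intro divide_left_mono) auto
    then have k2: "\<bar>k t - t\<bar> \<le> e \<and> \<bar>g (k t) - h t\<bar> \<le> e" using t by (intro k(2)) auto
    then have "\<bar>l (k t) - k t\<bar> \<le> d \<and> \<bar>f (l (k t)) - g (k t)\<bar> \<le> d"
      using t bound half_line_change_nonneg[OF k(1) t(1)] by (intro l(2)) auto
    with k2 show ?thesis by linarith
  qed
  with half_line_change_comp[OF l(1) k(1)] show ?thesis unfolding J1_close_def by blast
qed

text \<open>The inverse time change works, but its window is that of \<open>l\<close> shortened by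
  the displacement \<open>e\<close>; halving the horizon to \<open>1 / (2 * e)\<close> leaves room
  for this when \<open>e \<le> 1 / 2\<close>.\<close>

lemma J1_close_flip:
  assumes "J1_close e f g" and e: "0 < e" "e \<le> 1 / 2"
  shows "J1_close (2 * e) g f"
proof -
  obtain l where l: "half_line_change l" "\<And>t. 0 \<le> t \<Longrightarrow> t \<le> 1 / e \<Longrightarrow> \<bar>l t - t\<bar> \<le> e \<and> \<bar>f (l t) - g t\<bar> \<le> e"
    using assms unfolding J1_close_def by auto
  obtain l' where l': "half_line_change l'" "\<And>t. 0 \<le> t \<Longrightarrow> l' (l t) = t" "\<And>t. 0 \<le> t \<Longrightarrow> l (l' t) = t"
    using half_line_change_inverse[OF l(1)] by blast
  have "\<bar>l' s - s\<bar> \<le> 2 * e \<and> \<bar>g (l' s) - f s\<bar> \<le> 2 * e" if s: "0 \<le> s" "s \<le> 1 / (2 * e)" for s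
  proof -
    have l's: "0 \<le> l' s" using half_line_change_nonneg[OF l'(1) s(1)] .
    have "e * e \<le> 1 / 2 * (1 / 2)" using e by (intro mult_mono) auto
    then have "s \<le> 1 / e - e" using e s by (simp add: field_simps)
    also have "\<dots> \<le> l (1 / e)" using l(2)[of "1 / e"] e by auto
    finally have "\<not> l (1 / e) < l (l' s)" using l'(3) s by simp
    then have "l' s \<le> 1 / e" using half_line_change_less_iff[OF l(1), of "1 / e" "l' s"] l's e by auto
    then have "\<bar>l (l' s) - l' s\<bar> \<le> e \<and> \<bar>f (l (l' s)) - g (l' s)\<bar> \<le> e" using l's by (intro l(2))
    then show ?thesis using l'(3)[OF s(1)] e by auto
  qed
  with l'(1) show ?thesis unfolding J1_close_def by blast
qed

text \<open>Closeness \<open>e\<close> controls paths only on \<open>[0, 1/e]\<close>; since the windows shrink under composition of time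
  changes, the triangle inequality needs the truncation at 1.\<close>

definition jdist :: "(real \<Rightarrow> real) \<Rightarrow> (real \<Rightarrow> real) \<Rightarrow> real" where
  "jdist f g = Inf {e. 0 < e \<and> (1 \<le> e \<or> J1_close e f g \<and> J1_close e g f)}"

lemma jdist_commute: "jdist f g = jdist g f" unfolding jdist_def by (simp add: conj_commute)

lemma jdist_nonneg: "0 \<le> jdist f g"
  unfolding jdist_def by (rule cInf_greatest) (auto intro!: exI[of _ 1])

lemma jdist_le:
  assumes "0 < e" "1 \<le> e \<or> J1_close e f g \<and> J1_close e g f"
  shows "jdist f g \<le> e" unfolding jdist_def using assms
  by (intro cInf_lower bdd_belowI[of _ 0]) auto

lemma jdist_le_of_close:
  assumes "J1_close e f g" "0 < e" "e \<le> 1 / 2"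
  shows "jdist f g \<le> 2 * e"
  using assms J1_close_flip[OF assms] J1_close_mono[OF assms(1,2), of "2 * e"]
  by (intro jdist_le) auto

lemma J1_close_of_jdist_less:
  assumes "jdist f g < e" "e \<le> 1"
  shows "J1_close e f g"
proof -
  have "{e. 0 < e \<and> (1 \<le> e \<or> J1_close e f g \<and> J1_close e g f)} \<noteq> {}" by (auto intro!: exI[of _ 1])
  from cInf_lessD[OF this] assms(1) obtain d where "0 < d" "1 \<le> d \<or> J1_close d f g" "d < e"
    unfolding jdist_def by auto
  then show ?thesis using assms(2) J1_close_mono[of d f g e] by auto
qed

lemma jdist_triangle: "jdist f h \<le> jdist f g + jdist g h"
proof -
  define A where "A f g = {e. 0 < e \<and> (1 \<le> e \<or> J1_close e f g \<and> J1_close e g f)}" for f g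
  have ne: "A f g \<noteq> {}" for f g by (auto simp: A_def intro!: exI[of _ 1])
  have jA: "jdist f g = Inf (A f g)" for f g by (simp add: A_def jdist_def)
  have *: "jdist f h \<le> d + e" if d: "d \<in> A f g" and e: "e \<in> A g h" for d e
  proof (rule jdist_le)
    show "0 < d + e" using d e by (auto simp: A_def)
    show "1 \<le> d + e \<or> J1_close (d + e) f h \<and> J1_close (d + e) h f"
    proof (cases "1 \<le> d + e")
      case False
      then show ?thesis using d e J1_close_trans[of d f g e h] J1_close_trans[of e h g d f]
        by (auto simp: A_def add.commute)
    qed simp
  qed
  have "jdist f h - d \<le> jdist g h" if d: "d \<in> A f g" for d
    unfolding jA[of g h] by (rule cInf_greatest[OF ne]) (use *[OF d] in \<open>simp add: algebra_simps\<close>)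
  then have "jdist f h - jdist g h \<le> jdist f g"
    unfolding jA[of f g] by (intro cInf_greatest[OF ne]) (simp add: algebra_simps)
  then show ?thesis by simp
qed

text \<open>A continuity point beyond \<open>1 / e\<close> serves as horizon; the time change of
  \<open>[0, T]\<close> is continued by the identity, which the window of \<open>J1_close\<close>
  never sees.\<close>

lemma J1_converges_imp_jdist:
  assumes conv: "J1_converges f g" and f: "\<And>n. f n \<in> cadlag_fun" and g: "g \<in> cadlag_fun"
  shows "(\<lambda>n. jdist (f n) g) \<longlonglongrightarrow> 0"
proof (rule tendstoI)
  fix r :: real assume r: "0 < r"
  define e where "e = min (r / 3) (1 / 2)"
  have e: "0 < e" "e \<le> 1 / 2" "2 * e < r" using r by (auto simp: e_def)
  obtain T where T: "1 / e < T" "isCont g T" using cadlag_continuity_point[OF g, of "1 / e"] e by auto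
  have "0 < T" using T(1) e by (meson order_less_trans zero_less_divide_1_iff)
  then have "(\<lambda>n. J1_dist {0..T} (f n) g) \<longlonglongrightarrow> 0" using conv T unfolding J1_converges_def by auto
  then have "\<forall>\<^sub>F n in sequentially. J1_dist {0..T} (f n) g < e" using e(1) by (rule order_tendstoD)
  then show "\<forall>\<^sub>F n in sequentially. dist (jdist (f n) g) 0 < r"
  proof eventually_elim
    fix n assume "J1_dist {0..T} (f n) g < e"
    then obtain l where l: "l \<in> time_changes {0..T}"
      "\<And>t. 0 \<le> t \<Longrightarrow> t \<le> T \<Longrightarrow> \<bar>f n (l t) - g t\<bar> < e \<and> \<bar>l t - t\<bar> < e"
      using J1_dist_less[OF f g \<open>0 < T\<close>] by blast
    define k where "k t = (if t \<le> T then l t else t)" for t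
    have "half_line_change k" unfolding half_line_change_def
    proof
      have maps: "l t \<in> {0..T}" if "t \<in> {0..T}" for t
        using l(1) that by (auto simp: time_changes_Icc_iff)
      show "strict_mono_on {0..} k"
      proof (rule strict_mono_onI)
        fix s t :: real assume st: "s \<in> {0..}" "t \<in> {0..}" "s < t"
        have "strict_mono_on {0..T} l" using l(1) by (simp add: time_changes_Icc_iff)
        then show "k s < k t" using st maps[of s] strict_mono_onD[of "{0..T}" l s t]
          by (auto simp: k_def)
      qed
      have "k ` {0..} = k ` {0..T} \<union> k ` {T<..}"
        unfolding image_Un[symmetric] using \<open>0 < T\<close> by (intro arg_cong[where f="image k"]) auto
      also have "k ` {0..T} = {0..T}" using l(1) by (simp add: time_changes_Icc_iff k_def)
      also have "k ` {T<..} = {T<..}" by (simp add: k_def)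
      also have "{0..T} \<union> {T<..} = {0..}" using \<open>0 < T\<close> by auto
      finally show "k ` {0..} = {0..}" .
    qed
    moreover have "\<bar>k t - t\<bar> \<le> e \<and> \<bar>f n (k t) - g t\<bar> \<le> e" if "0 \<le> t" "t \<le> 1 / e" for t
      using l(2)[of t] that T(1) by (auto simp: k_def)
    ultimately have "J1_close e (f n) g" unfolding J1_close_def by blast
    then have "jdist (f n) g \<le> 2 * e" using e by (intro jdist_le_of_close)
    then show "dist (jdist (f n) g) 0 < r" using e jdist_nonneg[of "f n" g] by (simp add: dist_real_def)
  qed
qed

text \<open>The time change of the half-line is bent on \<open>[T - d, T]\<close>, where \<open>g\<close> is nearly constant,
  so as to map \<open>[0, T]\<close> onto itself.\<close>

lemma jdist_imp_J1_converges:
  assumes lim: "(\<lambda>n. jdist (f n) g) \<longlonglongrightarrow> 0"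
  shows "J1_converges f g" unfolding J1_converges_def
proof (intro allI impI tendstoI)
  fix T r :: real assume T: "0 < T" "isCont g T" and r: "0 < r"
  obtain d where d: "0 < d" "\<And>t. \<bar>t - T\<bar> < d \<Longrightarrow> \<bar>g t - g T\<bar> < r / 8"
    using T(2) r unfolding continuous_at_eps_delta dist_real_def by (metis divide_pos_pos zero_less_numeral)
  \<comment> \<open>\<open>c\<close> is the length of the bend: below \<open>d\<close>, so that
    \<open>g\<close> is nearly constant up to \<open>T + c\<close>, and below \<open>T\<close>.
    Taking \<open>e \<le> c / 4\<close> keeps \<open>l (T - c)\<close> below \<open>T\<close>, and
    \<open>e \<le> 1 / (T + d)\<close> makes the window reach \<open>T + d\<close>.\<close>
  define c where "c = min (min (d / 2) (T / 2)) (r / 4)"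
  have c: "0 < c" "c \<le> d / 2" "c \<le> T / 2" "c \<le> r / 4" using d T r by (auto simp: c_def)
  define e where "e = min (c / 4) (1 / (T + d))"
  have e: "0 < e" "e \<le> c / 4" "T + d \<le> 1 / e"
  proof -
    show "0 < e" "e \<le> c / 4" using c T d by (auto simp: e_def)
    then have "1 / (1 / (T + d)) \<le> 1 / e" using T d by (intro divide_left_mono) (auto simp: e_def)
    then show "T + d \<le> 1 / e" using T d by simp
  qed
  have "0 < min e 1" using e by simp
  then have "\<forall>\<^sub>F n in sequentially. jdist (f n) g < min e 1" using lim order_tendstoD(2) by blast
  then show "\<forall>\<^sub>F n in sequentially. dist (J1_dist {0..T} (f n) g) 0 < r"
  proof eventually_elim
    fix n assume "jdist (f n) g < min e 1"
    then have "J1_close (min e 1) (f n) g" by (rule J1_close_of_jdist_less) simp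
    then have "J1_close e (f n) g" using e by (elim J1_close_mono) auto
    then obtain l where l: "half_line_change l"
      "\<And>t. 0 \<le> t \<Longrightarrow> t \<le> 1 / e \<Longrightarrow> \<bar>l t - t\<bar> \<le> e \<and> \<bar>f n (l t) - g t\<bar> \<le> e"
      unfolding J1_close_def by auto
    have l2: "\<bar>l t - t\<bar> \<le> e" "\<bar>f n (l t) - g t\<bar> \<le> e" if "0 \<le> t" "t \<le> T + d" for t
      using l(2)[of t] that e(3) by auto
    obtain l' where l': "half_line_change l'" "\<And>t. 0 \<le> t \<Longrightarrow> l' (l t) = t" "\<And>t. 0 \<le> t \<Longrightarrow> l (l' t) = t"
      using half_line_change_inverse[OF l(1)] by blast
    define a where "a = T - c"
    have a: "0 < a" "a < T" using c T by (auto simp: a_def)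
    have la: "\<bar>l a - a\<bar> \<le> e" using a d by (intro l2) auto
    have laT: "l a < T" using la e c by (auto simp: a_def)
    have la0: "0 \<le> l a" using half_line_change_nonneg[OF l(1)] a by simp
    define q where "q = (T - l a) / c"
    have q: "0 < q" using laT c by (simp add: q_def)
    have qc: "q * c = T - l a" using c by (simp add: q_def)
    define k where "k t = (if t \<le> a then l t else l a + q * (t - a))" for t
    have k_less: "k s < k t" if "0 \<le> s" "s < t" for s t
    proof (cases "t \<le> a")
      case True
      then show ?thesis using half_line_change_less_iff[OF l(1), of s t] that by (simp add: k_def)
    next
      case t: False
      show ?thesis
      proof (cases "s \<le> a")
        case True
        then have "l s \<le> l a" using half_line_change_less_iff[OF l(1), of a s] that a by linarith
        moreover have "0 < q * (t - a)" using q t by simp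
        ultimately show ?thesis using t True by (simp add: k_def)
      next
        case False
        have "q * (s - a) < q * (t - a)" using q that by simp
        then show ?thesis using t False by (simp add: k_def)
      qed
    qed
    have kT: "k T = T" using a qc by (simp add: k_def a_def)
    have "l 0 = 0"
    proof (rule ccontr)
      assume "l 0 \<noteq> 0"
      then have "l (l' 0) < l 0" using half_line_change_nonneg[OF l(1), of 0] l'(3)[of 0] by simp
      then have "l' 0 < 0" using half_line_change_less_iff[OF l(1), of "l' 0" 0] half_line_change_nonneg[OF l'(1), of 0] by simp
      then show False using half_line_change_nonneg[OF l'(1), of 0] by simp
    qed
    then have k0: "k 0 = 0" using a by (simp add: k_def)
    have k_range: "0 \<le> k t" "k t \<le> T" if "0 \<le> t" "t \<le> T" for t
      using k_less[of 0 t] k_less[of t T] that k0 kT by (cases "t = 0"; cases "t = T"; auto)+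
    have k_surj: "\<exists>t\<in>{0..T}. k t = s" if s: "0 \<le> s" "s \<le> T" for s
    proof (cases "s \<le> l a")
      case True
      then have "\<not> a < l' s" using half_line_change_less_iff[OF l(1), of a "l' s"] l'(3)[OF s(1)] a
          half_line_change_nonneg[OF l'(1) s(1)] by simp
      then show ?thesis using a s l'(3) half_line_change_nonneg[OF l'(1) s(1)]
        by (intro bexI[of _ "l' s"]) (auto simp: k_def)
    next
      case False
      define t where "t = a + (s - l a) / q"
      have "s - l a \<le> q * c" using s qc by simp
      then have "(s - l a) / q \<le> c" using q by (simp add: field_simps)
      moreover have "0 < (s - l a) / q" using False q by simp
      ultimately show ?thesis using a q by (intro bexI[of _ t]) (auto simp: k_def t_def a_def)
    qed
    have "k \<in> time_changes {0..T}" unfolding time_changes_Icc_iff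
      using k_less k_range k_surj by (fastforce intro!: strict_mono_onI simp: image_iff)
    moreover have "\<bar>f n (k t) - g t\<bar> \<le> r / 2 \<and> \<bar>k t - t\<bar> \<le> r / 2" if t: "0 \<le> t" "t \<le> T" for t
    proof (cases "t \<le> a")
      case True
      then show ?thesis using l2[of t] t d e c r by (auto simp: k_def)
    next
      case False
      \<comment> \<open>On the bent part \<open>f n (k t)\<close> is close to \<open>g s\<close>,
        not to \<open>g t\<close>; both \<open>s\<close> and \<open>t\<close> lie within
        \<open>d\<close> of \<open>T\<close>, where \<open>g\<close> barely moves.\<close>
      define s where "s = l' (k t)"
      have kt: "0 \<le> k t" "k t \<le> T" using k_range t by auto
      have s0: "0 \<le> s" using half_line_change_nonneg[OF l'(1) kt(1)] by (simp add: s_def)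
      have ls: "l s = k t" using l'(3) kt by (simp add: s_def)
      have "k a < k t" using k_less[of a t] a False by simp
      then have lak: "l a < k t" by (simp add: k_def)
      then have sa: "a < s" using half_line_change_less_iff[OF l(1), of a s] a s0 ls by simp
      have "T < l (T + c)" using l2(1)[of "T + c"] T c e d by auto
      then have sT: "s < T + c" using half_line_change_less_iff[OF l(1), of s "T + c"] T c s0 ls kt by auto
      have "\<bar>f n (k t) - g s\<bar> \<le> e" using l2(2)[of s] s0 sT c d ls by auto
      moreover have "\<bar>g s - g T\<bar> < r / 8" using sa sT c d(1) by (intro d(2)) (auto simp: a_def)
      moreover have "\<bar>g t - g T\<bar> < r / 8" using t False c d(1) by (intro d(2)) (auto simp: a_def)
      moreover have "\<bar>k t - t\<bar> \<le> r / 2" using lak kt la False t(2) c(4) e(1,2) r unfolding a_def by linarith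
      ultimately show ?thesis using e(1,2) c(4) by linarith
    qed
    ultimately have "J1_dist {0..T} (f n) g \<le> r / 2" using T by (intro J1_dist_le[where l=k]) auto
    then show "dist (J1_dist {0..T} (f n) g) 0 < r" using J1_dist_nonneg[OF T(1), of "f n" g] r
      by (simp add: dist_real_def)
  qed
qed

lemma J1_converges_of_jdist_less:
  assumes "\<And>n. jdist g (f n) < inverse (real (Suc n))"
  shows "J1_converges f g"
proof (rule jdist_imp_J1_converges, rule tendsto_sandwich[OF _ _ tendsto_const LIMSEQ_inverse_real_of_nat])
  show "\<forall>\<^sub>F n in sequentially. 0 \<le> jdist (f n) g" by (simp add: jdist_nonneg)
  show "\<forall>\<^sub>F n in sequentially. jdist (f n) g \<le> inverse (real (Suc n))"
    using assms by (intro always_eventually allI) (simp add: jdist_commute less_imp_le)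
qed

lemma jdist_le_uniform:
  assumes "0 < e" "\<And>t. 0 \<le> t \<Longrightarrow> t \<le> 1 / e \<Longrightarrow> \<bar>f t - g t\<bar> \<le> e"
  shows "jdist f g \<le> e"
  using assms by (intro jdist_le disjI2 conjI J1_close_uniform) (auto simp: abs_minus_commute)

lemma jdist_self: "jdist f f = 0"
proof -
  have "jdist f f \<le> 0 + e" if "0 < e" for e using jdist_le_uniform[of e f f] that by simp
  then show ?thesis using jdist_nonneg[of f f] field_le_epsilon[of "jdist f f" 0] by fastforce
qed

section \<open>Bounded Lipschitz functionals, Borel sets and convergence in distribution\<close>

definition jlipschitz :: "real \<Rightarrow> real \<Rightarrow> ((real \<Rightarrow> real) \<Rightarrow> real) \<Rightarrow> bool" where
  "jlipschitz L B H \<longleftrightarrow> 0 \<le> L \<and> (\<forall>f\<in>cadlag_fun. \<bar>H f\<bar> \<le> B) \<and>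
     (\<forall>f\<in>cadlag_fun. \<forall>g\<in>cadlag_fun. \<bar>H f - H g\<bar> \<le> L * jdist f g)"

lemma jlipschitzD:
  assumes "jlipschitz L B H"
  shows "0 \<le> L" "f \<in> cadlag_fun \<Longrightarrow> \<bar>H f\<bar> \<le> B"
    "f \<in> cadlag_fun \<Longrightarrow> g \<in> cadlag_fun \<Longrightarrow> \<bar>H f - H g\<bar> \<le> L * jdist f g"
  using assms by (auto simp: jlipschitz_def)

lemma jlipschitz_tendsto:
  assumes H: "jlipschitz L B H" and f: "\<And>n. f n \<in> cadlag_fun" and g: "g \<in> cadlag_fun"
    and lim: "(\<lambda>n. jdist (f n) g) \<longlonglongrightarrow> 0"
  shows "(\<lambda>n. H (f n)) \<longlonglongrightarrow> H g"
proof -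
  have lim': "(\<lambda>n. L * jdist (f n) g) \<longlonglongrightarrow> 0" using tendsto_mult_left[OF lim, of L] by simp
  have "norm (H (f n) - H g) \<le> L * jdist (f n) g" for n
    using jlipschitzD(3)[OF H f g, of n] by simp
  then have "(\<lambda>n. H (f n) - H g) \<longlonglongrightarrow> 0"
    by (intro Lim_null_comparison[OF _ lim'] always_eventually) blast
  then show ?thesis by (simp add: LIM_zero_iff)
qed

text \<open>Openness in \<open>J1_topology\<close> is a condition on sequences, so sequential
  continuity is all there is to verify.\<close>

lemma jlipschitz_continuous_map:
  assumes H: "jlipschitz L B H"
  shows "continuous_map J1_topology euclideanreal H" unfolding continuous_map_def
proof (intro conjI allI impI)
  fix U :: "real set" assume "openin euclideanreal U"
  then have U: "open U" by simp
  show "openin J1_topology {x \<in> topspace J1_topology. H x \<in> U}"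
    unfolding openin_J1_topology topspace_J1_topology
  proof (intro conjI ballI allI impI)
    fix g f assume g: "g \<in> {x \<in> cadlag_fun. H x \<in> U}" and f: "(\<forall>n. f n \<in> cadlag_fun) \<and> J1_converges f g"
    then have "(\<lambda>n. H (f n)) \<longlonglongrightarrow> H g"
      by (intro jlipschitz_tendsto[OF H] J1_converges_imp_jdist) auto
    then have "\<forall>\<^sub>F n in sequentially. H (f n) \<in> U" using U g by (auto intro: topological_tendstoD)
    then show "\<forall>\<^sub>F n in sequentially. f n \<in> {x \<in> cadlag_fun. H x \<in> U}"
      by eventually_elim (use f in auto)
  qed auto
qed auto

lemma space_J1_borel [simp]: "space J1_borel = cadlag_fun"
  by (simp add: J1_borel_def space_measure_of_conv)

lemma sets_J1_borel: "sets J1_borel = sigma_sets cadlag_fun {U. openin J1_topology U}"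
  unfolding J1_borel_def using openin_subset[of J1_topology] topspace_J1_topology
  by (intro sets_measure_of) auto

lemma continuous_map_measurable_J1:
  assumes "continuous_map J1_topology euclideanreal F"
  shows "F \<in> borel_measurable J1_borel"
proof (rule borel_measurableI)
  fix S :: "real set" assume "open S"
  then have "openin J1_topology {x \<in> topspace J1_topology. F x \<in> S}"
    using assms by (auto simp: continuous_map_def)
  moreover have "{x \<in> topspace J1_topology. F x \<in> S} = F -` S \<inter> space J1_borel"
    by (auto simp: topspace_J1_topology)
  ultimately show "F -` S \<inter> space J1_borel \<in> sets J1_borel"
    unfolding sets_J1_borel by (auto intro: sigma_sets.Basic)
qed

lemma jlipschitz_measurable: "jlipschitz L B H \<Longrightarrow> H \<in> borel_measurable J1_borel"
  by (intro continuous_map_measurable_J1 jlipschitz_continuous_map)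

text \<open>For an open \<open>U\<close> with complement \<open>C\<close>, the distance to
  \<open>C\<close> is a Lipschitz functional that is positive exactly on \<open>U\<close>, so one
  measurable real function decides membership. It is positive on \<open>U\<close> because otherwise
  a sequence in \<open>C\<close> would converge in \<open>J1\<close> to a point of
  \<open>U\<close>.\<close>

lemma measurable_J1_borelI:
  assumes X: "\<And>w. w \<in> space M \<Longrightarrow> X w \<in> cadlag_fun"
    and H: "\<And>L B H. jlipschitz L B H \<Longrightarrow> (\<lambda>w. H (X w)) \<in> borel_measurable M"
  shows "X \<in> measurable M J1_borel" unfolding J1_borel_def
proof (rule measurable_measure_of)
  show "{U. openin J1_topology U} \<subseteq> Pow cadlag_fun"
    using openin_subset[of J1_topology] topspace_J1_topology by auto
  show "X \<in> space M \<rightarrow> cadlag_fun" using X by auto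
next
  fix U assume "U \<in> {U. openin J1_topology U}"
  then have U: "U \<subseteq> cadlag_fun"
    "\<And>g f. g \<in> U \<Longrightarrow> (\<And>n. f n \<in> cadlag_fun) \<Longrightarrow> J1_converges f g \<Longrightarrow> \<forall>\<^sub>F n in sequentially. f n \<in> U"
    by (auto simp: openin_J1_topology)
  show "X -` U \<inter> space M \<in> sets M"
  \<comment> \<open>The whole space is treated apart, because the infimum over an empty complement
    has no meaning.\<close>
  proof (cases "U = cadlag_fun")
    case True
    then have "X -` U \<inter> space M = space M" using X by auto
    then show ?thesis by simp
  next
    case False
    define C where "C = cadlag_fun - U"
    have C: "C \<noteq> {}" using False U(1) by (auto simp: C_def)
    define p where "p x = (INF y\<in>C. jdist x y)" for x
    have bdd: "bdd_below ((\<lambda>y. jdist x y) ` C)" for x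
      by (rule bdd_belowI2[of _ 0]) (rule jdist_nonneg)
    have p_nonneg: "0 \<le> p x" for x
      unfolding p_def by (rule cINF_greatest[OF C]) (rule jdist_nonneg)
    have p_le: "p x \<le> jdist x y" if "y \<in> C" for x y
      unfolding p_def by (rule cINF_lower[OF bdd that])
    have tri: "p x \<le> jdist x z + p z" for x z
    proof -
      have "p x - jdist x z \<le> p z" unfolding p_def[of z]
      proof (rule cINF_greatest[OF C])
        fix y assume "y \<in> C"
        then show "p x - jdist x z \<le> jdist z y" using p_le[of y x] jdist_triangle[of x y z] by simp
      qed
      then show ?thesis by simp
    qed
    have "jlipschitz 1 1 p" unfolding jlipschitz_def
    proof (intro conjI ballI)
      fix f g :: "real \<Rightarrow> real"
      show "\<bar>p f - p g\<bar> \<le> 1 * jdist f g"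
        using tri[of f g] tri[of g f] jdist_commute[of f g] by auto
      obtain y where "y \<in> C" using C by blast
      moreover have "jdist f y \<le> 1" by (rule jdist_le) auto
      ultimately show "\<bar>p f\<bar> \<le> 1" using p_le[of y f] p_nonneg[of f] by auto
    qed auto
    then have [measurable]: "(\<lambda>w. p (X w)) \<in> borel_measurable M" by (rule H)
    have "0 < p x" if x: "x \<in> U" for x
    proof (rule ccontr)
      assume "\<not> 0 < p x"
      then have "\<exists>y. y \<in> C \<and> jdist x y < inverse (real (Suc n))" for n
        using cInf_lessD[of "(\<lambda>y. jdist x y) ` C" "inverse (real (Suc n))"] C
        unfolding p_def by (smt (verit) image_iff image_is_empty inverse_positive_iff_positive of_nat_0_less_iff zero_less_Suc)
      then obtain y where y: "\<And>n. y n \<in> C" "\<And>n. jdist x (y n) < inverse (real (Suc n))" by metis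
      from y(2) have "J1_converges y x" by (rule J1_converges_of_jdist_less)
      then have "\<forall>\<^sub>F n in sequentially. y n \<in> U" using U(2)[OF x, of y] y(1) unfolding C_def by blast
      then show False using y(1) by (auto simp: C_def eventually_sequentially)
    qed
    moreover have "p x \<le> 0" if "x \<in> C" for x
      using p_le[OF that, of x] by (simp add: jdist_self)
    ultimately have "X -` U \<inter> space M = {w \<in> space M. 0 < p (X w)}"
      using X U(1) unfolding C_def by fastforce
    then show ?thesis by simp
  qed
qed

lemma measurable_J1_borel_limit:
  assumes X: "\<And>m. X m \<in> measurable M J1_borel"
    and Y: "\<And>w. w \<in> space M \<Longrightarrow> Y w \<in> cadlag_fun"
    and lim: "\<And>w. w \<in> space M \<Longrightarrow> (\<lambda>m. jdist (X m w) (Y w)) \<longlonglongrightarrow> 0"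
  shows "Y \<in> measurable M J1_borel"
proof (rule measurable_J1_borelI[OF Y])
  fix L B H assume H: "jlipschitz L B H"
  show "(\<lambda>w. H (Y w)) \<in> borel_measurable M"
  proof (rule borel_measurable_LIMSEQ_real)
    fix w assume w: "w \<in> space M"
    show "(\<lambda>m. H (X m w)) \<longlonglongrightarrow> H (Y w)"
      using w measurable_space[OF X w] by (intro jlipschitz_tendsto[OF H] lim Y) auto
  next
    fix m show "(\<lambda>w. H (X m w)) \<in> borel_measurable M"
      using measurable_compose[OF X jlipschitz_measurable[OF H]] .
  qed
qed auto

text \<open>A bounded continuous \<open>F\<close> is the limit from below of the Lipschitz functions
  \<open>\<lambda>x. INF y. F y + k * jdist x y\<close>.\<close>

lemma J1_converges_in_distributionI:
  assumes M: "prob_space M" and N: "prob_space N"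
    and X: "\<And>n. X n \<in> measurable M J1_borel" and Y: "Y \<in> measurable N J1_borel"
    and lim: "\<And>L B H. jlipschitz L B H \<Longrightarrow> (\<lambda>n. \<integral>w. H (X n w) \<partial>M) \<longlonglongrightarrow> (\<integral>v. H (Y v) \<partial>N)"
  shows "J1_converges_in_distribution M X N Y"
proof -
  interpret M: prob_space M by fact
  interpret N: prob_space N by fact
  note Xs = measurable_space[OF X, simplified] and Ys = measurable_space[OF Y, simplified]
  \<comment> \<open>Only the lower half is proved; applied to \<open>- F\<close> it gives the upper
    half.\<close>
  have lower: "\<forall>\<^sub>F n in sequentially. (\<integral>v. F (Y v) \<partial>N) - r < (\<integral>w. F (X n w) \<partial>M)"
    if F: "continuous_map J1_topology euclideanreal F" and FB: "\<And>x. x \<in> cadlag_fun \<Longrightarrow> \<bar>F x\<bar> \<le> B"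
      and r: "0 < r" for F B r
  proof -
    have ne: "cadlag_fun \<noteq> {}" using M.not_empty Xs[of _ 0] by auto
    have B: "0 \<le> B" using ne FB by (metis abs_ge_zero all_not_in_conv order_trans)
    have Fm: "F \<in> borel_measurable J1_borel" using F by (rule continuous_map_measurable_J1)
    define G where "G k x = (INF y\<in>cadlag_fun. F y + real k * jdist x y)" for k :: nat and x
    have low: "- B \<le> F y + real k * jdist x y" if "y \<in> cadlag_fun" for k x y
    proof -
      have "0 \<le> real k * jdist x y" using jdist_nonneg by simp
      with FB[OF that] show ?thesis by linarith
    qed
    have bdd: "bdd_below ((\<lambda>y. F y + real k * jdist x y) ` cadlag_fun)" for k x
      by (rule bdd_belowI2[of _ "- B"]) (rule low)
    have G_low: "- B \<le> G k x" for k x unfolding G_def by (intro cINF_greatest ne low)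
    have G_le: "G k x \<le> F y + real k * jdist x y" if "y \<in> cadlag_fun" for k x y
      unfolding G_def by (intro cINF_lower bdd that)
    have G_F: "G k x \<le> F x" if "x \<in> cadlag_fun" for k x
      using G_le[OF that, of k x] by (simp add: jdist_self)
    have tri: "G k x \<le> real k * jdist x z + G k z" for k x z
    proof -
      have "G k x - real k * jdist x z \<le> G k z" unfolding G_def[of k z]
      proof (rule cINF_greatest[OF ne])
        fix y assume "y \<in> cadlag_fun"
        have "real k * jdist x y \<le> real k * (jdist x z + jdist z y)"
          by (intro mult_left_mono jdist_triangle) auto
        with G_le[OF \<open>y \<in> cadlag_fun\<close>, of k x] show "G k x - real k * jdist x z \<le> F y + real k * jdist z y"
          by (simp add: distrib_left)
      qed
      then show ?thesis by simp
    qed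
    have G: "jlipschitz (real k) B (G k)" for k unfolding jlipschitz_def
    proof (intro conjI ballI)
      fix f g :: "real \<Rightarrow> real"
      show "\<bar>G k f - G k g\<bar> \<le> real k * jdist f g"
        using tri[of k f g] tri[of k g f] jdist_commute[of f g] by auto
    next
      fix f :: "real \<Rightarrow> real" assume "f \<in> cadlag_fun"
      then show "\<bar>G k f\<bar> \<le> B" using G_low[of k f] G_F[of f k] FB[of f] by auto
    qed auto
    have G_lim: "(\<lambda>k. G k x) \<longlonglongrightarrow> F x" if x: "x \<in> cadlag_fun" for x
    proof (rule tendstoI)
      fix e :: real assume e: "0 < e"
      have "\<exists>d>0. \<forall>y\<in>cadlag_fun. jdist x y < d \<longrightarrow> F x - e / 2 < F y"
      proof (rule ccontr)
        assume contra: "\<not> ?thesis"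
        have "\<exists>y. y \<in> cadlag_fun \<and> jdist x y < inverse (real (Suc n)) \<and> F y \<le> F x - e / 2" for n
          using contra by (metis inverse_positive_iff_positive not_less of_nat_0_less_iff zero_less_Suc)
        then obtain y where y: "\<And>n. y n \<in> cadlag_fun" "\<And>n. jdist x (y n) < inverse (real (Suc n))"
          "\<And>n. F (y n) \<le> F x - e / 2" by metis
        from y(2) have conv: "J1_converges y x" by (rule J1_converges_of_jdist_less)
        have "openin J1_topology {z \<in> topspace J1_topology. F z \<in> {F x - e / 2<..}}"
          using F unfolding continuous_map_def by (metis open_greaterThan open_openin)
        then have "\<forall>\<^sub>F n in sequentially. y n \<in> {z \<in> topspace J1_topology. F z \<in> {F x - e / 2<..}}"
          unfolding openin_J1_topology using conv x y(1) e by (auto simp: topspace_J1_topology)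
        then show False using y(3) by (auto simp: eventually_sequentially not_less[symmetric])
      qed
      then obtain d where d: "0 < d" "\<And>y. y \<in> cadlag_fun \<Longrightarrow> jdist x y < d \<Longrightarrow> F x - e / 2 < F y" by auto
      \<comment> \<open>From \<open>2 * B / d\<close> on, the penalty \<open>k * jdist x y\<close>
        outside the \<open>d\<close>-ball makes up for the full range \<open>2 * B\<close> of
        \<open>F\<close>.\<close>
      obtain k0 :: nat where k0: "2 * B / d \<le> real k0" using real_arch_simple by blast
      have "dist (G k x) (F x) < e" if "k0 \<le> k" for k
      proof -
        have "F x - e / 2 \<le> G k x" unfolding G_def
        proof (rule cINF_greatest[OF ne])
          fix y assume y: "y \<in> cadlag_fun"
          show "F x - e / 2 \<le> F y + real k * jdist x y"
          proof (cases "jdist x y < d")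
            case True
            moreover have "0 \<le> real k * jdist x y" using jdist_nonneg by simp
            ultimately show ?thesis using d(2)[OF y] by linarith
          next
            case False
            have "2 * B / d \<le> real k" using k0 that by linarith
            then have "2 * B \<le> real k * d" using d(1) by (simp add: field_simps)
            also have "\<dots> \<le> real k * jdist x y" using False by (intro mult_left_mono) auto
            finally show ?thesis using FB[OF x] FB[OF y] e by linarith
          qed
        qed
        then show ?thesis using G_F[OF x, of k] e by (simp add: dist_real_def)
      qed
      then show "\<forall>\<^sub>F k in sequentially. dist (G k x) (F x) < e"
        unfolding eventually_sequentially by blast
    qed
    have Gm: "G k \<in> borel_measurable J1_borel" for k using G by (rule jlipschitz_measurable)
    have "(\<lambda>k. \<integral>v. G k (Y v) \<partial>N) \<longlonglongrightarrow> (\<integral>v. F (Y v) \<partial>N)"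
      using Ys jlipschitzD(2)[OF G] measurable_compose[OF Y Fm] measurable_compose[OF Y Gm]
      by (intro integral_dominated_convergence[where w="\<lambda>_. B"]) (auto intro: G_lim)
    then have "\<forall>\<^sub>F k in sequentially. (\<integral>v. F (Y v) \<partial>N) - r / 2 < (\<integral>v. G k (Y v) \<partial>N)"
      using r by (intro order_tendstoD(1)) auto
    then obtain k where k: "(\<integral>v. F (Y v) \<partial>N) - r / 2 < (\<integral>v. G k (Y v) \<partial>N)"
      by (auto simp: eventually_sequentially)
    have "\<forall>\<^sub>F n in sequentially. (\<integral>v. G k (Y v) \<partial>N) - r / 2 < (\<integral>w. G k (X n w) \<partial>M)"
      using r by (intro order_tendstoD(1)[OF lim[OF G]]) auto
    then show ?thesis
    proof eventually_elim
      fix n assume n: "(\<integral>v. G k (Y v) \<partial>N) - r / 2 < (\<integral>w. G k (X n w) \<partial>M)"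
      have "(\<integral>w. G k (X n w) \<partial>M) \<le> (\<integral>w. F (X n w) \<partial>M)"
      proof (rule integral_mono)
        show "integrable M (\<lambda>w. G k (X n w))" by (rule M.integrable_const_bound[of _ B])
            (use Xs jlipschitzD(2)[OF G] measurable_compose[OF X Gm] in auto)
        show "integrable M (\<lambda>w. F (X n w))" by (rule M.integrable_const_bound[of _ B])
            (use Xs FB measurable_compose[OF X Fm] in auto)
      qed (use Xs G_F in auto)
      then show "(\<integral>v. F (Y v) \<partial>N) - r < (\<integral>w. F (X n w) \<partial>M)" using n k by linarith
    qed
  qed
  show ?thesis unfolding J1_converges_in_distribution_def
  proof (intro conjI allI impI X Y)
    fix F assume "continuous_map J1_topology euclideanreal F \<and> bounded (F ` cadlag_fun)"
    then have F: "continuous_map J1_topology euclideanreal F" and "bounded (F ` cadlag_fun)" by auto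
    then obtain B where FB: "\<And>x. x \<in> cadlag_fun \<Longrightarrow> \<bar>F x\<bar> \<le> B" by (auto simp: bounded_iff)
    have F': "continuous_map J1_topology euclideanreal (\<lambda>x. - F x)"
      using F by (intro continuous_map_minus)
    show "(\<lambda>n. \<integral>w. F (X n w) \<partial>M) \<longlonglongrightarrow> (\<integral>v. F (Y v) \<partial>N)"
    proof (rule tendstoI)
      fix r :: real assume r: "0 < r"
      have "\<forall>\<^sub>F n in sequentially. (\<integral>v. - F (Y v) \<partial>N) - r < (\<integral>w. - F (X n w) \<partial>M)"
        by (rule lower[OF F' _ r, of B]) (use FB in auto)
      moreover have "\<forall>\<^sub>F n in sequentially. (\<integral>v. F (Y v) \<partial>N) - r < (\<integral>w. F (X n w) \<partial>M)"
        by (rule lower[OF F _ r, of B]) (use FB in auto)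
      ultimately show "\<forall>\<^sub>F n in sequentially. dist (\<integral>w. F (X n w) \<partial>M) (\<integral>v. F (Y v) \<partial>N) < r"
        by eventually_elim (auto simp: dist_real_def abs_if)
    qed
  qed
qed

section \<open>Step paths and discretisation on a grid\<close>

definition stepfun :: "real \<Rightarrow> (nat \<Rightarrow> real) \<Rightarrow> real \<Rightarrow> real" where
  "stepfun c x = (\<lambda>t\<in>{0..}. x (nat \<lfloor>c * t\<rfloor>))"

lemma stepfun_apply: "0 \<le> t \<Longrightarrow> stepfun c x t = x (nat \<lfloor>c * t\<rfloor>)" by (simp add: stepfun_def)

lemma stepfun_cadlag:
  assumes c: "0 \<le> c"
  shows "stepfun c x \<in> cadlag_fun" unfolding stepfun_def
proof (rule cadlag_funI)
  let ?f = "\<lambda>t. x (nat \<lfloor>c * t\<rfloor>)"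
  fix t :: real
  show "(?f \<longlongrightarrow> ?f t) (at_right t)"
  proof (cases "c = 0")
    case False
    with c have c: "0 < c" by simp
    have "?f s = ?f t" if "t < s" "s < (of_int \<lfloor>c * t\<rfloor> + 1) / c" for s
    proof -
      have "c * t \<le> c * s" using that c by simp
      then have "of_int \<lfloor>c * t\<rfloor> \<le> c * s" by linarith
      moreover have "c * s < of_int \<lfloor>c * t\<rfloor> + 1" using that c by (simp add: field_simps)
      ultimately have "\<lfloor>c * s\<rfloor> = \<lfloor>c * t\<rfloor>" by (simp add: floor_unique)
      then show ?thesis by simp
    qed
    moreover have "t < (of_int \<lfloor>c * t\<rfloor> + 1) / c" using c by (simp add: pos_less_divide_eq mult.commute)
    ultimately show ?thesis
      by (intro tendsto_eventually) (auto simp: eventually_at_right_field)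
  qed simp
  show "\<exists>l. (?f \<longlongrightarrow> l) (at_left t)"
  proof (cases "c = 0")
    case False
    with c have c: "0 < c" by simp
    have "?f s = x (nat (\<lceil>c * t\<rceil> - 1))" if "(of_int \<lceil>c * t\<rceil> - 1) / c < s" "s < t" for s
    proof -
      have "of_int \<lceil>c * t\<rceil> - 1 \<le> c * s" using that c by (simp add: field_simps)
      moreover have "c * s < c * t" using that c by simp
      then have "c * s < of_int \<lceil>c * t\<rceil>" by linarith
      ultimately have "\<lfloor>c * s\<rfloor> = \<lceil>c * t\<rceil> - 1" by (intro floor_unique) auto
      then show ?thesis by simp
    qed
    moreover have "of_int \<lceil>c * t\<rceil> - 1 < c * t" by linarith
    then have "(of_int \<lceil>c * t\<rceil> - 1) / c < t" using c by (simp add: field_simps)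
    ultimately show ?thesis
      by (intro exI tendsto_eventually) (auto simp: eventually_at_left_field)
  qed (auto intro: exI[of _ "x 0"])
qed

text \<open>The window \<open>[0, 1 / e]\<close> meets finitely many steps, so convergence of each
  coordinate is uniform there. This makes Lipschitz functionals of step paths continuous functions
  of the coordinates.\<close>

lemma stepfun_tendsto:
  assumes c: "0 \<le> c" and lim: "\<And>i. (\<lambda>n. x n i) \<longlonglongrightarrow> y i"
  shows "(\<lambda>n. jdist (stepfun c (x n)) (stepfun c y)) \<longlonglongrightarrow> 0"
proof (rule tendstoI)
  fix r :: real assume r: "0 < r"
  define e where "e = r / 2"
  have e: "0 < e" "e < r" using r by (auto simp: e_def)
  have "\<forall>\<^sub>F n in sequentially. \<forall>i\<in>{..nat \<lfloor>c / e\<rfloor>}. dist (x n i) (y i) < e"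
    using e by (intro eventually_ball_finite ballI tendstoD[OF lim]) auto
  then show "\<forall>\<^sub>F n in sequentially. dist (jdist (stepfun c (x n)) (stepfun c y)) 0 < r"
  proof eventually_elim
    fix n assume n: "\<forall>i\<in>{..nat \<lfloor>c / e\<rfloor>}. dist (x n i) (y i) < e"
    have "jdist (stepfun c (x n)) (stepfun c y) \<le> e"
    proof (rule jdist_le_uniform[OF e(1)])
      fix t assume t: "0 \<le> t" "t \<le> 1 / e"
      have "c * t \<le> c * (1 / e)" using t c by (intro mult_left_mono)
      then have "nat \<lfloor>c * t\<rfloor> \<le> nat \<lfloor>c / e\<rfloor>" by (intro nat_mono floor_mono) simp
      with n have "dist (x n (nat \<lfloor>c * t\<rfloor>)) (y (nat \<lfloor>c * t\<rfloor>)) < e" by simp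
      then show "\<bar>stepfun c (x n) t - stepfun c y t\<bar> \<le> e" using t by (simp add: stepfun_apply dist_real_def)
    qed
    then show "dist (jdist (stepfun c (x n)) (stepfun c y)) 0 < r"
      using e jdist_nonneg[of "stepfun c (x n)" "stepfun c y"] by (simp add: dist_real_def)
  qed
qed

abbreviation seq_borel :: "(nat \<Rightarrow> real) measure" where
  "seq_borel \<equiv> \<Pi>\<^sub>M i\<in>UNIV. borel"

text \<open>On countably many real coordinates the product sigma-algebra is the Borel one of the
  product topology, in which sequential continuity is continuity.\<close>

lemma measurable_of_pointwise_continuous:
  fixes G :: "(nat \<Rightarrow> real) \<Rightarrow> real"
  assumes lim: "\<And>x y. (\<And>i. (\<lambda>n. x n i) \<longlonglongrightarrow> y i) \<Longrightarrow> (\<lambda>n. G (x n)) \<longlonglongrightarrow> G y"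
  shows "G \<in> borel_measurable seq_borel"
proof -
  have "isCont G y" for y
  proof (rule continuous_at_sequentiallyI)
    fix x :: "nat \<Rightarrow> nat \<Rightarrow> real" assume x: "x \<longlonglongrightarrow> y"
    have "(\<lambda>n. x n i) \<longlonglongrightarrow> y i" for i
    proof -
      have "continuous_on UNIV (\<lambda>z :: nat \<Rightarrow> real. z i)" by (rule continuous_on_product_coordinates)
      then have "isCont (\<lambda>z :: nat \<Rightarrow> real. z i) y" unfolding continuous_on_eq_continuous_at[OF open_UNIV] by blast
      then show ?thesis using x by (rule isCont_tendsto_compose)
    qed
    then show "(\<lambda>n. G (x n)) \<longlonglongrightarrow> G y" by (rule lim)
  qed
  then have "G \<in> borel_measurable borel"
    by (intro borel_measurable_continuous_onI continuous_at_imp_continuous_on) auto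
  then show ?thesis using measurable_cong_sets[OF sets_PiM_equal_borel refl] by blast
qed

lemma stepfun_measurable:
  assumes c: "0 \<le> c"
  shows "stepfun c \<in> measurable seq_borel J1_borel"
proof (rule measurable_J1_borelI)
  fix L B H assume H: "jlipschitz L B H"
  show "(\<lambda>x. H (stepfun c x)) \<in> borel_measurable seq_borel"
    by (intro measurable_of_pointwise_continuous jlipschitz_tendsto[OF H] stepfun_cadlag stepfun_tendsto c)
qed (rule stepfun_cadlag[OF c])

lemma stepfun_measurable_compose:
  assumes "0 \<le> c" "\<And>i. (\<lambda>w. X w i) \<in> borel_measurable M"
  shows "(\<lambda>w. stepfun c (X w)) \<in> measurable M J1_borel"
  by (rule measurable_compose[OF _ stepfun_measurable[OF assms(1)]])
    (rule measurable_PiM_single', use assms in auto)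

text \<open>The time change is linear on each cell of length \<open>1 / c\<close> and takes the grid
  point \<open>i / c\<close> to \<open>s i\<close>.\<close>

lemma half_line_change_interpolate:
  fixes s :: "nat \<Rightarrow> real"
  assumes s0: "s 0 = 0" and inc: "\<And>i. s i < s (Suc i)" and unb: "\<And>r. \<exists>i. r < s i" and c: "0 < c"
  obtains l where "half_line_change l"
    "\<And>t. 0 \<le> t \<Longrightarrow> s (nat \<lfloor>c * t\<rfloor>) \<le> l t \<and> l t < s (Suc (nat \<lfloor>c * t\<rfloor>))"
proof -
  define D where "D i = s (Suc i) - s i" for i
  have D: "0 < D i" for i using inc[of i] by (simp add: D_def)
  define l where "l t = s (nat \<lfloor>c * t\<rfloor>) + frac (c * t) * D (nat \<lfloor>c * t\<rfloor>)" for t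
  have l: "s (nat \<lfloor>c * t\<rfloor>) \<le> l t \<and> l t < s (Suc (nat \<lfloor>c * t\<rfloor>))" for t
  proof -
    have "frac (c * t) * D (nat \<lfloor>c * t\<rfloor>) < 1 * D (nat \<lfloor>c * t\<rfloor>)"
      using D by (intro mult_strict_right_mono) (simp add: frac_lt_1)
    moreover have "0 \<le> frac (c * t) * D (nat \<lfloor>c * t\<rfloor>)" using D[of "nat \<lfloor>c * t\<rfloor>"] by simp
    ultimately show ?thesis unfolding l_def by (simp add: D_def)
  qed
  have mono: "mono s" using inc by (simp add: incseq_Suc_iff less_imp_le)
  have less: "l t < l u" if "0 \<le> t" "t < u" for t u
  proof -
    have ct: "c * t < c * u" "0 \<le> c * t" using that c by auto
    then have le: "\<lfloor>c * t\<rfloor> \<le> \<lfloor>c * u\<rfloor>" by (intro floor_mono) simp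
    show ?thesis
    proof (cases "\<lfloor>c * t\<rfloor> = \<lfloor>c * u\<rfloor>")
      case True
      then have "frac (c * t) < frac (c * u)" using ct by (simp add: frac_def)
      then show ?thesis using D True by (simp add: l_def)
    next
      case False
      with le ct have "Suc (nat \<lfloor>c * t\<rfloor>) \<le> nat \<lfloor>c * u\<rfloor>" by linarith
      then have "s (Suc (nat \<lfloor>c * t\<rfloor>)) \<le> s (nat \<lfloor>c * u\<rfloor>)" using mono by (simp add: mono_def)
      then show ?thesis using l[of t] l[of u] by linarith
    qed
  qed
  have surj: "\<exists>t\<ge>0. l t = r" if r: "0 \<le> r" for r
  proof -
    define k where "k = (LEAST i. r < s i)"
    have k: "r < s k" unfolding k_def using unb by (rule LeastI_ex)
    then have "k \<noteq> 0" using s0 r by (metis not_less)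
    then obtain i where i: "k = Suc i" by (metis not0_implies_Suc)
    have "s i \<le> r" using not_less_Least[of i "\<lambda>i. r < s i"] i k_def by auto
    define a where "a = (r - s i) / D i"
    have a: "0 \<le> a" "a < 1" using \<open>s i \<le> r\<close> k i D[of i] by (auto simp: a_def D_def)
    have ca: "c * ((real i + a) / c) = real i + a" using c by simp
    have fl: "\<lfloor>real i + a\<rfloor> = int i" using a by (intro floor_unique) auto
    have "l ((real i + a) / c) = r"
      unfolding l_def ca fl frac_def using D[of i] by (simp add: a_def)
    then show ?thesis using a c by (intro exI[of _ "(real i + a) / c"]) auto
  qed
  have "0 \<le> l t" for t using l[of t] mono s0 by (metis le0 monoD order_trans)
  with surj have "l ` {0..} = {0..}" by (force simp: image_iff)
  with less have "half_line_change l" by (auto simp: half_line_change_def intro!: strict_mono_onI)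
  with l that show ?thesis by blast
qed

definition grid_path :: "nat \<Rightarrow> (real \<Rightarrow> real) \<Rightarrow> real \<Rightarrow> real" where
  "grid_path m f = stepfun (real m) (\<lambda>i. f (real i / real m))"

lemma grid_path_cadlag: "grid_path m f \<in> cadlag_fun"
  unfolding grid_path_def by (rule stepfun_cadlag) simp

text \<open>If \<open>f\<close> is nearly a one-jump function on each grid cell, moving its jump to the right end of
  the cell produces a function close to the discretisation of \<open>f\<close>.\<close>

lemma J1_close_discretise:
  fixes f :: "real \<Rightarrow> real" and m K :: nat
  assumes m: "0 < m" and e: "0 < e" "2 / real m \<le> e" and K: "1 / e < real K / real m"
    and cell: "\<And>i. i < K \<Longrightarrow> one_jump e f (real i / real m) (real (Suc i) / real m)"
  shows "J1_close e f (grid_path m f)"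
proof -
  obtain \<tau> where \<tau>: "\<And>i. i < K \<Longrightarrow> real i / real m < \<tau> i \<and> \<tau> i \<le> real (Suc i) / real m"
    "\<And>i t. i < K \<Longrightarrow> real i / real m \<le> t \<Longrightarrow> t < \<tau> i \<Longrightarrow> \<bar>f t - f (real i / real m)\<bar> \<le> e"
    "\<And>i t. i < K \<Longrightarrow> \<tau> i \<le> t \<Longrightarrow> t \<le> real (Suc i) / real m \<Longrightarrow> \<bar>f t - f (real (Suc i) / real m)\<bar> \<le> e"
    using cell unfolding one_jump_def by metis
  \<comment> \<open>The grid point \<open>(j + 1) / m\<close> is to be sent to the jump time of cell
    \<open>j\<close>; past the first \<open>K\<close> cells the grid points stay fixed.\<close>
  define s where "s i = (case i of 0 \<Rightarrow> 0 | Suc j \<Rightarrow> if j < K then \<tau> j else real (Suc j) / real m)" for i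
  have sSuc: "real i / real m < s (Suc i)" "s (Suc i) \<le> real (Suc i) / real m" for i
    using \<tau>(1)[of i] m by (auto simp: s_def divide_strict_right_mono)
  have s0: "s 0 = 0" by (simp add: s_def)
  have inc: "s i < s (Suc i)" for i
    using sSuc(1)[of i] sSuc(2)[of "i - 1"] s0 by (cases i) auto
  have unb: "\<exists>i. r < s i" for r
  proof -
    obtain i :: nat where "r * real m \<le> real i" using real_arch_simple by blast
    then have "r \<le> real i / real m" using m by (simp add: field_simps)
    then show ?thesis using sSuc(1)[of i] by (intro exI[of _ "Suc i"]) linarith
  qed
  obtain l where l: "half_line_change l"
    "\<And>t. 0 \<le> t \<Longrightarrow> s (nat \<lfloor>real m * t\<rfloor>) \<le> l t \<and> l t < s (Suc (nat \<lfloor>real m * t\<rfloor>))"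
    using half_line_change_interpolate[OF s0 inc unb, of "real m"] m by auto
  have "\<bar>l t - t\<bar> \<le> e \<and> \<bar>f (l t) - grid_path m f t\<bar> \<le> e"
    if t: "0 \<le> t" "t \<le> 1 / e" for t
  proof -
    define i where "i = nat \<lfloor>real m * t\<rfloor>"
    have "real i \<le> real m * t" "real m * t < real (Suc i)"
      using t m unfolding i_def by (simp_all) linarith
    then have it: "real i / real m \<le> t" "t < real (Suc i) / real m"
      using m by (simp_all add: field_simps)
    have "real i / real m < real K / real m" using it t K by linarith
    then have iK: "i < K" using m by (simp add: divide_less_cancel)
    have lt: "s i \<le> l t" "l t < s (Suc i)" using l(2)[OF t(1)] by (auto simp: i_def)
    have si: "real i / real m - 1 / real m \<le> s i"
    proof (cases i)
      case (Suc j)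
      then show ?thesis using sSuc(1)[of j] m by (simp add: field_simps)
    qed (simp add: s0)
    have split: "real (Suc i) / real m = real i / real m + 1 / real m" "2 / real m = 1 / real m + 1 / real m"
      by (simp_all add: add_divide_distrib)
    have pos: "0 < 1 / real m" using m by simp
    have "\<bar>l t - t\<bar> \<le> e"
      using si lt sSuc(2)[of i] it e(2) split pos unfolding abs_le_iff by linarith
    \<comment> \<open>\<open>l t\<close> runs from the jump time of cell \<open>i - 1\<close> to
      that of cell \<open>i\<close>: it lies either after the jump of the former or before the jump
      of the latter, and both pieces are compared with the common end point
      \<open>i / m\<close>.\<close>
    moreover have "\<bar>f (l t) - f (real i / real m)\<bar> \<le> e"
    proof (cases "real i / real m \<le> l t")
      case True
      then show ?thesis using \<tau>(2)[OF iK True] lt iK by (simp add: s_def)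
    next
      case False
      then obtain j where j: "i = Suc j" using lt s0 by (cases i) auto
      then have "\<tau> j \<le> l t" using lt iK by (simp add: s_def)
      then show ?thesis using \<tau>(3)[of j "l t"] j iK False by simp
    qed
    ultimately show ?thesis using t by (simp add: grid_path_def stepfun_apply i_def)
  qed
  with l(1) show ?thesis unfolding J1_close_def by blast
qed

text \<open>Once the mesh is below the threshold of \<open>cadlag_one_jump\<close>, every cell
  meeting the window satisfies the one-jump condition.\<close>

lemma cadlag_discretise_tendsto:
  assumes f: "f \<in> cadlag_fun"
  shows "(\<lambda>m. jdist (grid_path m f) f) \<longlonglongrightarrow> 0"
proof (rule tendstoI)
  fix r :: real assume r: "0 < r"
  define e where "e = min (r / 3) (1 / 2)"
  have e: "0 < e" "e \<le> 1 / 2" "2 * e < r" using r by (auto simp: e_def)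
  obtain d where d: "0 < d" "\<And>a b. 0 \<le> a \<Longrightarrow> a < b \<Longrightarrow> a \<le> 1 / e + 1 \<Longrightarrow> b - a < d \<Longrightarrow> one_jump e f a b"
    using cadlag_one_jump[OF f e(1), of "1 / e + 1"] by blast
  have "(\<lambda>m. 1 / real m) \<longlonglongrightarrow> 0" by (rule lim_1_over_n)
  moreover have "0 < min d (e / 2)" using d e by simp
  ultimately have "\<forall>\<^sub>F m in sequentially. 1 / real m < min d (e / 2)" by (rule order_tendstoD(2))
  then show "\<forall>\<^sub>F m in sequentially. dist (jdist (grid_path m f) f) 0 < r"
    using eventually_gt_at_top[of 0]
  proof eventually_elim
    fix m :: nat assume m: "1 / real m < min d (e / 2)" "0 < m"
    define K where "K = nat \<lceil>real m / e\<rceil> + 1"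
    have "J1_close e f (grid_path m f)"
    proof (rule J1_close_discretise[OF m(2) e(1)])
      show "2 / real m \<le> e" using m(1) by simp
      have "real m / e < real K" unfolding K_def by linarith
      then show "1 / e < real K / real m" using m(2) by (simp add: field_simps)
    next
      fix i assume i: "i < K"
      have "0 \<le> real m / e" using e by simp
      then have "real i \<le> real m / e + 1" using i unfolding K_def by linarith
      then have "real i / real m \<le> (real m / e + 1) / real m" by (intro divide_right_mono) auto
      also have "\<dots> = 1 / e + 1 / real m" using m(2) by (simp add: add_divide_distrib)
      also have "\<dots> \<le> 1 / e + 1" using m(2) by simp
      finally show "one_jump e f (real i / real m) (real (Suc i) / real m)"
        using m by (intro d(2)) (auto simp: divide_strict_right_mono diff_divide_distrib[symmetric])
    qed
    then have "jdist f (grid_path m f) \<le> 2 * e" using e by (intro jdist_le_of_close)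
    then show "dist (jdist (grid_path m f) f) 0 < r"
      using e jdist_nonneg by (simp add: dist_real_def jdist_commute)
  qed
qed

section \<open>Weak convergence\<close>

lemma (in prob_space) expectation_diff_le:
  fixes U V :: "'a \<Rightarrow> real"
  assumes [measurable]: "U \<in> borel_measurable M" "V \<in> borel_measurable M" "A \<in> events"
    and B: "\<And>w. w \<in> space M \<Longrightarrow> \<bar>U w\<bar> \<le> B" "\<And>w. w \<in> space M \<Longrightarrow> \<bar>V w\<bar> \<le> B"
    and e: "0 \<le> e" "\<And>w. w \<in> space M \<Longrightarrow> w \<notin> A \<Longrightarrow> \<bar>U w - V w\<bar> \<le> e"
  shows "\<bar>expectation U - expectation V\<bar> \<le> e + 2 * B * prob A"
proof -
  have int: "integrable M U" "integrable M V"
    by (rule integrable_const_bound[of _ B]; use B in auto)+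
  have "\<bar>expectation U - expectation V\<bar> = \<bar>expectation (\<lambda>w. U w - V w)\<bar>" using int by simp
  also have "\<dots> \<le> expectation (\<lambda>w. \<bar>U w - V w\<bar>)" by (rule integral_abs_bound)
  also have "\<dots> \<le> expectation (\<lambda>w. e + 2 * B * indicator A w)"
  proof (rule integral_mono)
    fix w assume w: "w \<in> space M"
    show "\<bar>U w - V w\<bar> \<le> e + 2 * B * indicator A w"
      using e B[OF w] e(2)[OF w] by (cases "w \<in> A") auto
  next
    show "integrable M (\<lambda>w. e + 2 * B * indicator A w)"
      by (rule integrable_const_bound[of _ "e + \<bar>2 * B\<bar>"])
        (use e(1) in \<open>auto simp: indicator_def intro: order_trans[OF abs_triangle_ineq]\<close>)
  qed (use int in auto)
  also have "\<dots> = e + 2 * B * prob A"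
    by (subst Bochner_Integration.integral_add) (auto simp: prob_space emeasure_eq_measure less_top[symmetric])
  finally show ?thesis .
qed

lemma weak_conv_of_pointwise:
  assumes P: "prob_space P" and [measurable]: "\<And>n. Z n \<in> borel_measurable P" "Y \<in> borel_measurable P"
    and lim: "\<And>x. x \<in> space P \<Longrightarrow> (\<lambda>n. Z n x) \<longlonglongrightarrow> Y x"
  shows "weak_conv_m (\<lambda>n. distr P borel (Z n)) (distr P borel Y)"
proof -
  interpret prob_space P by fact
  show ?thesis
  proof (rule integral_bdd_continuous_conv_imp_weak_conv)
    fix f :: "real \<Rightarrow> real" assume f: "\<And>x. isCont f x" "\<And>x. \<bar>f x\<bar> \<le> 1"
    have [measurable]: "f \<in> borel_measurable borel"
      using f(1) by (intro borel_measurable_continuous_onI continuous_at_imp_continuous_on) auto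
    have "(\<lambda>n. \<integral>x. f (Z n x) \<partial>P) \<longlonglongrightarrow> (\<integral>x. f (Y x) \<partial>P)"
      using f lim by (intro integral_dominated_convergence[where w="\<lambda>_. 1"])
        (auto intro!: isCont_tendsto_compose[of _ f])
    then show "(\<lambda>n. integral\<^sup>L (distr P borel (Z n)) f) \<longlonglongrightarrow> integral\<^sup>L (distr P borel Y) f"
      by (simp add: integral_distr)
  qed auto
qed

text \<open>The Skorokhod representation of weak convergence, packed into one predicate so that a
  coupling can be chosen for each of infinitely many coordinates.\<close>

definition pointwise_coupling ::
    "real measure \<Rightarrow> (nat \<Rightarrow> real \<Rightarrow> real) \<Rightarrow> (real \<Rightarrow> real) \<Rightarrow> (nat \<Rightarrow> real measure) \<Rightarrow> real measure \<Rightarrow> bool" where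
  "pointwise_coupling \<Omega> Z Y \<mu> L \<longleftrightarrow> prob_space \<Omega> \<and> (\<forall>n. Z n \<in> borel_measurable \<Omega>) \<and> Y \<in> borel_measurable \<Omega> \<and>
    (\<forall>n. distr \<Omega> borel (Z n) = \<mu> n) \<and> distr \<Omega> borel Y = L \<and> (\<forall>x\<in>space \<Omega>. (\<lambda>n. Z n x) \<longlonglongrightarrow> Y x)"

lemma pointwise_coupling_exists:
  assumes "\<And>n. real_distribution (\<mu> n)" "real_distribution L" "weak_conv_m \<mu> L"
  shows "\<exists>\<Omega> Z Y. pointwise_coupling \<Omega> Z Y \<mu> L"
  using Skorohod[OF assms] unfolding pointwise_coupling_def by simp blast

text \<open>On a Skorokhod coupling this is convergence of \<open>c n * Z (N n) x + d n\<close> at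
  each point, which handles converging constants and a reindexing at once.\<close>

lemma weak_conv_affine:
  fixes N :: "nat \<Rightarrow> nat"
  assumes \<mu>: "\<And>n. real_distribution (\<mu> n)" and L: "real_distribution L" and w: "weak_conv_m \<mu> L"
    and N: "filterlim N at_top at_top" and c: "c \<longlonglongrightarrow> c'" and d: "d \<longlonglongrightarrow> d'"
  shows "weak_conv_m (\<lambda>n. distr (\<mu> (N n)) borel (\<lambda>x. c n * x + d n)) (distr L borel (\<lambda>x. c' * x + d'))"
proof -
  obtain \<Omega> Z Y where "pointwise_coupling \<Omega> Z Y \<mu> L" using pointwise_coupling_exists[OF \<mu> L w] by blast
  then have \<Omega>: "prob_space \<Omega>" and [measurable]: "\<And>n. Z n \<in> borel_measurable \<Omega>" "Y \<in> borel_measurable \<Omega>"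
    and ZY: "\<And>n. distr \<Omega> borel (Z n) = \<mu> n" "distr \<Omega> borel Y = L"
    "\<And>x. x \<in> space \<Omega> \<Longrightarrow> (\<lambda>n. Z n x) \<longlonglongrightarrow> Y x" by (auto simp: pointwise_coupling_def)
  have "weak_conv_m (\<lambda>n. distr \<Omega> borel (\<lambda>x. c n * Z (N n) x + d n)) (distr \<Omega> borel (\<lambda>x. c' * Y x + d'))"
    using ZY(3) by (intro weak_conv_of_pointwise \<Omega>)
      (auto intro!: tendsto_intros c d filterlim_compose[OF _ N])
  then show ?thesis unfolding ZY(1,2)[symmetric] by (simp add: distr_distr comp_def)
qed

text \<open>A continuous ramp between the levels \<open>x\<close> and \<open>y\<close> separates the
  two tail indicators, so the levels need not be continuity points of \<open>L\<close>.\<close>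

lemma weak_conv_tail:
  assumes \<mu>: "\<And>n. real_distribution (\<mu> n)" and L: "real_distribution L" and w: "weak_conv_m \<mu> L"
    and xy: "x < y" and q: "measure L {z. x \<le> \<bar>z\<bar>} < q"
  shows "\<forall>\<^sub>F n in sequentially. measure (\<mu> n) {z. y \<le> \<bar>z\<bar>} < q"
proof -
  interpret \<mu>: real_distribution "\<mu> n" for n by fact
  interpret L: real_distribution L by fact
  define g where "g z = max 0 (min 1 ((\<bar>z\<bar> - x) / (y - x)))" for z :: real
  have cont: "isCont g z" for z unfolding g_def using xy by (intro continuous_intros) auto
  have b: "0 \<le> g z" "g z \<le> 1" for z by (auto simp: g_def)
  have [measurable]: "g \<in> borel_measurable borel"
    using cont by (intro borel_measurable_continuous_onI continuous_at_imp_continuous_on) auto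
  have "(\<lambda>n. integral\<^sup>L (\<mu> n) g) \<longlonglongrightarrow> integral\<^sup>L L g"
    by (rule weak_conv_imp_integral_bdd_continuous_conv[OF \<mu> L w cont, of 1]) (use b in auto)
  moreover have "integral\<^sup>L L g \<le> (\<integral>z. indicator {z. x \<le> \<bar>z\<bar>} z \<partial>L)"
  proof (rule integral_mono)
    show "integrable L g" by (rule L.integrable_const_bound[of _ 1]) (use b in auto)
    show "integrable L (indicator {z. x \<le> \<bar>z\<bar>} :: real \<Rightarrow> real)"
      by (rule L.integrable_const_bound[of _ 1]) auto
    fix z show "g z \<le> indicator {z. x \<le> \<bar>z\<bar>} z"
      using xy b(2)[of z] by (auto simp: g_def indicator_def divide_nonpos_pos)
  qed
  ultimately have "\<forall>\<^sub>F n in sequentially. integral\<^sup>L (\<mu> n) g < q"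
    using q by (elim order_tendstoD(2)) auto
  then show ?thesis
  proof eventually_elim
    fix n assume n: "integral\<^sup>L (\<mu> n) g < q"
    have "(\<integral>z. indicator {z. y \<le> \<bar>z\<bar>} z \<partial>\<mu> n) \<le> integral\<^sup>L (\<mu> n) g"
    proof (rule integral_mono)
      show "integrable (\<mu> n) (indicator {z. y \<le> \<bar>z\<bar>} :: real \<Rightarrow> real)"
        by (rule \<mu>.integrable_const_bound[of _ 1]) auto
      show "integrable (\<mu> n) g" by (rule \<mu>.integrable_const_bound[of _ 1]) (use b in auto)
      fix z show "indicator {z. y \<le> \<bar>z\<bar>} z \<le> g z"
        using xy b(1)[of z] by (auto simp: g_def indicator_def)
    qed
    with n show "measure (\<mu> n) {z. y \<le> \<bar>z\<bar>} < q" by simp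
  qed
qed

lemma (in real_distribution) tail_small:
  assumes "0 < q"
  obtains K where "0 < K" "measure M {z. K \<le> \<bar>z\<bar>} < q"
proof -
  have "(\<lambda>n. measure M {z. real n \<le> \<bar>z\<bar>}) \<longlonglongrightarrow> measure M (\<Inter>n. {z. real n \<le> \<bar>z\<bar>})"
    by (intro finite_Lim_measure_decseq) (auto simp: decseq_def)
  moreover have "(\<Inter>n. {z. real n \<le> \<bar>z\<bar>}) = {}"
    using reals_Archimedean2 by (fastforce simp: not_le[symmetric])
  ultimately have "(\<lambda>n. measure M {z. real n \<le> \<bar>z\<bar>}) \<longlonglongrightarrow> 0" by simp
  then have "\<forall>\<^sub>F n in sequentially. measure M {z. real n \<le> \<bar>z\<bar>} < q"
    using assms by (rule order_tendstoD(2))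
  then obtain n0 where "\<And>n. n0 \<le> n \<Longrightarrow> measure M {z. real n \<le> \<bar>z\<bar>} < q"
    by (auto simp: eventually_sequentially)
  then show ?thesis using that[of "real (Suc n0)"] by (metis le_SucI of_nat_0_less_iff order_refl zero_less_Suc)
qed

text \<open>Eventual tightness comes from the tails of \<open>L\<close>; the finitely many remaining
  laws are absorbed by adding their own bounds.\<close>

lemma weak_conv_tight:
  assumes \<mu>: "\<And>n. real_distribution (\<mu> n)" and L: "real_distribution L" and w: "weak_conv_m \<mu> L"
    and q: "0 < q"
  obtains K where "0 < K" "\<And>n. measure (\<mu> n) {z. K \<le> \<bar>z\<bar>} < q"
proof -
  interpret \<mu>: real_distribution "\<mu> n" for n by fact
  interpret L: real_distribution L by fact
  obtain K where K: "0 < K" "measure L {z. K \<le> \<bar>z\<bar>} < q" using L.tail_small[OF q] by blast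
  then have "\<forall>\<^sub>F n in sequentially. measure (\<mu> n) {z. K + 1 \<le> \<bar>z\<bar>} < q"
    by (intro weak_conv_tail[OF \<mu> L w]) auto
  then obtain n0 where n0: "\<And>n. n0 \<le> n \<Longrightarrow> measure (\<mu> n) {z. K + 1 \<le> \<bar>z\<bar>} < q"
    by (auto simp: eventually_sequentially)
  have "\<forall>n. \<exists>J>0. measure (\<mu> n) {z. J \<le> \<bar>z\<bar>} < q" using \<mu>.tail_small[OF q] by metis
  then obtain J where J: "\<And>n. 0 < J n" "\<And>n. measure (\<mu> n) {z. J n \<le> \<bar>z\<bar>} < q" by metis
  define K' where "K' = K + 1 + (\<Sum>n<n0. J n)"
  have "measure (\<mu> n) {z. K' \<le> \<bar>z\<bar>} < q" for n
  proof -
    have "\<exists>k\<le>K'. measure (\<mu> n) {z. k \<le> \<bar>z\<bar>} < q"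
    proof (cases "n0 \<le> n")
      case True
      have "0 \<le> (\<Sum>n<n0. J n)" using J(1) by (intro sum_nonneg) (simp add: less_imp_le)
      then show ?thesis using n0[OF True] by (intro exI[of _ "K + 1"]) (simp add: K'_def)
    next
      case False
      then have "J n \<le> (\<Sum>n<n0. J n)" using J(1) by (intro member_le_sum) (auto simp: less_imp_le)
      then show ?thesis using J(2) K(1) by (intro exI[of _ "J n"]) (simp add: K'_def)
    qed
    then obtain k where k: "k \<le> K'" "measure (\<mu> n) {z. k \<le> \<bar>z\<bar>} < q" by blast
    have "measure (\<mu> n) {z. K' \<le> \<bar>z\<bar>} \<le> measure (\<mu> n) {z. k \<le> \<bar>z\<bar>}"
      using k(1) by (intro \<mu>.finite_measure_mono) auto
    then show ?thesis using k(2) by simp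
  qed
  moreover have "0 \<le> (\<Sum>n<n0. J n)" using J(1) by (intro sum_nonneg) (simp add: less_imp_le)
  then have "0 < K'" using K(1) by (simp add: K'_def)
  ultimately show ?thesis using that by blast
qed

lemma distr_PiM_coordinatewise:
  fixes \<Omega> :: "nat \<Rightarrow> 'b measure" and f :: "nat \<Rightarrow> 'b \<Rightarrow> real"
  assumes \<Omega>: "\<And>i. prob_space (\<Omega> i)" and f[measurable]: "\<And>i. f i \<in> borel_measurable (\<Omega> i)"
  shows "distr (\<Pi>\<^sub>M i\<in>UNIV. \<Omega> i) seq_borel (\<lambda>\<omega> i. f i (\<omega> i)) =
    (\<Pi>\<^sub>M i\<in>UNIV. distr (\<Omega> i) borel (f i))" (is "distr ?P ?B ?t = ?D")
proof (rule measure_eqI_PiM_infinite[where I = UNIV and M = "\<lambda>i. distr (\<Omega> i) borel (f i)"])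
  have meas[measurable]: "?t \<in> measurable ?P ?B" by (rule measurable_PiM_single') auto
  have D: "prob_space (distr (\<Omega> i) borel (f i))" for i
    using \<Omega> by (intro prob_space.prob_space_distr) auto
  show "sets (distr ?P ?B ?t) = sets ?D" by (simp cong: sets_PiM_cong)
  interpret P: prob_space ?P using \<Omega> by (intro prob_space_PiM)
  interpret PD: prob_space "distr ?P ?B ?t" by (intro P.prob_space_distr meas)
  show "finite_measure (distr ?P ?B ?t)" by unfold_locales
  fix A :: "nat \<Rightarrow> real set" and J :: "nat set"
  assume J: "finite J" "J \<subseteq> UNIV" and A: "\<And>i. i \<in> J \<Longrightarrow> A i \<in> sets (distr (\<Omega> i) borel (f i))"
  let ?E = "prod_emb UNIV (\<lambda>i. distr (\<Omega> i) borel (f i)) J (Pi\<^sub>E J A)"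
  have "?E \<in> sets ?D" using J A by (intro sets_PiM_I) auto
  then have E: "?E \<in> sets ?B" by (simp cong: sets_PiM_cong)
  have "emeasure (distr ?P ?B ?t) ?E = emeasure ?P (?t -` ?E \<inter> space ?P)"
    using E by (intro emeasure_distr meas)
  also have "?t -` ?E \<inter> space ?P = prod_emb UNIV \<Omega> J (\<Pi>\<^sub>E j\<in>J. f j -` A j \<inter> space (\<Omega> j))"
    by (auto simp: prod_emb_def space_PiM PiE_iff)
  also have "emeasure ?P \<dots> = (\<Prod>j\<in>J. emeasure (\<Omega> j) (f j -` A j \<inter> space (\<Omega> j)))"
    using J A by (intro emeasure_PiM_emb \<Omega>) (auto intro!: measurable_sets[OF f])
  also have "\<dots> = (\<Prod>j\<in>J. emeasure (distr (\<Omega> j) borel (f j)) (A j))"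
    using A by (intro prod.cong) (auto simp: emeasure_distr)
  also have "\<dots> = emeasure ?D ?E" using J A by (intro emeasure_PiM_emb[symmetric] D) auto
  finally show "emeasure (distr ?P ?B ?t) ?E = emeasure ?D ?E" .
qed auto

text \<open>Skorokhod couplings of the single coordinates are multiplied together; on the product
  space all coordinates converge at every point, and dominated convergence applies to
  \<open>G\<close>.\<close>

lemma weak_conv_product:
  fixes \<mu> :: "nat \<Rightarrow> nat \<Rightarrow> real measure" and G :: "(nat \<Rightarrow> real) \<Rightarrow> real"
  assumes \<mu>: "\<And>n i. real_distribution (\<mu> n i)" and L: "\<And>i. real_distribution (L i)"
    and w: "\<And>i. weak_conv_m (\<lambda>n. \<mu> n i) (L i)"
    and G: "\<And>x y. (\<And>i. (\<lambda>n. x n i) \<longlonglongrightarrow> y i) \<Longrightarrow> (\<lambda>n. G (x n)) \<longlonglongrightarrow> G y"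
    and B: "\<And>x. \<bar>G x\<bar> \<le> B"
  shows "(\<lambda>n. \<integral>x. G x \<partial>(\<Pi>\<^sub>M i\<in>UNIV. \<mu> n i)) \<longlonglongrightarrow> (\<integral>x. G x \<partial>(\<Pi>\<^sub>M i\<in>UNIV. L i))"
proof -
  have "\<forall>i. \<exists>\<Omega> Z Y. pointwise_coupling \<Omega> Z Y (\<lambda>n. \<mu> n i) (L i)"
    using pointwise_coupling_exists[OF \<mu> L w] by blast
  then obtain \<Omega> Z Y where "\<And>i. pointwise_coupling (\<Omega> i) (Z i) (Y i) (\<lambda>n. \<mu> n i) (L i)" by metis
  then have \<Omega>: "\<And>i. prob_space (\<Omega> i)" and [measurable]: "\<And>i n. Z i n \<in> borel_measurable (\<Omega> i)" "\<And>i. Y i \<in> borel_measurable (\<Omega> i)"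
    and d: "\<And>i n. distr (\<Omega> i) borel (Z i n) = \<mu> n i" "\<And>i. distr (\<Omega> i) borel (Y i) = L i"
    and lim: "\<And>i x. x \<in> space (\<Omega> i) \<Longrightarrow> (\<lambda>n. Z i n x) \<longlonglongrightarrow> Y i x"
    by (simp_all add: pointwise_coupling_def)
  let ?P = "\<Pi>\<^sub>M i\<in>UNIV. \<Omega> i"
  interpret P: prob_space ?P using \<Omega> by (intro prob_space_PiM)
  have [measurable]: "G \<in> borel_measurable seq_borel"
    by (rule measurable_of_pointwise_continuous[OF G])
  have mZ[measurable]: "(\<lambda>\<omega> i. Z i n (\<omega> i)) \<in> measurable ?P seq_borel" for n
    by (rule measurable_PiM_single') auto
  have mY[measurable]: "(\<lambda>\<omega> i. Y i (\<omega> i)) \<in> measurable ?P seq_borel"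
    by (rule measurable_PiM_single') auto
  have 1: "(\<integral>x. G x \<partial>(\<Pi>\<^sub>M i\<in>UNIV. \<mu> n i)) = (\<integral>\<omega>. G (\<lambda>i. Z i n (\<omega> i)) \<partial>?P)" for n
    unfolding d(1)[symmetric] by (subst distr_PiM_coordinatewise[symmetric]) (auto simp: \<Omega> integral_distr)
  have 2: "(\<integral>x. G x \<partial>(\<Pi>\<^sub>M i\<in>UNIV. L i)) = (\<integral>\<omega>. G (\<lambda>i. Y i (\<omega> i)) \<partial>?P)"
    unfolding d(2)[symmetric] by (subst distr_PiM_coordinatewise[symmetric]) (auto simp: \<Omega> integral_distr)
  have "(\<lambda>n. \<integral>\<omega>. G (\<lambda>i. Z i n (\<omega> i)) \<partial>?P) \<longlonglongrightarrow> (\<integral>\<omega>. G (\<lambda>i. Y i (\<omega> i)) \<partial>?P)"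
  proof (rule integral_dominated_convergence[where w="\<lambda>_. B"])
    show "AE \<omega> in ?P. (\<lambda>n. G (\<lambda>i. Z i n (\<omega> i))) \<longlonglongrightarrow> G (\<lambda>i. Y i (\<omega> i))"
      by (intro AE_I2 G lim) (auto simp: space_PiM)
  qed (use B in auto)
  then show ?thesis unfolding 1 2 .
qed

section \<open>Random walks with independent identically distributed steps\<close>

definition first_exit :: "real \<Rightarrow> nat \<Rightarrow> (nat \<Rightarrow> real) \<Rightarrow> bool" where
  "first_exit y j x \<longleftrightarrow> y < \<bar>sum x {..<j}\<bar> \<and> (\<forall>i<j. \<bar>sum x {..<i}\<bar> \<le> y)"

lemma first_exit_exists:
  assumes "y < \<bar>sum x {..<k}\<bar>"
  obtains j where "j \<le> k" "first_exit y j x"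
proof -
  define j where "j = (LEAST j. y < \<bar>sum x {..<j}\<bar>)"
  have "y < \<bar>sum x {..<j}\<bar>" unfolding j_def using assms by (rule LeastI)
  moreover have "\<forall>i<j. \<bar>sum x {..<i}\<bar> \<le> y" unfolding j_def using not_less_Least by (auto simp: not_less[symmetric])
  moreover have "j \<le> k" unfolding j_def using assms by (rule Least_le)
  ultimately show ?thesis using that by (auto simp: first_exit_def)
qed

lemma first_exit_unique: "first_exit y i x \<Longrightarrow> first_exit y j x \<Longrightarrow> i = j"
  unfolding first_exit_def by (metis linorder_neqE_nat not_less)

lemma first_exit_cong: "(\<And>i. i < j \<Longrightarrow> x i = x' i) \<Longrightarrow> first_exit y j x \<longleftrightarrow> first_exit y j x'"
proof -
  assume eq: "\<And>i. i < j \<Longrightarrow> x i = x' i"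
  have "sum x {..<i} = sum x' {..<i}" if "i \<le> j" for i using that eq by (intro sum.cong) auto
  then show ?thesis by (auto simp: first_exit_def)
qed

lemma measurable_first_exit [measurable]:
  "Measurable.pred seq_borel (first_exit y j)" unfolding first_exit_def by measurable

text \<open>The second excursion may use \<open>N\<close> steps counted from \<open>j\<close>, not
  just those left before \<open>N\<close>. Its event then has the same form for every
  \<open>j\<close>, so the probability factorises.\<close>

definition double_exit :: "real \<Rightarrow> nat \<Rightarrow> (nat \<Rightarrow> real) \<Rightarrow> bool" where
  "double_exit y N x \<longleftrightarrow> (\<exists>j\<le>N. first_exit y j x \<and> (\<exists>k\<le>N. y < \<bar>\<Sum>i<k. x (j + i)\<bar>))"

lemma measurable_double_exit [measurable]:
  "Measurable.pred seq_borel (double_exit y N)" unfolding double_exit_def by measurable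

lemma sum_shift_lessThan: "sum x {..<j + k} = sum x {..<j} + (\<Sum>i<k. x (j + i :: nat))" for x :: "nat \<Rightarrow> real"
  by (induction k) (auto simp: add.assoc)

locale iid_walk = prob_space M for M :: "'a measure" +
  fixes X :: "nat \<Rightarrow> 'a \<Rightarrow> real"
  assumes indep: "indep_vars (\<lambda>_. borel) X UNIV"
    and ident: "\<And>i. distr M borel (X i) = distr M borel (X 0)"
begin

abbreviation S :: "nat \<Rightarrow> 'a \<Rightarrow> real" where
  "S n w \<equiv> \<Sum>i<n. X i w"

abbreviation beyond :: "real \<Rightarrow> nat \<Rightarrow> 'a set" where
  "beyond y n \<equiv> {w \<in> space M. y < \<bar>S n w\<bar>}"

abbreviation exits :: "real \<Rightarrow> nat \<Rightarrow> 'a set" where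
  "exits y N \<equiv> {w \<in> space M. \<exists>k\<le>N. y < \<bar>S k w\<bar>}"

abbreviation exit_event :: "real \<Rightarrow> nat \<Rightarrow> 'a set" where
  "exit_event y j \<equiv> {w \<in> space M. first_exit y j (\<lambda>i. X i w)}"

abbreviation limit_law :: "real \<Rightarrow> real measure \<Rightarrow> bool" where
  "limit_law a L \<equiv> weak_conv_m (\<lambda>n. distr M borel (\<lambda>w. real n powr - a * S n w)) L"

lemma X_measurable [measurable]: "X i \<in> borel_measurable M"
  using indep by (simp add: indep_vars_def)

lemma shifted_measurable [measurable]:
  "(\<lambda>w i. X (b + i) w) \<in> measurable M seq_borel"
  "(\<lambda>w i. X i w) \<in> measurable M seq_borel" by (rule measurable_PiM_single'; simp)+

lemma law_PiM: "distr M seq_borel (\<lambda>w i. X i w) = (\<Pi>\<^sub>M i\<in>UNIV. distr M borel (X 0))"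
proof -
  have "distr M seq_borel (\<lambda>w. \<lambda>i\<in>UNIV. X i w) = (\<Pi>\<^sub>M i\<in>UNIV. distr M borel (X i))"
    using indep_vars_iff_distr_eq_PiM[of UNIV X "\<lambda>_. borel"] indep by simp
  also have "(\<lambda>i. distr M borel (X i)) = (\<lambda>_. distr M borel (X 0))" by (rule ext) (rule ident)
  finally show ?thesis by (simp only: restrict_UNIV)
qed

text \<open>The law is an infinite product of equal factors, hence invariant under an injective
  renumbering of the coordinates.\<close>

lemma law_shift:
  "distr M seq_borel (\<lambda>w i. X (b + i) w) = distr M seq_borel (\<lambda>w i. X i w)"
proof -
  let ?\<mu> = "distr M borel (X 0)"
  have sets: "sets (\<Pi>\<^sub>M i\<in>UNIV. ?\<mu>) = sets seq_borel" by (simp cong: sets_PiM_cong)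
  have "(\<Pi>\<^sub>M i\<in>UNIV. ?\<mu>) = distr (\<Pi>\<^sub>M i\<in>UNIV. ?\<mu>) (\<Pi>\<^sub>M i\<in>UNIV. ?\<mu>) (\<lambda>\<omega>. \<lambda>n\<in>UNIV. \<omega> (b + n))"
    by (subst distr_PiM_reindex[where K = UNIV]) (auto intro: prob_space_distr)
  also have "\<dots> = distr (\<Pi>\<^sub>M i\<in>UNIV. ?\<mu>) seq_borel (\<lambda>\<omega> n. \<omega> (b + n))"
    by (rule distr_cong) (auto simp: sets)
  also have "\<dots> = distr (distr M seq_borel (\<lambda>w i. X i w)) seq_borel (\<lambda>\<omega> n. \<omega> (b + n))"
    by (simp add: law_PiM)
  also have "\<dots> = distr M seq_borel (\<lambda>w i. X (b + i) w)"
    by (subst distr_distr) (auto simp: comp_def intro!: measurable_PiM_single')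
  finally show ?thesis by (simp add: law_PiM)
qed

lemma prob_shift:
  assumes [measurable]: "Measurable.pred seq_borel Q"
  shows "prob {w \<in> space M. Q (\<lambda>i. X (b + i) w)} = prob {w \<in> space M. Q (\<lambda>i. X i w)}"
proof -
  define A where "A = {x \<in> space seq_borel. Q x}"
  have A: "A \<in> sets seq_borel" unfolding A_def by measurable
  have "prob {w \<in> space M. Q (\<lambda>i. X (b + i) w)} = measure (distr M seq_borel (\<lambda>w i. X (b + i) w)) A"
    by (subst measure_distr[OF _ A]) (auto intro!: arg_cong[where f=prob] simp: space_PiM A_def)
  also have "\<dots> = measure (distr M seq_borel (\<lambda>w i. X i w)) A" by (simp only: law_shift)
  also have "\<dots> = prob {w \<in> space M. Q (\<lambda>i. X i w)}"
    by (subst measure_distr[OF _ A]) (auto intro!: arg_cong[where f=prob] simp: space_PiM A_def)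
  finally show ?thesis .
qed

text \<open>The Markov property at a first exit: the exit at \<open>j\<close> is decided by the
  steps before \<open>j\<close>, the event \<open>Q\<close> by those from \<open>j\<close> on, and
  shifting back by \<open>j\<close> leaves the probability of \<open>Q\<close> unchanged.\<close>

lemma prob_first_exit_indep:
  assumes Q[measurable]: "Measurable.pred seq_borel Q"
  shows "prob {w \<in> space M. first_exit y j (\<lambda>i. X i w) \<and> Q (\<lambda>i. X (j + i) w)} =
    prob (exit_event y j) * prob {w \<in> space M. Q (\<lambda>i. X i w)}"
proof -
  let ?P1 = "\<Pi>\<^sub>M (i::nat)\<in>{..<j}. (borel :: real measure)"
  let ?P2 = "\<Pi>\<^sub>M (i::nat)\<in>{j..}. (borel :: real measure)"
  let ?f1 = "\<lambda>w. \<lambda>i\<in>{..<j}. X i w" and ?f2 = "\<lambda>w. \<lambda>i\<in>{j..}. X i w"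
  define A where "A = {r \<in> space ?P1. first_exit y j r}"
  define B where "B = {r \<in> space ?P2. Q (\<lambda>i. r (j + i))}"
  have *: "(\<lambda>r. \<Sum>l<i. r l) \<in> borel_measurable ?P1" if "i \<le> j" for i
    using that by (intro borel_measurable_sum measurable_component_singleton) auto
  have "A = {r \<in> space ?P1. y < \<bar>\<Sum>l<j. r l\<bar>} \<inter> (\<Inter>i<j. {r \<in> space ?P1. \<bar>\<Sum>l<i. r l\<bar> \<le> y}) \<inter> space ?P1"
    by (auto simp: A_def first_exit_def)
  also have "\<dots> \<in> sets ?P1"
    using *[of j] by (cases "j = 0") (auto intro!: sets.Int sets.countable_INT' borel_measurable_less borel_measurable_le borel_measurable_abs *)
  finally have A: "A \<in> sets ?P1" .
  have "(\<lambda>r i. r (j + i)) \<in> measurable ?P2 seq_borel"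
    by (intro measurable_PiM_single' measurable_component_singleton) auto
  then have B: "B \<in> sets ?P2" unfolding B_def by measurable
  have "indep_var ?P1 ?f1 ?P2 ?f2" by (rule indep_var_restrict[OF indep]) auto
  from indep_varD[OF this A B]
  have p: "prob ((\<lambda>w. (?f1 w, ?f2 w)) -` (A \<times> B) \<inter> space M) = prob (?f1 -` A \<inter> space M) * prob (?f2 -` B \<inter> space M)" .
  have "first_exit y j (?f1 w) \<longleftrightarrow> first_exit y j (\<lambda>i. X i w)" for w
    by (rule first_exit_cong) simp
  then have 1: "?f1 -` A \<inter> space M = exit_event y j" by (auto simp: A_def space_PiM)
  have 2: "?f2 -` B \<inter> space M = {w \<in> space M. Q (\<lambda>i. X (j + i) w)}"
    by (auto simp: B_def space_PiM)
  have "(\<lambda>w. (?f1 w, ?f2 w)) -` (A \<times> B) \<inter> space M = (?f1 -` A \<inter> space M) \<inter> (?f2 -` B \<inter> space M)"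
    by auto
  also have "\<dots> = {w \<in> space M. first_exit y j (\<lambda>i. X i w) \<and> Q (\<lambda>i. X (j + i) w)}"
    unfolding 1 2 by auto
  finally show ?thesis using p 1 2 prob_shift[OF Q, of j] by simp
qed

lemma prob_exit:
  "prob (exits y N) =
    (\<Sum>j\<le>N. prob (exit_event y j))"
proof -
  have "exits y N = (\<Union>j\<le>N. exit_event y j)"
    (is "?L = ?R")
  proof
    show "?L \<subseteq> ?R"
    proof
      fix w assume "w \<in> ?L"
      then obtain k where k: "w \<in> space M" "k \<le> N" "y < \<bar>S k w\<bar>" by auto
      from first_exit_exists[OF k(3)] obtain j where "j \<le> k" "first_exit y j (\<lambda>i. X i w)" .
      then show "w \<in> ?R" using k by auto
    qed
    show "?R \<subseteq> ?L" by (auto simp: first_exit_def)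
  qed
  also have "prob \<dots> = (\<Sum>j\<le>N. prob (exit_event y j))" by (rule finite_measure_finite_Union)
      (auto simp: disjoint_family_on_def dest: first_exit_unique)
  finally show ?thesis .
qed

text \<open>Ottaviani's inequality. Split by the first time \<open>j\<close> beyond
  \<open>2 * y\<close>; the remaining \<open>N - j\<close> steps move by at most \<open>y\<close>
  with probability at least 1/2, independently of the past, and then the final position is beyond
  \<open>y\<close>.\<close>

lemma ottaviani:
  assumes half: "\<And>j. j \<le> N \<Longrightarrow> prob (beyond y j) \<le> 1 / 2"
  shows "prob (exits (2 * y) N) \<le> 2 * prob (beyond y N)"
proof -
  let ?F = "\<lambda>j. exit_event (2 * y) j"
  let ?G = "\<lambda>j. {w \<in> space M. first_exit (2 * y) j (\<lambda>i. X i w) \<and> \<bar>\<Sum>i<N-j. X (j + i) w\<bar> \<le> y}"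
  have G: "prob (?F j) \<le> 2 * prob (?G j)" if "j \<le> N" for j
  proof -
    have "prob {w \<in> space M. \<not> y < \<bar>S (N-j) w\<bar>} = 1 - prob (beyond y (N-j))"
      by (rule prob_neg) simp
    with half[of "N - j"] have "1 / 2 \<le> prob {w \<in> space M. \<bar>S (N-j) w\<bar> \<le> y}"
      by (simp add: not_less)
    moreover have "prob (?G j) = prob (?F j) * prob {w \<in> space M. \<bar>S (N-j) w\<bar> \<le> y}"
      using prob_first_exit_indep[of "\<lambda>x. \<bar>\<Sum>i<N-j. x i\<bar> \<le> y" "2 * y" j] by simp
    moreover have "prob (?F j) * (1 / 2) \<le> prob (?F j) * prob {w \<in> space M. \<bar>S (N-j) w\<bar> \<le> y}"
      using calculation(1) by (intro mult_left_mono) auto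
    ultimately show ?thesis by simp
  qed
  have "prob (exits (2 * y) N) = (\<Sum>j\<le>N. prob (?F j))" by (rule prob_exit)
  also have "\<dots> \<le> (\<Sum>j\<le>N. 2 * prob (?G j))" using G by (intro sum_mono) auto
  also have "\<dots> = 2 * (\<Sum>j\<le>N. prob (?G j))" by (simp add: sum_distrib_left)
  also have "(\<Sum>j\<le>N. prob (?G j)) = prob (\<Union>j\<le>N. ?G j)"
    by (rule finite_measure_finite_Union[symmetric])
      (auto simp: disjoint_family_on_def dest: first_exit_unique)
  also have "\<dots> \<le> prob (beyond y N)"
  proof (rule finite_measure_mono)
    show "(\<Union>j\<le>N. ?G j) \<subseteq> beyond y N"
    proof
      fix w assume "w \<in> (\<Union>j\<le>N. ?G j)"
      then obtain j where j: "j \<le> N" "w \<in> space M" "2 * y < \<bar>S j w\<bar>" "\<bar>\<Sum>i<N-j. X (j + i) w\<bar> \<le> y"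
        by (auto simp: first_exit_def)
      have "S N w = S j w + (\<Sum>i<N-j. X (j + i) w)"
        using sum_shift_lessThan[of "\<lambda>i. X i w" j "N - j"] j(1) by simp
      then show "w \<in> beyond y N" using j by simp
    qed
  qed simp
  finally show ?thesis by simp
qed

text \<open>Summing over the first exit time leaves one exit probability as total mass and the other
  as a common factor.\<close>

lemma prob_double_exit:
  "prob {w \<in> space M. double_exit y N (\<lambda>i. X i w)} \<le> (prob (exits y N))\<^sup>2"
proof -
  let ?Q = "\<lambda>x. \<exists>k\<le>N. y < \<bar>\<Sum>i<k. x i\<bar>"
  let ?G = "\<lambda>j. {w \<in> space M. first_exit y j (\<lambda>i. X i w) \<and> ?Q (\<lambda>i. X (j + i) w)}"
  have "{w \<in> space M. double_exit y N (\<lambda>i. X i w)} = (\<Union>j\<le>N. ?G j)"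
    by (auto simp: double_exit_def)
  also have "prob \<dots> \<le> (\<Sum>j\<le>N. prob (?G j))" by (rule finite_measure_subadditive_finite) auto
  also have "\<dots> = (\<Sum>j\<le>N. prob (exit_event y j) * prob {w \<in> space M. ?Q (\<lambda>i. X i w)})"
    by (intro sum.cong prob_first_exit_indep) auto
  also have "\<dots> = (\<Sum>j\<le>N. prob (exit_event y j)) * prob {w \<in> space M. ?Q (\<lambda>i. X i w)}"
    by (simp add: sum_distrib_right)
  also have "\<dots> = (prob {w \<in> space M. ?Q (\<lambda>i. X i w)})\<^sup>2"
    by (simp only: prob_exit[symmetric] power2_eq_square)
  finally show ?thesis .
qed

section \<open>Tightness and exit probabilities over short blocks\<close>

definition tight_walk :: "real \<Rightarrow> bool" where
  "tight_walk a \<longleftrightarrow> (\<forall>q>0. \<exists>K>0. \<forall>n. prob (beyond (K * real n powr a) n) \<le> q)"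

lemma tight_walkI:
  assumes L: "real_distribution L"
    and w: "limit_law a L"
  shows "tight_walk a" unfolding tight_walk_def
proof (intro allI impI)
  fix q :: real assume "0 < q"
  obtain K where K: "0 < K"
    "\<And>n. measure (distr M borel (\<lambda>w. real n powr - a * S n w)) {z. K \<le> \<bar>z\<bar>} < q"
    by (rule weak_conv_tight[OF _ L w \<open>0 < q\<close>]) (auto intro!: real_distribution_distr)
  have "prob (beyond (K * real n powr a) n) \<le> q" for n
  proof (cases "n = 0")
    case False
    have "beyond (K * real n powr a) n \<subseteq>
      (\<lambda>w. real n powr - a * S n w) -` {z. K \<le> \<bar>z\<bar>} \<inter> space M"
      using False by (auto simp: abs_mult powr_minus field_simps)
    then have "prob (beyond (K * real n powr a) n) \<le>
      prob ((\<lambda>w. real n powr - a * S n w) -` {z. K \<le> \<bar>z\<bar>} \<inter> space M)"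
      by (intro finite_measure_mono) measurable
    with K(2)[of n] show ?thesis by (simp add: measure_distr)
  qed (use \<open>0 < q\<close> in simp)
  with K(1) show "\<exists>K>0. \<forall>n. prob (beyond (K * real n powr a) n) \<le> q" by blast
qed

lemma tight_walk_max:
  assumes T: "tight_walk a" and a: "0 < a" and q: "0 < q"
  obtains K where "0 < K" "\<And>N. prob (exits (K * real N powr a) N) \<le> q"
proof -
  \<comment> \<open>\<open>q / 2\<close> pays for the factor 2 in \<open>ottaviani\<close>, and
    \<open>1 / 2\<close> provides its hypothesis.\<close>
  have "0 < min (q / 2) (1 / 2)" using q by simp
  then obtain K where K: "0 < K" "\<And>n. prob (beyond (K * real n powr a) n) \<le> min (q / 2) (1 / 2)"
    using T unfolding tight_walk_def by blast
  show ?thesis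
  proof (rule that[of "2 * K"])
    show "0 < 2 * K" using K(1) by simp
    fix N
    have "prob (exits (2 * (K * real N powr a)) N) \<le>
      2 * prob (beyond (K * real N powr a) N)"
    proof (rule ottaviani)
      fix j assume "j \<le> N"
      then have "K * real j powr a \<le> K * real N powr a"
        using K(1) a by (intro mult_left_mono powr_mono2) auto
      then have "prob (beyond (K * real N powr a) j) \<le> prob (beyond (K * real j powr a) j)"
        by (intro finite_measure_mono) auto
      also have "\<dots> \<le> 1 / 2" using K(2)[of j] by simp
      finally show "prob (beyond (K * real N powr a) j) \<le> 1 / 2" .
    qed
    also have "\<dots> \<le> q" using K(2)[of N] by simp
    finally show "prob (exits (2 * K * real N powr a) N) \<le> q" by (simp add: mult.assoc)
  qed
qed

text \<open>\<open>S (N n) / n powr a\<close> is \<open>(N n / n) powr a\<close> times the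
  normalised sum of index \<open>N n\<close>, and \<open>N n / n\<close> tends to
  \<open>1 / m\<close>. The tolerance 1 admits both the ceiling of \<open>n / m\<close> and the
  difference of two neighbouring grid floors.\<close>

lemma scaled_walk_limit:
  fixes N :: "nat \<Rightarrow> nat"
  assumes L: "real_distribution L" and m: "0 < m" and N: "\<And>n. \<bar>real (N n) - real n / real m\<bar> \<le> 1"
    and w: "limit_law a L"
  shows "weak_conv_m (\<lambda>n. distr M borel (\<lambda>w. S (N n) w / real n powr a))
    (distr L borel (\<lambda>x. real m powr - a * x))"
proof -
  have mpos: "0 < real m" using m by simp
  have N_ge: "real n / real m - 1 \<le> real (N n)" and N_le: "real (N n) \<le> real n / real m + 1" for n
    using N[of n] by linarith+
  have N_top: "filterlim N at_top at_top" unfolding filterlim_at_top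
  proof
    fix Z
    show "\<forall>\<^sub>F n in sequentially. Z \<le> N n" using eventually_ge_at_top[of "(Z + 1) * m"]
    proof eventually_elim
      fix n assume "(Z + 1) * m \<le> n"
      then have "real (Z + 1) * real m \<le> real n" by (metis of_nat_le_iff of_nat_mult)
      then have "real (Z + 1) \<le> real n / real m" using mpos by (simp add: field_simps)
      with N_ge[of n] show "Z \<le> N n" by linarith
    qed
  qed
  have "(\<lambda>n. real (N n) / real n) \<longlonglongrightarrow> 1 / real m"
  proof (rule tendsto_sandwich[of "\<lambda>n. 1 / real m - 1 / real n" _ _ "\<lambda>n. 1 / real m + 1 / real n"])
    show "\<forall>\<^sub>F n in sequentially. 1 / real m - 1 / real n \<le> real (N n) / real n"
      using eventually_gt_at_top[of 0]
    proof eventually_elim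
      fix n :: nat assume "0 < n"
      have "(real n / real m - 1) / real n \<le> real (N n) / real n" by (intro divide_right_mono N_ge) simp
      then show "1 / real m - 1 / real n \<le> real (N n) / real n" using \<open>0 < n\<close> by (simp add: diff_divide_distrib)
    qed
    show "\<forall>\<^sub>F n in sequentially. real (N n) / real n \<le> 1 / real m + 1 / real n"
      using eventually_gt_at_top[of 0]
    proof eventually_elim
      fix n :: nat assume "0 < n"
      have "real (N n) / real n \<le> (real n / real m + 1) / real n" by (intro divide_right_mono N_le) simp
      then show "real (N n) / real n \<le> 1 / real m + 1 / real n" using \<open>0 < n\<close> by (simp add: add_divide_distrib)
    qed
    show "(\<lambda>n. 1 / real m + 1 / real n) \<longlonglongrightarrow> 1 / real m"
      using tendsto_add[OF tendsto_const lim_1_over_n, of "1 / real m"] by simp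
    show "(\<lambda>n. 1 / real m - 1 / real n) \<longlonglongrightarrow> 1 / real m"
      using tendsto_diff[OF tendsto_const lim_1_over_n, of "1 / real m"] by simp
  qed
  then have c: "(\<lambda>n. (real (N n) / real n) powr a) \<longlonglongrightarrow> (1 / real m) powr a"
    using mpos by (intro tendsto_powr tendsto_const) auto
  have "weak_conv_m (\<lambda>n. distr (distr M borel (\<lambda>w. real (N n) powr - a * S (N n) w)) borel
      (\<lambda>x. (real (N n) / real n) powr a * x + 0)) (distr L borel (\<lambda>x. (1 / real m) powr a * x + 0))"
    by (rule weak_conv_affine[OF _ L w N_top c tendsto_const]) (auto intro!: real_distribution_distr)
  moreover have "(real (N n) / real n) powr a * (real (N n) powr - a * S (N n) w) = S (N n) w / real n powr a" for n w
    by (cases "N n = 0") (simp_all add: powr_divide powr_minus_divide)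
  moreover have "(1 / real m) powr a = real m powr - a" using mpos by (simp add: powr_divide powr_minus_divide)
  ultimately show ?thesis by (simp add: distr_distr comp_def)
qed

text \<open>The level \<open>y\<close> drops to \<open>y / 2\<close> through
  \<open>ottaviani\<close> and to \<open>y / 4\<close> through the strict gap in
  \<open>weak_conv_tail\<close>. The threshold \<open>m0\<close>, which does not depend on
  \<open>q\<close>, makes a block so short that the hypothesis of \<open>ottaviani\<close> follows
  from tightness.\<close>

lemma block_exit_bound:
  assumes L: "real_distribution L" and a: "0 < a" and y: "0 < y"
    and w: "limit_law a L"
  obtains m0 where "0 < m0"
    "\<And>m q. m0 \<le> m \<Longrightarrow> measure L {z. y / 4 \<le> \<bar>real m powr - a * z\<bar>} < q \<Longrightarrow>
      \<forall>\<^sub>F n in sequentially. prob (exits (y * real n powr a) (nat \<lceil>real n / real m\<rceil>)) \<le> 2 * q"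
proof -
  interpret L: real_distribution L by fact
  have "0 < (1 / 2 :: real)" by simp
  then obtain K where K: "0 < K" "\<And>n. prob (beyond (K * real n powr a) n) \<le> 1 / 2"
    using tight_walkI[OF L w] unfolding tight_walk_def by blast
  have "filterlim (\<lambda>m. 1 / 2 * real m) at_top sequentially"
    by (rule filterlim_tendsto_pos_mult_at_top[OF tendsto_const _ filterlim_real_sequentially]) simp
  then have "(\<lambda>m. (real m / 2) powr - a) \<longlonglongrightarrow> 0" using a by (intro tendsto_neg_powr) auto
  then have "(\<lambda>m. K * (real m / 2) powr - a) \<longlonglongrightarrow> 0"
    using tendsto_mult_left[of "\<lambda>m. (real m / 2) powr - a" 0 _ K] by simp
  then have "\<forall>\<^sub>F m in sequentially. K * (real m / 2) powr - a < y / 2"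
    using y by (intro order_tendstoD(2)) auto
  then obtain m0 where m0: "\<And>m. m0 \<le> m \<Longrightarrow> K * (real m / 2) powr - a < y / 2"
    by (auto simp: eventually_sequentially)
  show ?thesis
  proof (rule that[of "Suc m0"])
    fix m q assume m: "Suc m0 \<le> m" and q: "measure L {z. y / 4 \<le> \<bar>real m powr - a * z\<bar>} < q"
    define N where "N n = nat \<lceil>real n / real m\<rceil>" for n
    have mpos: "0 < real m" using m by simp
    have N_ge: "real n / real m \<le> real (N n)" for n unfolding N_def by linarith
    have N_le: "real (N n) \<le> real n / real m + 1" for n
      unfolding N_def using mpos by (simp add: of_nat_ceiling) 
    have N_dist: "\<bar>real (N n) - real n / real m\<bar> \<le> 1" for n using N_ge[of n] N_le[of n] by linarith
    have m0': "0 < m" using m by simp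
    note wc = scaled_walk_limit[OF L m0' N_dist w]
    have "measure (distr L borel (\<lambda>x. real m powr - a * x)) {z. y / 4 \<le> \<bar>z\<bar>} < q"
      using q by (subst measure_distr) (auto simp: vimage_def)
    then have ev: "\<forall>\<^sub>F n in sequentially. measure (distr M borel (\<lambda>w. S (N n) w / real n powr a)) {z. y / 2 \<le> \<bar>z\<bar>} < q"
      using y by (intro weak_conv_tail[OF _ _ wc, where x="y / 4"]) (auto intro!: real_distribution_distr L.real_distribution_distr)
    show "\<forall>\<^sub>F n in sequentially. prob (exits (y * real n powr a) (nat \<lceil>real n / real m\<rceil>)) \<le> 2 * q"
      using ev eventually_ge_at_top[of m]
    proof eventually_elim
      fix n assume tail: "measure (distr M borel (\<lambda>w. S (N n) w / real n powr a)) {z. y / 2 \<le> \<bar>z\<bar>} < q"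
        and n: "m \<le> n"
      have npos: "0 < real n" using n mpos by simp
      have Npos: "0 < real (N n)" using N_ge[of n] npos mpos by (meson divide_pos_pos less_le_trans)
      have "real (N n) \<le> real n / real m + 1" by (rule N_le)
      \<comment> \<open>For \<open>m \<le> n\<close> the rounding at most doubles the bound on the
        block length; hence \<open>real m / 2\<close> in the choice of \<open>m0\<close>.\<close>
      also have "\<dots> \<le> 2 * (real n / real m)" using n mpos by (simp add: field_simps)
      finally have "real (N n) powr a \<le> (real n * (2 / real m)) powr a"
        using a Npos by (intro powr_mono2) (auto simp: mult.commute)
      also have "\<dots> = real n powr a * (real m / 2) powr - a"
        using npos mpos by (simp add: powr_mult powr_minus_divide powr_divide)
      finally have "K * real (N n) powr a \<le> K * (real n powr a * (real m / 2) powr - a)"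
        using K(1) by (intro mult_left_mono) auto
      also have "\<dots> = real n powr a * (K * (real m / 2) powr - a)" by simp
      also have "\<dots> \<le> real n powr a * (y / 2)" using m0[of m] m by (intro mult_left_mono) auto
      finally have KN: "K * real (N n) powr a \<le> y / 2 * real n powr a" by (simp add: mult.commute)
      have "prob (exits (2 * (y / 2 * real n powr a)) (N n))
        \<le> 2 * prob (beyond (y / 2 * real n powr a) (N n))"
      proof (rule ottaviani)
        fix j assume "j \<le> N n"
        then have "K * real j powr a \<le> K * real (N n) powr a"
          using K(1) a by (intro mult_left_mono powr_mono2) auto
        with KN have "prob (beyond (y / 2 * real n powr a) j) \<le> prob (beyond (K * real j powr a) j)"
          by (intro finite_measure_mono) auto
        also have "\<dots> \<le> 1 / 2" by (rule K(2))
        finally show "prob (beyond (y / 2 * real n powr a) j) \<le> 1 / 2" .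
      qed
      also have "prob (beyond (y / 2 * real n powr a) (N n)) \<le>
        prob ((\<lambda>w. S (N n) w / real n powr a) -` {z. y / 2 \<le> \<bar>z\<bar>} \<inter> space M)"
        using npos by (intro finite_measure_mono) (auto simp: field_simps)
      also have "\<dots> < q" using tail by (subst (asm) measure_distr) auto
      finally show "prob (exits (y * real n powr a) (nat \<lceil>real n / real m\<rceil>)) \<le> 2 * q"
        by (simp add: N_def)
    qed
  qed simp
qed

end

section \<open>Levy processes\<close>

text \<open>A purely deterministic statement. Without any exit the end of the cell serves as jump
  time; otherwise the first exit does: before it the sums stay within \<open>y\<close> of the start,
  after it within \<open>y\<close> of the exit position and so within \<open>2 * y\<close> of the
  end value.\<close>

lemma walk_one_jump:
  fixes x :: "nat \<Rightarrow> real" and n m i :: nat and y s :: real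
  assumes n: "0 < n" and m: "0 < m" and y: "0 \<le> y" and s: "0 < s"
    and good: "\<not> double_exit y (nat \<lceil>real n / real m\<rceil>) (\<lambda>l. x (nat \<lfloor>real n * (real i / real m)\<rfloor> + l))"
  defines "f \<equiv> stepfun (real n) (\<lambda>k. (\<Sum>l<k. x l) / s)"
  shows "one_jump (2 * y / s) f (real i / real m) (real (Suc i) / real m)"
proof -
  define N where "N = nat \<lceil>real n / real m\<rceil>"
  define k where "k t = nat \<lfloor>real n * t\<rfloor>" for t
  define b where "b = k (real i / real m)"
  define c where "c = k (real (Suc i) / real m)"
  have npos: "0 < real n" and mpos: "0 < real m" using n m by auto
  have k_le: "real (k t) \<le> real n * t" "real n * t < real (k t) + 1" if "0 \<le> t" for t
    using that npos unfolding k_def by simp_all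
  have b_le: "real b \<le> real n * (real i / real m)" "real n * (real i / real m) < real b + 1"
    unfolding b_def using mpos by (intro k_le; simp)+
  have c_le: "real c \<le> real n * (real (Suc i) / real m)" "real n * (real (Suc i) / real m) < real c + 1"
    unfolding c_def using mpos by (intro k_le; simp)+
  have N_ge: "real n / real m \<le> real N" unfolding N_def by linarith
  have split: "real n * (real (Suc i) / real m) = real n * (real i / real m) + real n / real m"
    by (simp add: add_divide_distrib distrib_left)
  \<comment> \<open>The two floors differ by at most the ceiling of \<open>n / m\<close>, so the
    cell never contains more than \<open>N\<close> steps.\<close>
  have cbN: "c \<le> b + N" using b_le c_le N_ge split by linarith
  have k_mono: "k t \<le> k u" if "t \<le> u" for t u
    unfolding k_def using that npos by (intro nat_mono floor_mono mult_left_mono) auto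
  have i_le: "real i / real m < real (Suc i) / real m" using mpos by (simp add: divide_strict_right_mono)
  have bc: "b \<le> c" unfolding b_def c_def using i_le by (intro k_mono) simp
  define P where "P j = (\<Sum>l<j. x l)" for j
  have P_add: "P (j + d) = P j + (\<Sum>l<d. x (j + l))" for j d
    unfolding P_def by (rule sum_shift_lessThan)
  have f: "f t = P (k t) / s" if "0 \<le> t" for t
    unfolding f_def using that by (simp add: stepfun_apply P_def k_def)
  have fdiff: "\<bar>f t - f u\<bar> \<le> 2 * y / s" if "0 \<le> t" "0 \<le> u" "\<bar>P (k t) - P (k u)\<bar> \<le> 2 * y" for t u
  proof -
    have "\<bar>f t - f u\<bar> = \<bar>P (k t) - P (k u)\<bar> / s"
      using that s by (simp add: f diff_divide_distrib[symmetric])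
    then show ?thesis using that(3) s by (simp add: divide_right_mono)
  qed
  show ?thesis
  proof (cases "\<forall>d\<le>c - b. \<bar>\<Sum>l<d. x (b + l)\<bar> \<le> y")
    case True
    have "\<bar>f t - f (real i / real m)\<bar> \<le> 2 * y / s" if t: "real i / real m \<le> t" "t \<le> real (Suc i) / real m" for t
    proof (rule fdiff)
      have t0: "0 \<le> t" using t(1) by (meson divide_nonneg_nonneg of_nat_0_le_iff order_trans)
      then show "0 \<le> t" .
      have "b \<le> k t" "k t \<le> c" unfolding b_def c_def using t by (auto intro: k_mono)
      then obtain d where d: "k t = b + d" "d \<le> c - b" by (intro that[of "k t - b"]) auto
      then have "P (k t) - P b = (\<Sum>l<d. x (b + l))" by (simp add: P_add)
      moreover have "\<bar>\<Sum>l<d. x (b + l)\<bar> \<le> y" using True d by blast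
      ultimately show "\<bar>P (k t) - P (k (real i / real m))\<bar> \<le> 2 * y" using y by (simp add: b_def)
    qed simp
    then show ?thesis unfolding one_jump_def using i_le y s
      by (intro exI[of _ "real (Suc i) / real m"]) (auto simp: le_less)
  next
    case False
    then obtain d where d: "d \<le> c - b" "y < \<bar>\<Sum>l<d. x (b + l)\<bar>" by (auto simp: not_le)
    from first_exit_exists[OF d(2)] obtain j where j: "j \<le> d" "first_exit y j (\<lambda>l. x (b + l))" .
    have j0: "0 < j" using j(2) y by (cases j) (auto simp: first_exit_def)
    have jN: "j \<le> N" "b + j \<le> c" using j d cbN bc by auto
    have after: "\<bar>\<Sum>l<d. x (b + (j + l))\<bar> \<le> y" if "d \<le> N" for d
    proof -
      have "\<not> double_exit y N (\<lambda>l. x (b + l))" using good by (simp add: N_def b_def k_def)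
      then show ?thesis using j(2) jN that unfolding double_exit_def by (meson not_less)
    qed
    have after': "\<bar>P u - P (b + j)\<bar> \<le> y" if "b + j \<le> u" "u \<le> c" for u
    proof -
      define d where "d = u - (b + j)"
      then have d: "u = (b + j) + d" using that by simp
      then have "d \<le> N" using that cbN by linarith
      moreover have "P u - P (b + j) = (\<Sum>l<d. x (b + (j + l)))"
        unfolding d P_add[of "b + j" d] by (simp add: add.assoc)
      ultimately show ?thesis using after by simp
    qed
    define \<tau> where "\<tau> = real (b + j) / real n"
    have n\<tau>: "real n * \<tau> = real (b + j)" using npos by (simp add: \<tau>_def)
    have "real n * (real i / real m) < real n * \<tau>" unfolding n\<tau> using b_le j0 by linarith
    then have \<tau>1: "real i / real m < \<tau>" using npos by (simp only: mult_less_cancel_left_pos)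
    have "real n * \<tau> \<le> real n * (real (Suc i) / real m)" unfolding n\<tau> using c_le jN by linarith
    then have \<tau>2: "\<tau> \<le> real (Suc i) / real m" using npos by (simp only: mult_le_cancel_left_pos)
    have i0: "0 \<le> real i / real m" by simp
    have "\<bar>f t - f (real i / real m)\<bar> \<le> 2 * y / s" if t: "real i / real m \<le> t" "t < \<tau>" for t
    proof (rule fdiff)
      show t0: "0 \<le> t" using t(1) i0 by linarith
      have "real n * t < real n * \<tau>" using t npos by simp
      then have "k t < b + j" using k_le(1)[OF t0] n\<tau> by linarith
      moreover have "b \<le> k t" unfolding b_def using t by (intro k_mono)
      ultimately obtain d where d: "k t = b + d" "d < j" by (intro that[of "k t - b"]) auto
      then have "P (k t) - P b = (\<Sum>l<d. x (b + l))" by (simp add: P_add)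
      moreover have "\<bar>\<Sum>l<d. x (b + l)\<bar> \<le> y" using j(2) d by (simp add: first_exit_def)
      ultimately show "\<bar>P (k t) - P (k (real i / real m))\<bar> \<le> 2 * y" using y by (simp add: b_def)
    qed simp
    moreover have "\<bar>f t - f (real (Suc i) / real m)\<bar> \<le> 2 * y / s" if t: "\<tau> \<le> t" "t \<le> real (Suc i) / real m" for t
    proof (rule fdiff)
      show t0: "0 \<le> t" using t(1) \<tau>1 i0 by linarith
      have "real n * \<tau> \<le> real n * t" using t npos by simp
      then have 1: "b + j \<le> k t" using k_le(2)[OF t0] n\<tau> by linarith
      have 2: "k t \<le> c" unfolding c_def using t by (intro k_mono)
      show "\<bar>P (k t) - P (k (real (Suc i) / real m))\<bar> \<le> 2 * y"
        using after'[OF 1 2] after'[OF jN(2) order_refl] unfolding c_def[symmetric] by linarith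
    qed simp
    ultimately show ?thesis unfolding one_jump_def using \<tau>1 \<tau>2 by blast
  qed
qed

lemma (in prob_space) indep_vars_UNIV_natI:
  assumes "\<And>k::nat. indep_vars M' X {..<k}"
  shows "indep_vars M' X UNIV" unfolding indep_vars_def2 indep_sets_def
proof (intro conjI ballI allI impI)
  fix i :: nat
  show "random_variable (M' i) (X i)" using assms[of "Suc i"] by (auto simp: indep_vars_def2)
  show "{X i -` A \<inter> space M |A. A \<in> sets (M' i)} \<subseteq> events"
    using assms[of "Suc i"] unfolding indep_vars_def2 indep_sets_def by blast
next
  fix J A assume J: "J \<subseteq> (UNIV :: nat set)" "J \<noteq> {}" "finite J"
    and A: "A \<in> (\<Pi> i\<in>J. {X i -` A \<inter> space M |A. A \<in> sets (M' i)})"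
  have "J \<subseteq> {..<Suc (Max J)}" using J by (auto simp: less_Suc_eq_le)
  with assms[of "Suc (Max J)"] J A show "prob (\<Inter> (A ` J)) = (\<Prod>j\<in>J. prob (A j))"
    unfolding indep_vars_def2 indep_sets_def by blast
qed

abbreviation levy_incr :: "(real \<Rightarrow> 'v \<Rightarrow> real) \<Rightarrow> nat \<Rightarrow> nat \<Rightarrow> 'v \<Rightarrow> real" where
  "levy_incr W m i v \<equiv> W (real (Suc i) / real m) v - W (real i / real m) v"

context
  fixes N :: "'v measure" and W :: "real \<Rightarrow> 'v \<Rightarrow> real"
  assumes levy: "levy_process N W"
begin

interpretation N: prob_space N using levy by (simp add: levy_process_def)

lemma levy_measurable: "0 \<le> t \<Longrightarrow> W t \<in> borel_measurable N"
  using levy by (simp add: levy_process_def)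

lemma levy_AE_0: "AE v in N. W 0 v = 0" using levy by (simp add: levy_process_def)

lemma levy_cadlag: "v \<in> space N \<Longrightarrow> (\<lambda>t\<in>{0..}. W t v) \<in> cadlag_fun"
  using levy by (simp add: levy_process_def)

lemma levy_increment_law:
  "distr N borel (\<lambda>v. levy_incr W m i v) = distr N borel (W (1 / real m))"
proof -
  have "\<forall>s\<ge>0. \<forall>t\<ge>0. distr N borel (\<lambda>v. W (s + t) v - W s v) = distr N borel (W t)"
    using levy by (simp add: levy_process_def)
  then have "distr N borel (\<lambda>v. W (real i / real m + 1 / real m) v - W (real i / real m) v) = distr N borel (W (1 / real m))"
    by simp
  moreover have "real i / real m + 1 / real m = real (Suc i) / real m" by (simp add: add_divide_distrib)
  ultimately show ?thesis by simp
qed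

lemma levy_iid_walk:
  "iid_walk N (\<lambda>i v. levy_incr W m i v)"
proof
  have "\<forall>t :: nat \<Rightarrow> real. \<forall>k. 0 \<le> t 0 \<and> mono t \<longrightarrow>
        N.indep_vars (\<lambda>_. borel) (\<lambda>i v. W (t (Suc i)) v - W (t i) v) {..<k}"
    using levy by (simp add: levy_process_def)
  from this[rule_format, of "\<lambda>i. real i / real m"]
  have "N.indep_vars (\<lambda>_. borel) (\<lambda>i v. levy_incr W m i v) {..<k}" for k
    by (auto simp: mono_def divide_right_mono)
  then show "N.indep_vars (\<lambda>_. borel) (\<lambda>i v. levy_incr W m i v) UNIV"
    by (rule N.indep_vars_UNIV_natI)
qed (simp only: levy_increment_law)

lemma levy_sum_increments:
  "(\<Sum>i<k. levy_incr W m i v) = W (real k / real m) v - W 0 v"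
  by (subst sum_lessThan_telescope) simp

text \<open>Right-continuity at 0 keeps \<open>W\<close> small on some \<open>[0, 1/j]\<close> with probability at least \<open>1/2\<close>; the
  \<open>m div j\<close> independent increments over cells of length \<open>1/m\<close> are then all small.\<close>

lemma levy_small_increment:
  assumes x: "0 < x"
  obtains C where "0 < C" "\<And>m. 0 < m \<Longrightarrow> N.prob {v \<in> space N. x \<le> \<bar>W (1 / real m) v\<bar>} \<le> C / real m"
proof -
  \<comment> \<open>Rational times make the event below a countable intersection, and they include
    all grid points \<open>i / m\<close>.\<close>
  define D where "D = {s :: real. s \<in> \<rat> \<and> 0 \<le> s}"
  have cD: "countable D" unfolding D_def using countable_rat by (rule countable_subset[rotated]) auto
  define G where "G j = {v \<in> space N. \<forall>s\<in>D. s \<le> 1 / real (Suc j) \<longrightarrow> \<bar>W s v\<bar> < x / 2}" for j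
  have mW[measurable]: "W s \<in> borel_measurable N" if "s \<in> D" for s
    using that by (intro levy_measurable) (simp add: D_def)
  have G_sets: "G j \<in> N.events" for j
  proof -
    have "G j = {v \<in> space N. \<forall>s\<in>{s\<in>D. s \<le> 1 / real (Suc j)}. \<bar>W s v\<bar> < x / 2}" by (auto simp: G_def)
    also have "\<dots> \<in> N.events"
    proof (rule sets.sets_Collect_countable_All')
      show "countable {s \<in> D. s \<le> 1 / real (Suc j)}" using cD by (rule countable_subset[rotated]) auto
      fix s assume "s \<in> {s \<in> D. s \<le> 1 / real (Suc j)}"
      then have [measurable]: "W s \<in> borel_measurable N" by (intro mW) simp
      show "{v \<in> space N. \<bar>W s v\<bar> < x / 2} \<in> N.events" by measurable
    qed
    finally show ?thesis .
  qed
  have "AE v in N. v \<in> (\<Union>j. G j)" using levy_AE_0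
  proof (rule AE_mp, intro AE_I2 impI)
    fix v assume v: "v \<in> space N" "W 0 v = 0"
    have "continuous (at_right 0) (\<lambda>t\<in>{0..}. W t v)" using levy_cadlag[OF v(1)] by (auto simp: cadlag_fun_def)
    then have "((\<lambda>t\<in>{0..}. W t v) \<longlongrightarrow> 0) (at_right 0)" using v(2) by (simp add: continuous_within)
    then have "\<forall>\<^sub>F t in at_right 0. dist ((\<lambda>t\<in>{0..}. W t v) t) 0 < x / 2"
      by (rule tendstoD) (use x in simp)
    then obtain b where b: "0 < b" "\<And>t. 0 < t \<Longrightarrow> t < b \<Longrightarrow> \<bar>W t v\<bar> < x / 2"
      by (auto simp: eventually_at_right_field)
    obtain j where j: "1 / real (Suc j) < b" using nat_approx_posE[OF b(1)] by blast
    have "\<bar>W s v\<bar> < x / 2" if "s \<in> D" "s \<le> 1 / real (Suc j)" for s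
      using that b(2)[of s] j v(2) x by (cases "s = 0") (auto simp: D_def)
    then show "v \<in> (\<Union>j. G j)" using v by (auto simp: G_def)
  qed
  then have "N.prob (\<Union>j. G j) = 1" using G_sets by (subst N.prob_eq_1) auto
  moreover have "incseq G"
  proof (rule incseq_SucI)
    fix j
    have "1 / real (Suc (Suc j)) \<le> 1 / real (Suc j)" by (simp add: frac_le)
    then show "G j \<subseteq> G (Suc j)" unfolding G_def using order_trans by blast
  qed
  ultimately have "(\<lambda>j. N.prob (G j)) \<longlonglongrightarrow> 1"
    using N.finite_Lim_measure_incseq[of G] G_sets by auto
  then have "\<forall>\<^sub>F j in sequentially. 1 / 2 < N.prob (G j)" by (rule order_tendstoD) simp
  then obtain j where j: "1 / 2 < N.prob (G j)" by (auto simp: eventually_sequentially)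
  define J where "J = Suc j"
  show ?thesis
  proof (rule that[of "2 * real J"])
    show "0 < 2 * real J" by (simp add: J_def)
    fix m :: nat assume m: "0 < m"
    define I where "I i v = levy_incr W m i v" for i v
    interpret I: iid_walk N I unfolding I_def[abs_def] by (rule levy_iid_walk)
    define q where "q = N.prob {v \<in> space N. x \<le> \<bar>W (1 / real m) v\<bar>}"
    have q01: "0 \<le> q" "q \<le> 1" by (auto simp: q_def)
    define k where "k = m div J"
    have single: "N.prob {v \<in> space N. \<bar>I i v\<bar> < x} = 1 - q" for i
    proof -
      have [measurable]: "W (1 / real m) \<in> borel_measurable N" by (rule levy_measurable) simp
      have "N.prob {v \<in> space N. \<bar>I i v\<bar> < x} = measure (distr N borel (I i)) {z. \<bar>z\<bar> < x}"
        by (subst measure_distr) (auto intro!: arg_cong[where f=N.prob])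
      also have "\<dots> = measure (distr N borel (W (1 / real m))) {z. \<bar>z\<bar> < x}"
        unfolding I_def[abs_def] levy_increment_law ..
      also have "\<dots> = N.prob {v \<in> space N. \<not> x \<le> \<bar>W (1 / real m) v\<bar>}"
        by (subst measure_distr) (auto intro!: arg_cong[where f=N.prob])
      also have "\<dots> = 1 - q" unfolding q_def by (rule N.prob_neg) simp
      finally show ?thesis .
    qed
    show "N.prob {v \<in> space N. x \<le> \<bar>W (1 / real m) v\<bar>} \<le> 2 * real J / real m"
    \<comment> \<open>If not even one cell fits into \<open>[0, 1 / J]\<close>, then
      \<open>m < J\<close> and the bound exceeds 1.\<close>
    proof (cases "k = 0")
      case True
      then have "m < J" unfolding k_def by (simp add: J_def div_eq_0_iff)
      then have "1 \<le> 2 * real J / real m" using m by (simp add: field_simps)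
      then show ?thesis using q01 unfolding q_def by linarith
    next
      case False
      have "N.prob (G j) \<le> N.prob (\<Inter>i\<in>{..<k}. {v \<in> space N. \<bar>I i v\<bar> < x})"
      proof (rule N.finite_measure_mono)
        show "(\<Inter>i\<in>{..<k}. {v \<in> space N. \<bar>I i v\<bar> < x}) \<in> N.events"
          using False by (intro sets.finite_INT) auto
        show "G j \<subseteq> (\<Inter>i\<in>{..<k}. {v \<in> space N. \<bar>I i v\<bar> < x})"
        proof (intro subsetI INT_I)
          fix v i assume v: "v \<in> G j" and "i \<in> {..<k}"
          then have "Suc i * J \<le> k * J" by (intro mult_right_mono) auto
          also have "\<dots> \<le> m" by (simp add: k_def)
          finally have "real (Suc i) * real J \<le> real m" by (metis of_nat_le_iff of_nat_mult)
          then have 1: "real (Suc i) / real m \<le> 1 / real (Suc j)" using m by (simp add: J_def field_simps)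
          then have 2: "real i / real m \<le> 1 / real (Suc j)"
            by (rule order_trans[rotated]) (simp add: divide_right_mono)
          have "real (Suc i) / real m \<in> D" "real i / real m \<in> D" by (auto simp: D_def)
          with 1 2 v have "\<bar>W (real (Suc i) / real m) v\<bar> < x / 2" "\<bar>W (real i / real m) v\<bar> < x / 2" "v \<in> space N"
            unfolding G_def by blast+
          then show "v \<in> {v \<in> space N. \<bar>I i v\<bar> < x}" unfolding I_def by auto
        qed
      qed
      also have "(\<Inter>i\<in>{..<k}. {v \<in> space N. \<bar>I i v\<bar> < x}) = (\<Inter>i\<in>{..<k}. I i -` {z. \<bar>z\<bar> < x} \<inter> space N)"
        by (intro INF_cong) auto
      also have "N.prob \<dots> = (\<Prod>i<k. N.prob (I i -` {z. \<bar>z\<bar> < x} \<inter> space N))"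
        using False by (intro N.indep_varsD[OF I.indep]) auto
      also have "\<dots> = (\<Prod>i<k. 1 - q)"
        by (intro prod.cong refl) (simp add: single vimage_def Int_def conj_commute)
      also have "\<dots> = (1 - q) ^ k" by simp
      also have "\<dots> \<le> exp (- q) ^ k" using q01 exp_ge_add_one_self[of "- q"] by (intro power_mono) auto
      also have "\<dots> = exp (- (real k * q))" by (simp add: exp_of_nat_mult[symmetric])
      finally have half: "1 / 2 < exp (- (real k * q))" using j by linarith
      \<comment> \<open>Since \<open>exp (- 1) \<le> 1 / 2\<close>, a probability above 1/2 forces
        \<open>k * q < 1\<close>; together with \<open>m \<le> 2 * J * k\<close> this is the claim
        with constant \<open>2 * J\<close>.\<close>
      have "real k * q < 1"
      proof (rule ccontr)
        assume "\<not> real k * q < 1"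
        then have "exp (- (real k * q)) \<le> exp (- 1)" by simp
        moreover have "exp (- 1 :: real) \<le> 1 / 2"
          using exp_ge_add_one_self[of "1 :: real"] by (simp add: exp_minus field_simps)
        ultimately show False using half by linarith
      qed
      moreover have "m \<le> 2 * J * k"
      proof -
        have "m = J * k + m mod J" by (simp add: k_def)
        moreover have "m mod J < J" by (simp add: J_def)
        moreover have "J \<le> J * k" using False by simp
        ultimately show ?thesis by linarith
      qed
      then have "real m \<le> 2 * real J * real k" by (metis of_nat_le_iff of_nat_mult of_nat_numeral)
      then have "real m * q \<le> 2 * real J * real k * q" using q01 by (intro mult_right_mono) auto
      moreover have "2 * real J * (real k * q) \<le> 2 * real J * 1" using calculation(1) by (intro mult_left_mono) auto
      ultimately have "real m * q \<le> 2 * real J" by (simp add: mult.assoc)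
      then show ?thesis using m by (simp add: q_def field_simps)
    qed
  qed
qed

end

section \<open>Convergence of random walks to Levy processes\<close>

lemma char_scale:
  assumes [measurable]: "Z \<in> borel_measurable M"
  shows "char (distr M borel (\<lambda>w. c * Z w)) t = char (distr M borel Z) (c * t)"
  by (simp add: char_def integral_distr mult_ac)

context iid_walk
begin

lemma char_walk:
  "char (distr M borel (\<lambda>w. c * S n w)) t = char (distr M borel (X 0)) (c * t) ^ n"
proof -
  have "char (distr M borel (\<lambda>w. \<Sum>i<n. X i w)) (c * t) = (\<Prod>i<n. char (distr M borel (X i)) (c * t))"
    by (rule char_distr_sum[OF indep_vars_subset[OF indep]]) simp
  also have "\<dots> = (\<Prod>i<n. char (distr M borel (X 0)) (c * t))"
    by (rule prod.cong[OF refl]) (subst ident, rule refl)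
  finally show ?thesis by (simp add: char_scale)
qed

text \<open>Along \<open>n = m * k\<close> the walk is a sum of \<open>m\<close> independent blocks
  of \<open>k\<close> steps. Comparing the limits in \<open>k\<close> shows that \<open>L\<close> is
  the \<open>m\<close>-fold convolution of its own rescaling by \<open>m powr -a\<close>.\<close>

lemma limit_law_char_root:
  assumes L: "real_distribution L" and m: "0 < m"
    and w: "limit_law a L"
  shows "char L (real m powr - a * t) ^ m = char L t"
proof -
  let ?\<mu> = "\<lambda>n. distr M borel (\<lambda>w. real n powr - a * S n w)"
  have R: "real_distribution (?\<mu> n)" for n by (intro real_distribution_distr) simp
  have lim: "(\<lambda>n. char (?\<mu> n) s) \<longlonglongrightarrow> char L s" for s by (rule levy_continuity1[OF R L w])
  have sub: "filterlim (\<lambda>k. m * k) at_top sequentially"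
    using m by (intro filterlim_subseq) (simp add: strict_mono_def)
  have eq: "char (?\<mu> (m * k)) t = char (?\<mu> k) (real m powr - a * t) ^ m" for k
    unfolding char_walk by (simp add: powr_mult power_mult mult_ac)
  have "(\<lambda>k. char (?\<mu> (m * k)) t) \<longlonglongrightarrow> char L t" by (rule filterlim_compose[OF lim sub])
  then have "(\<lambda>k. char (?\<mu> k) (real m powr - a * t) ^ m) \<longlonglongrightarrow> char L t" by (simp only: eq)
  moreover have "(\<lambda>k. char (?\<mu> k) (real m powr - a * t) ^ m) \<longlonglongrightarrow> char L (real m powr - a * t) ^ m"
    by (intro tendsto_power lim)
  ultimately show ?thesis using LIMSEQ_unique by blast
qed

text \<open>A zero at \<open>t\<close> would give a zero at \<open>m powr -a * t\<close> for every
  positive \<open>m\<close>, but these points tend to 0, where the characteristic function is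
  1.\<close>

lemma limit_law_char_nonzero:
  assumes L: "real_distribution L" and a: "0 < a"
    and w: "limit_law a L"
  shows "char L t \<noteq> 0"
proof -
  interpret L: real_distribution L by fact
  have "(\<lambda>m. real m powr - a) \<longlonglongrightarrow> 0"
    using a by (intro tendsto_neg_powr filterlim_real_sequentially) auto
  then have "(\<lambda>m. real m powr - a * t) \<longlonglongrightarrow> 0" using tendsto_mult_left_zero by blast
  then have "(\<lambda>m. char L (real m powr - a * t)) \<longlonglongrightarrow> char L 0"
    by (rule isCont_tendsto_compose[OF L.isCont_char])
  then have "\<forall>\<^sub>F m in sequentially. char L (real m powr - a * t) \<noteq> 0"
    by (rule tendsto_imp_eventually_ne) (simp add: L.char_zero)
  then obtain m where "0 < m" "char L (real m powr - a * t) \<noteq> 0"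
    using eventually_gt_at_top[of 0] eventually_happens[OF eventually_conj] by (metis (mono_tags, lifting) trivial_limit_sequentially)
  then show ?thesis using limit_law_char_root[OF L _ w, of m t] by auto
qed

section \<open>Paths of the rescaled walk and their comparison with the Levy process\<close>

definition walk_path :: "real \<Rightarrow> nat \<Rightarrow> 'a \<Rightarrow> real \<Rightarrow> real" where
  "walk_path a n w = stepfun (real n) (\<lambda>k. S k w / real n powr a)"

lemma walk_path_cadlag: "walk_path a n w \<in> cadlag_fun"
  unfolding walk_path_def by (intro stepfun_cadlag) simp

lemma walk_path_measurable: "walk_path a n \<in> measurable M J1_borel"
  unfolding walk_path_def[abs_def] by (intro stepfun_measurable_compose) auto

lemma walk_grid_eq:
  "grid_path m (walk_path a n w) = stepfun (real m) (\<lambda>i. (\<Sum>l<nat \<lfloor>real n * (real i / real m)\<rfloor>. X l w) / real n powr a)"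
  unfolding grid_path_def walk_path_def by (simp add: stepfun_apply)

lemma walk_grid_measurable: "(\<lambda>w. grid_path m (walk_path a n w)) \<in> measurable M J1_borel"
  unfolding walk_grid_eq by (intro stepfun_measurable_compose) auto

end

text \<open>The limit is described by the exponent \<open>a\<close> and the law of
  \<open>W 1\<close>; in this form a deterministic drift, whose law at time 1 is a point mass and so
  not a \<open>stable_law\<close>, is included.\<close>

locale walk_to_levy = iid_walk M X for M :: "'a measure" and X +
  fixes N :: "'v measure" and W :: "real \<Rightarrow> 'v \<Rightarrow> real" and a :: real
  assumes levy: "levy_process N W" and a: "0 < a" and w: "limit_law a (distr N borel (W 1))"
begin

sublocale N: prob_space N using levy by (simp add: levy_process_def)

abbreviation path_mean :: "((real \<Rightarrow> real) \<Rightarrow> real) \<Rightarrow> nat \<Rightarrow> real" where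
  "path_mean H n \<equiv> \<integral>w. H (walk_path a n w) \<partial>M"

abbreviation grid_mean :: "((real \<Rightarrow> real) \<Rightarrow> real) \<Rightarrow> nat \<Rightarrow> nat \<Rightarrow> real" where
  "grid_mean H m n \<equiv> \<integral>w. H (grid_path m (walk_path a n w)) \<partial>M"

abbreviation levy_mean :: "((real \<Rightarrow> real) \<Rightarrow> real) \<Rightarrow> real" where
  "levy_mean H \<equiv> \<integral>v. H (\<lambda>t\<in>{0..}. W t v) \<partial>N"

abbreviation levy_grid_mean :: "((real \<Rightarrow> real) \<Rightarrow> real) \<Rightarrow> nat \<Rightarrow> real" where
  "levy_grid_mean H m \<equiv> \<integral>v. H (grid_path m (\<lambda>t. W t v)) \<partial>N"

lemma W_measurable [measurable]:
  "0 \<le> t \<Longrightarrow> W t \<in> borel_measurable N" "W 1 \<in> borel_measurable N" "W 0 \<in> borel_measurable N"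
  "W (1 / real m) \<in> borel_measurable N" "W (real i / real m) \<in> borel_measurable N"
  by (intro levy_measurable[OF levy]; simp)+

lemma W1_law: "real_distribution (distr N borel (W 1))"
  by (intro N.real_distribution_distr) simp

text \<open>Both laws are \<open>m\<close>-th convolution roots of the law of \<open>W 1\<close>, whose characteristic function has
  no zeros; the quotient of their characteristic functions is a continuous \<open>m\<close>-th root of unity.\<close>

lemma levy_marginal_law:
  assumes m: "0 < m"
  shows "distr N borel (W (1 / real m)) = distr N borel (\<lambda>v. real m powr - a * W 1 v)"
proof -
  define L where "L = distr N borel (W 1)"
  have L: "real_distribution L" unfolding L_def by (rule W1_law)
  interpret L: real_distribution L by fact
  define P where "P = distr N borel (W (1 / real m))"
  interpret P: real_distribution P unfolding P_def by (rule N.real_distribution_distr) simp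
  interpret I: iid_walk N "\<lambda>i v. levy_incr W m i v" by (rule levy_iid_walk[OF levy])
  have I0: "distr N borel (\<lambda>v. W (real (Suc 0) / real m) v - W (real 0 / real m) v) = P"
    unfolding P_def by (rule levy_increment_law[OF levy])
  have P_pow: "char P t ^ m = char L t" for t
  proof -
    have "char P t ^ m = char (distr N borel (\<lambda>v. 1 * (\<Sum>i<m. levy_incr W m i v))) t"
      unfolding I.char_walk I0 by simp
    also have "distr N borel (\<lambda>v. 1 * (\<Sum>i<m. levy_incr W m i v)) = L" unfolding L_def
    \<comment> \<open>The increments telescope to \<open>W 1 - W 0\<close>, and \<open>W 0\<close>
      vanishes only almost surely.\<close>
    proof (rule distr_cong_AE)
      show "AE v in N. 1 * (\<Sum>i<m. levy_incr W m i v) = W 1 v" using levy_AE_0[OF levy]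
        by eventually_elim (unfold levy_sum_increments[OF levy], use m in simp)
    qed simp_all
    finally show ?thesis .
  qed
  have nz: "char L t \<noteq> 0" for t
    by (rule limit_law_char_nonzero[OF L a]) (use w in \<open>simp add: L_def\<close>)
  have L_pow: "char L (real m powr - a * t) ^ m = char L t" for t
    by (rule limit_law_char_root[OF L m]) (use w in \<open>simp add: L_def\<close>)
  define r where "r t = char P t / char L (real m powr - a * t)" for t
  have "r t ^ m = 1" for t unfolding r_def using nz by (simp add: power_divide P_pow L_pow)
  then have "r ` UNIV \<subseteq> {z. z ^ m = 1}" by auto
  moreover have "finite {z :: complex. z ^ m = 1}" using m by (intro finite_nth_roots)
  ultimately have "finite (r ` UNIV)" using finite_subset by blast
  moreover have "continuous_on UNIV r"
  proof (rule continuous_at_imp_continuous_on, intro ballI)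
    fix t
    have "isCont (\<lambda>t. char L (real m powr - a * t)) t"
      by (rule isCont_o2[OF _ L.isCont_char]) (intro continuous_intros)
    then show "isCont r t" unfolding r_def using nz P.isCont_char by (intro isCont_divide) auto
  qed
  ultimately have "r constant_on UNIV" by (intro continuous_finite_range_constant) auto
  then obtain z where z: "\<And>t. r t = z" by (auto simp: constant_on_def)
  have "r 0 = 1" by (simp add: r_def L.char_zero P.char_zero)
  then have "r t = 1" for t using z by metis
  then have "char P t = char (distr N borel (\<lambda>v. real m powr - a * W 1 v)) t" for t
    using nz[of "real m powr - a * t"] by (simp add: r_def char_scale L_def)
  then have "char P = char (distr N borel (\<lambda>v. real m powr - a * W 1 v))" by blast
  then have "P = distr N borel (\<lambda>v. real m powr - a * W 1 v)"
    by (intro Levy_uniqueness) (auto intro!: N.real_distribution_distr P.real_distribution_axioms)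
  then show ?thesis by (simp add: P_def)
qed

text \<open>A cell is bad only if the walk makes two large displacements in it, which has probability
  \<open>O(1/m\<^sup>2)\<close>; there are \<open>O(m)\<close> cells.\<close>

lemma walk_grid_approx:
  assumes H: "jlipschitz C B H" and r: "0 < r"
  obtains m0 where "0 < m0" "\<And>m. m0 \<le> m \<Longrightarrow>
    \<forall>\<^sub>F n in sequentially. \<bar>path_mean H n - grid_mean H m n\<bar> \<le> r"
proof -
  have C0: "0 \<le> C" using jlipschitzD(1)[OF H] .
  \<comment> \<open>Evaluating the bound at any cadlag path gives \<open>0 \<le> B\<close>; the path
    of index 0 at an arbitrary point serves as witness.\<close>
  have B0: "0 \<le> B" using jlipschitzD(2)[OF H walk_path_cadlag[of a 0 undefined]] by linarith
  define e where "e = min (r / (4 * (C + 1))) (1 / 2)"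
  have e: "0 < e" using r C0 by (auto simp: e_def)
  have e_half: "e \<le> 1 / 2" unfolding e_def by (rule min.cobounded2)
  have Ce: "C * (2 * e) \<le> r / 2"
  proof -
    have "C * (2 * e) \<le> (C + 1) * (2 * (r / (4 * (C + 1))))"
      using C0 e by (intro mult_mono) (auto simp: e_def)
    also have "\<dots> = r / 2" using C0 by (simp add: field_simps)
    finally show ?thesis .
  qed
  have e2: "0 < e / 2" "0 < e / 2 / 4" using e by auto
  obtain D where D: "0 < D" "\<And>m. 0 < m \<Longrightarrow> N.prob {v \<in> space N. e / 2 / 4 \<le> \<bar>W (1 / real m) v\<bar>} \<le> D / real m"
    using levy_small_increment[OF levy e2(2)] by blast
  obtain m1 where m1: "0 < m1" "\<And>m q. m1 \<le> m \<Longrightarrow> measure (distr N borel (W 1)) {z. e / 2 / 4 \<le> \<bar>real m powr - a * z\<bar>} < q \<Longrightarrow>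
      \<forall>\<^sub>F n in sequentially. prob (exits (e / 2 * real n powr a) (nat \<lceil>real n / real m\<rceil>)) \<le> 2 * q"
    using block_exit_bound[OF W1_law a e2(1) w] by blast
  \<comment> \<open>At most \<open>m * (1 / e + 2)\<close> cells are inspected, each bad with
    probability at most the square of \<open>2 * (D + 1) / m\<close>; the product is
    \<open>R / m\<close>.\<close>
  define R where "R = (1 / e + 2) * (2 * (D + 1))\<^sup>2"
  obtain m2 :: nat where m2: "max (2 / e) (4 * B * R / r) \<le> real m2" using real_arch_simple by blast
  show ?thesis
  proof (rule that[of "max m1 (Suc m2)"])
    show "0 < max m1 (Suc m2)" by simp
    fix m assume "max m1 (Suc m2) \<le> m"
    then have m: "m1 \<le> m" "0 < m" "real m2 \<le> real m" by auto
    then have mpos: "0 < real m" by simp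
    have m_e: "2 / real m \<le> e"
    proof -
      have "2 / e \<le> real m" using m(3) m2 by simp
      then show ?thesis using e mpos by (simp add: field_simps)
    qed
    have m_R: "2 * B * (R / real m) \<le> r / 2"
    proof -
      have "4 * B * R / r \<le> real m" using m(3) m2 by simp
      then show ?thesis using r mpos by (simp add: field_simps)
    qed
    \<comment> \<open>\<open>D + 1\<close> instead of \<open>D\<close> because the tail has to be
      strictly below \<open>q\<close>.\<close>
    define q where "q = (D + 1) / real m"
    have "measure (distr N borel (W 1)) {z. e / 2 / 4 \<le> \<bar>real m powr - a * z\<bar>} =
      measure (distr N borel (\<lambda>v. real m powr - a * W 1 v)) {z. e / 2 / 4 \<le> \<bar>z\<bar>}"
      by (subst (1 2) measure_distr) (auto intro!: arg_cong[where f=N.prob])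
    also have "\<dots> = measure (distr N borel (W (1 / real m))) {z. e / 2 / 4 \<le> \<bar>z\<bar>}"
      by (simp only: levy_marginal_law[OF m(2)])
    also have "\<dots> = N.prob {v \<in> space N. e / 2 / 4 \<le> \<bar>W (1 / real m) v\<bar>}"
      by (subst measure_distr) (auto intro!: arg_cong[where f=N.prob])
    also have "\<dots> \<le> D / real m" by (rule D(2)[OF m(2)])
    also have "\<dots> < q" using mpos by (simp add: q_def divide_strict_right_mono)
    finally have "\<forall>\<^sub>F n in sequentially. prob (exits (e / 2 * real n powr a) (nat \<lceil>real n / real m\<rceil>)) \<le> 2 * q"
      by (rule m1(2)[OF m(1)])
    then show "\<forall>\<^sub>F n in sequentially. \<bar>path_mean H n - grid_mean H m n\<bar> \<le> r"
      using eventually_gt_at_top[of 0]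
    proof eventually_elim
      fix n assume p: "prob (exits (e / 2 * real n powr a) (nat \<lceil>real n / real m\<rceil>)) \<le> 2 * q"
        and n: "0 < n"
      \<comment> \<open>Half of \<open>e\<close> on the scale of the walk, as
        \<open>walk_one_jump\<close> loses a factor 2.\<close>
      define y where "y = e / 2 * real n powr a"
      define Nn where "Nn = nat \<lceil>real n / real m\<rceil>"
      define b where "b i = nat \<lfloor>real n * (real i / real m)\<rfloor>" for i
      define K where "K = nat \<lceil>real m / e\<rceil> + 1"
      define A where "A = (\<Union>i<K. {w \<in> space M. double_exit y Nn (\<lambda>l. X (b i + l) w)})"
      have A_sets: "{w \<in> space M. double_exit y Nn (\<lambda>l. X (b i + l) w)} \<in> events" for i
        using measurable_compose[OF shifted_measurable(1)[of "b i"] measurable_double_exit[of y Nn]] by simp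
      then have A: "A \<in> events" unfolding A_def by (intro sets.finite_UN) auto
      have "prob A \<le> (\<Sum>i<K. prob {w \<in> space M. double_exit y Nn (\<lambda>l. X (b i + l) w)})"
        unfolding A_def using A_sets by (intro finite_measure_subadditive_finite) auto
      also have "\<dots> \<le> (\<Sum>i<K. (2 * q)\<^sup>2)"
      proof (intro sum_mono)
        fix i
        have "prob {w \<in> space M. double_exit y Nn (\<lambda>l. X (b i + l) w)} = prob {w \<in> space M. double_exit y Nn (\<lambda>l. X l w)}"
          by (rule prob_shift) measurable
        also have "\<dots> \<le> (prob (exits y Nn))\<^sup>2" by (rule prob_double_exit)
        also have "\<dots> \<le> (2 * q)\<^sup>2" using p unfolding Nn_def y_def by (intro power_mono) auto
        finally show "prob {w \<in> space M. double_exit y Nn (\<lambda>l. X (b i + l) w)} \<le> (2 * q)\<^sup>2" .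
      qed
      also have "\<dots> = real K * (2 * q)\<^sup>2" by simp
      also have "\<dots> \<le> (real m * (1 / e + 2)) * (2 * q)\<^sup>2"
      proof (rule mult_right_mono)
        have "0 \<le> real m / e" using e by simp
        then have "real K \<le> real m / e + 2" unfolding K_def by linarith
        also have "\<dots> \<le> real m * (1 / e + 2)" using m(2) by (simp add: distrib_left)
        finally show "real K \<le> real m * (1 / e + 2)" .
      qed simp
      also have "\<dots> = R / real m" using mpos by (simp add: R_def q_def power2_eq_square field_simps)
      finally have pA: "prob A \<le> R / real m" .
      have "\<bar>path_mean H n - grid_mean H m n\<bar> \<le> r / 2 + 2 * B * prob A"
      proof (rule expectation_diff_le[OF _ _ A])
        fix w assume wA: "w \<in> space M" "w \<notin> A"
        have "J1_close e (walk_path a n w) (grid_path m (walk_path a n w))"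
        proof (rule J1_close_discretise[OF m(2) e m_e])
          have "real m / e < real K" unfolding K_def by linarith
          then show "1 / e < real K / real m" using mpos by (simp add: field_simps)
        next
          fix i assume "i < K"
          then have "\<not> double_exit y Nn (\<lambda>l. X (b i + l) w)" using wA by (auto simp: A_def)
          then have good: "\<not> double_exit y (nat \<lceil>real n / real m\<rceil>) (\<lambda>l. X (nat \<lfloor>real n * (real i / real m)\<rfloor> + l) w)"
            by (simp add: Nn_def b_def)
          have npow: "0 < real n powr a" using n by simp
          have "2 * y / real n powr a = e" using npow by (simp add: y_def)
          with walk_one_jump[OF n m(2) _ npow good] e
          show "one_jump e (walk_path a n w) (real i / real m) (real (Suc i) / real m)"
            unfolding walk_path_def by (simp add: y_def)
        qed
        then have "jdist (walk_path a n w) (grid_path m (walk_path a n w)) \<le> 2 * e"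
          using e e_half by (intro jdist_le_of_close)
        then have "C * jdist (walk_path a n w) (grid_path m (walk_path a n w)) \<le> C * (2 * e)" using C0 by (intro mult_left_mono)
        with jlipschitzD(3)[OF H walk_path_cadlag grid_path_cadlag] Ce
        show "\<bar>H (walk_path a n w) - H (grid_path m (walk_path a n w))\<bar> \<le> r / 2" by (meson order_trans)
      next
        show "(\<lambda>w. H (walk_path a n w)) \<in> borel_measurable M"
          by (rule measurable_compose[OF walk_path_measurable jlipschitz_measurable[OF H]])
        show "(\<lambda>w. H (grid_path m (walk_path a n w))) \<in> borel_measurable M"
          by (rule measurable_compose[OF walk_grid_measurable jlipschitz_measurable[OF H]])
      qed (use r jlipschitzD(2)[OF H] walk_path_cadlag grid_path_cadlag in auto)
      also have "\<dots> \<le> r / 2 + 2 * B * (R / real m)" using pA B0 by (intro add_left_mono mult_left_mono) auto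
      also have "\<dots> \<le> r" using m_R by linarith
      finally show "\<bar>path_mean H n - grid_mean H m n\<bar> \<le> r" .
    qed
  qed
qed

end

lemma levy_grid_measurable:
  assumes levy: "levy_process N W"
  shows "(\<lambda>v. grid_path m (\<lambda>t. W t v)) \<in> measurable N J1_borel"
  unfolding grid_path_def by (intro stepfun_measurable_compose levy_measurable[OF levy]) auto

lemma levy_grid_tendsto:
  assumes levy: "levy_process N W" and v: "v \<in> space N"
  shows "(\<lambda>m. jdist (grid_path m (\<lambda>t. W t v)) (\<lambda>t\<in>{0..}. W t v)) \<longlonglongrightarrow> 0"
  using cadlag_discretise_tendsto[OF levy_cadlag[OF levy v]] by (simp add: grid_path_def)

lemma levy_path_measurable:
  assumes levy: "levy_process N W"
  shows "(\<lambda>v. \<lambda>t\<in>{0..}. W t v) \<in> measurable N J1_borel"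
  by (rule measurable_J1_borel_limit[OF levy_grid_measurable[OF levy] levy_cadlag[OF levy] levy_grid_tendsto[OF levy]])

lemma walk_law_cong:
  assumes "iid_walk M X" "iid_walk M' X'" and eq: "distr M borel (X 0) = distr M' borel (X' 0)"
  shows "distr M borel (\<lambda>w. c * (\<Sum>i<n. X i w)) = distr M' borel (\<lambda>w. c * (\<Sum>i<n. X' i w))"
proof -
  interpret X: iid_walk M X by fact
  interpret X': iid_walk M' X' by fact
  have "char (distr M borel (\<lambda>w. c * (\<Sum>i<n. X i w))) = char (distr M' borel (\<lambda>w. c * (\<Sum>i<n. X' i w)))"
    by (rule ext) (simp only: X.char_walk X'.char_walk eq)
  then show ?thesis
    by (intro Levy_uniqueness X.real_distribution_distr X'.real_distribution_distr) measurable
qed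

context iid_walk
begin

lemma distr_shift:
  assumes [measurable]: "f \<in> borel_measurable seq_borel"
  shows "distr M borel (\<lambda>w. f (\<lambda>i. X (b + i) w)) = distr M borel (\<lambda>w. f (\<lambda>i. X i w))"
proof -
  have "distr M borel (\<lambda>w. f (\<lambda>i. X (b + i) w)) = distr (distr M seq_borel (\<lambda>w i. X (b + i) w)) borel f"
    by (subst distr_distr) (auto simp: comp_def)
  also have "\<dots> = distr (distr M seq_borel (\<lambda>w i. X i w)) borel f" by (simp only: law_shift)
  also have "\<dots> = distr M borel (\<lambda>w. f (\<lambda>i. X i w))"
    by (subst distr_distr) (auto simp: comp_def)
  finally show ?thesis .
qed

end

context walk_to_levy
begin

text \<open>For fixed \<open>m\<close> the discretised path is a function of its increments over
  blocks. These are independent, and each converges in law to an increment of \<open>W\<close> over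
  a time \<open>1 / m\<close>, so \<open>weak_conv_product\<close> applies; partial sums of the
  coordinates recover the path.\<close>

lemma walk_grid_limit:
  assumes m: "0 < m" and H: "jlipschitz C B H"
  shows "(\<lambda>n. grid_mean H m n) \<longlonglongrightarrow> levy_grid_mean H m"
proof -
  define G where "G x = H (stepfun (real m) (\<lambda>i. \<Sum>l<i. x l))" for x :: "nat \<Rightarrow> real"
  have G_lim: "(\<lambda>n. G (x n)) \<longlonglongrightarrow> G y" if "\<And>i. (\<lambda>n. x n i) \<longlonglongrightarrow> y i" for x y
    unfolding G_def using that by (intro jlipschitz_tendsto[OF H] stepfun_cadlag stepfun_tendsto tendsto_sum) auto
  have G_B: "\<bar>G x\<bar> \<le> B" for x
    unfolding G_def by (intro jlipschitzD(2)[OF H] stepfun_cadlag) simp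
  have G_meas[measurable]: "G \<in> borel_measurable seq_borel"
    by (rule measurable_of_pointwise_continuous[OF G_lim])
  define b where "b n i = nat \<lfloor>real n * (real i / real m)\<rfloor>" for n i :: nat
  have b_real: "real (b n i) \<le> real n * (real i / real m)" "real n * (real i / real m) < real (b n i) + 1" for n i
    unfolding b_def by simp_all
  have b0: "b n 0 = 0" for n by (simp add: b_def)
  have b_mono: "b n i \<le> b n j" if "i \<le> j" for n i j
    unfolding b_def using that by (intro nat_mono floor_mono mult_left_mono divide_right_mono) auto
  \<comment> \<open>Block lengths differ by rounding, so for fixed \<open>n\<close> these increments
    are independent but need not be identically distributed; their limits are.\<close>
  define Dl where "Dl n i w = (\<Sum>l\<in>{b n i..<b n (Suc i)}. X l w) / real n powr a" for n i w
  have [measurable]: "Dl n i \<in> borel_measurable M" for n i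
    unfolding Dl_def[abs_def] by measurable
  have Dl_sum: "(\<Sum>l<i. Dl n l w) = S (b n i) w / real n powr a" for n i w
  proof (induction i)
    case (Suc i)
    have "(\<Sum>l<b n (Suc i). X l w) = S (b n i) w + (\<Sum>l\<in>{b n i..<b n (Suc i)}. X l w)"
      unfolding lessThan_atLeast0 by (rule sum.atLeastLessThan_concat[symmetric]) (auto intro: b_mono)
    with Suc show ?case by (simp add: Dl_def add_divide_distrib)
  qed (simp add: b0)
  have grid: "H (grid_path m (walk_path a n w)) = G (\<lambda>i. Dl n i w)" for n w
    unfolding walk_grid_eq G_def Dl_sum b_def ..
  have disj: "disjoint_family_on (\<lambda>i. {b n i..<b n (Suc i)}) UNIV" for n
  proof -
    have "{b n i..<b n (Suc i)} \<inter> {b n j..<b n (Suc j)} = {}" if "i < j" for i j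
      using b_mono[of "Suc i" j n] that by auto
    then show ?thesis unfolding disjoint_family_on_def by (metis inf_commute linorder_neqE_nat)
  qed
  have "indep_vars (\<lambda>_. borel) (Dl n) UNIV" for n
  proof -
    have "indep_vars (\<lambda>i. PiM {b n i..<b n (Suc i)} (\<lambda>_. borel)) (\<lambda>i w. restrict (\<lambda>l. X l w) {b n i..<b n (Suc i)}) UNIV"
      by (rule indep_vars_restrict[OF indep _ disj]) simp
    then have "indep_vars (\<lambda>_. borel) (\<lambda>i w. (\<Sum>l\<in>{b n i..<b n (Suc i)}. restrict (\<lambda>l. X l w) {b n i..<b n (Suc i)} l) / real n powr a) UNIV"
      by (rule indep_vars_compose2[where Y="\<lambda>i r. (\<Sum>l\<in>{b n i..<b n (Suc i)}. r l) / real n powr a"])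
        (intro borel_measurable_divide borel_measurable_sum measurable_component_singleton borel_measurable_const; simp)
    then show ?thesis by (simp add: Dl_def[abs_def])
  qed
  then have "distr M seq_borel (\<lambda>w. \<lambda>i\<in>UNIV. Dl n i w) = (\<Pi>\<^sub>M i\<in>UNIV. distr M borel (Dl n i))" for n
    by (subst indep_vars_iff_distr_eq_PiM[symmetric]) auto
  then have Dl_law: "distr M seq_borel (\<lambda>w i. Dl n i w) = (\<Pi>\<^sub>M i\<in>UNIV. distr M borel (Dl n i))" for n
    by (simp only: restrict_UNIV)
  have "(\<lambda>w i. Dl n i w) \<in> measurable M seq_borel" for n by (rule measurable_PiM_single') auto
  then have lhs: "grid_mean H m n = (\<integral>x. G x \<partial>(\<Pi>\<^sub>M i\<in>UNIV. distr M borel (Dl n i)))" for n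
    unfolding grid Dl_law[symmetric] by (simp add: integral_distr)
  have lim: "weak_conv_m (\<lambda>n. distr M borel (Dl n i)) (distr N borel (W (1 / real m)))" for i
  proof -
    have "distr M borel (Dl n i) = distr M borel (\<lambda>w. (\<Sum>l<b n (Suc i) - b n i. X l w) / real n powr a)" for n
    proof -
      have "Dl n i = (\<lambda>w. (\<Sum>l<b n (Suc i) - b n i. X (b n i + l) w) / real n powr a)"
        unfolding Dl_def[abs_def]
        by (subst sum.atLeastLessThan_shift_0) (simp add: lessThan_atLeast0)
      then show ?thesis
        using distr_shift[of "\<lambda>x. (\<Sum>l<b n (Suc i) - b n i. x l) / real n powr a" "b n i"] by simp
    qed
    moreover have "\<bar>real (b n (Suc i) - b n i) - real n / real m\<bar> \<le> 1" for n
    proof -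
      have "real n * (real (Suc i) / real m) = real n * (real i / real m) + real n / real m"
        by (simp add: add_divide_distrib distrib_left)
      moreover have "real (b n (Suc i) - b n i) = real (b n (Suc i)) - real (b n i)"
        using b_mono[of i "Suc i" n] by (simp add: of_nat_diff)
      ultimately show ?thesis using b_real[of n i] b_real[of n "Suc i"] by linarith
    qed
    note scaled_walk_limit[OF W1_law m this w]
    ultimately have "weak_conv_m (\<lambda>n. distr M borel (Dl n i)) (distr (distr N borel (W 1)) borel (\<lambda>x. real m powr - a * x))"
      by simp
    then show ?thesis unfolding levy_marginal_law[OF m] by (simp add: distr_distr comp_def)
  qed
  have "(\<lambda>n. \<integral>x. G x \<partial>(\<Pi>\<^sub>M i\<in>UNIV. distr M borel (Dl n i))) \<longlonglongrightarrow>
    (\<integral>x. G x \<partial>(\<Pi>\<^sub>M (i::nat)\<in>UNIV. distr N borel (W (1 / real m))))"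
    by (rule weak_conv_product[OF _ _ lim G_lim G_B])
      (auto intro!: real_distribution_distr N.real_distribution_distr)
  moreover have "levy_grid_mean H m =
    (\<integral>x. G x \<partial>(\<Pi>\<^sub>M (i::nat)\<in>UNIV. distr N borel (W (1 / real m))))"
  proof -
    define I where "I i v = levy_incr W m i v" for i v
    interpret I: iid_walk N I unfolding I_def[abs_def] by (rule levy_iid_walk[OF levy])
    have I0: "distr N borel (I 0) = distr N borel (W (1 / real m))"
      unfolding I_def[abs_def] by (rule levy_increment_law[OF levy])
    have "levy_grid_mean H m = (\<integral>v. G (\<lambda>i. I i v) \<partial>N)"
    proof (rule integral_cong_AE)
      show "(\<lambda>v. H (grid_path m (\<lambda>t. W t v))) \<in> borel_measurable N"
        by (rule measurable_compose[OF levy_grid_measurable[OF levy] jlipschitz_measurable[OF H]])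
      show "AE v in N. H (grid_path m (\<lambda>t. W t v)) = G (\<lambda>i. I i v)" using levy_AE_0[OF levy]
        by eventually_elim (simp add: grid_path_def G_def I_def levy_sum_increments[OF levy] del: of_nat_Suc)
    qed measurable
    also have "\<dots> = (\<integral>x. G x \<partial>distr N seq_borel (\<lambda>v i. I i v))" by (simp add: integral_distr)
    finally show ?thesis unfolding I.law_PiM I0 .
  qed
  ultimately show ?thesis unfolding lhs by simp
qed

text \<open>\<open>m\<close> is fixed first, large enough for the discretisation errors of walk and
  limit to be small; for this \<open>m\<close> the discretised means converge as \<open>n\<close>
  grows.\<close>

theorem walk_path_limit:
  assumes H: "jlipschitz C B H"
  shows "(\<lambda>n. path_mean H n) \<longlonglongrightarrow> levy_mean H"
proof (rule tendstoI)
  fix r :: real assume r: "0 < r"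
  note meas = levy_grid_measurable[OF levy] and limW = levy_grid_tendsto[OF levy]
    and measW = levy_path_measurable[OF levy]
  have "(\<lambda>m. levy_grid_mean H m) \<longlonglongrightarrow> levy_mean H"
  proof (rule integral_dominated_convergence[where w="\<lambda>_. B"])
    show "(\<lambda>v. H (\<lambda>t\<in>{0..}. W t v)) \<in> borel_measurable N"
      by (rule measurable_compose[OF measW jlipschitz_measurable[OF H]])
    show "(\<lambda>v. H (grid_path m (\<lambda>t. W t v))) \<in> borel_measurable N" for m
      by (rule measurable_compose[OF meas jlipschitz_measurable[OF H]])
    show "AE v in N. (\<lambda>m. H (grid_path m (\<lambda>t. W t v))) \<longlonglongrightarrow> H (\<lambda>t\<in>{0..}. W t v)"
      by (intro AE_I2 jlipschitz_tendsto[OF H] grid_path_cadlag levy_cadlag[OF levy] limW) auto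
    show "AE v in N. norm (H (grid_path m (\<lambda>t. W t v))) \<le> B" for m
      using jlipschitzD(2)[OF H grid_path_cadlag] by (intro AE_I2) simp
  qed simp
  then have ev1: "\<forall>\<^sub>F m in sequentially. dist (levy_grid_mean H m) (levy_mean H) < r / 3"
    using r by (intro tendstoD) auto
  have "0 < r / 3" using r by simp
  then obtain m0 where m0: "0 < m0" "\<And>m. m0 \<le> m \<Longrightarrow>
    \<forall>\<^sub>F n in sequentially. \<bar>path_mean H n - grid_mean H m n\<bar> \<le> r / 3"
    using walk_grid_approx[OF H] by blast
  obtain m where m: "m0 \<le> m" "dist (levy_grid_mean H m) (levy_mean H) < r / 3"
    using eventually_happens[OF eventually_conj[OF ev1 eventually_ge_at_top[of m0]]] by auto
  have "0 < m" using m m0 by simp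
  have "\<forall>\<^sub>F n in sequentially. dist (grid_mean H m n) (levy_grid_mean H m) < r / 3"
    using r by (intro tendstoD[OF walk_grid_limit[OF \<open>0 < m\<close> H]]) auto
  with m0(2)[OF m(1)]
  show "\<forall>\<^sub>F n in sequentially. dist (path_mean H n) (levy_mean H) < r"
    by eventually_elim (use m(2) in \<open>unfold dist_real_def, linarith\<close>)
qed

abbreviation deviates :: "(nat \<Rightarrow> 'a \<Rightarrow> real) \<Rightarrow> nat \<Rightarrow> real \<Rightarrow> 'a set" where
  "deviates V n y \<equiv> {w \<in> space M. \<exists>k\<le>n. y < \<bar>V k w - S k w\<bar>}"

text \<open>Slutsky's argument: off an event of small probability the two paths differ uniformly by
  at most \<open>e\<close> on the window \<open>[0, 1 / e]\<close>, which the first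
  \<open>T * n\<close> steps cover.\<close>

lemma perturbed_walk_limit:
  assumes H: "jlipschitz C B H"
    and V[measurable]: "\<And>k. V k \<in> borel_measurable M"
    and close: "\<And>T e q. 0 < T \<Longrightarrow> 0 < e \<Longrightarrow> 0 < q \<Longrightarrow>
      \<forall>\<^sub>F n in sequentially. prob (deviates V (T * n) (e * real n powr a)) \<le> q"
  shows "(\<lambda>n. \<integral>w. H (stepfun (real n) (\<lambda>k. V k w / real n powr a)) \<partial>M) \<longlonglongrightarrow> levy_mean H"
proof -
  let ?Z = "\<lambda>n w. stepfun (real n) (\<lambda>k. V k w / real n powr a)"
  have C0: "0 \<le> C" using jlipschitzD(1)[OF H] .
  have B0: "0 \<le> B" using jlipschitzD(2)[OF H walk_path_cadlag[of a 0 undefined]] by linarith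
  have cad: "?Z n w \<in> cadlag_fun" for n w by (rule stepfun_cadlag) simp
  have meas: "?Z n \<in> measurable M J1_borel" for n by (intro stepfun_measurable_compose) auto
  have "(\<lambda>n. (\<integral>w. H (?Z n w) \<partial>M) - path_mean H n) \<longlonglongrightarrow> 0"
  proof (rule tendstoI)
    fix r :: real assume r: "0 < r"
    define e where "e = r / (3 * (C + 1))"
    have e: "0 < e" using r C0 by (simp add: e_def)
    have Ce: "C * e \<le> r / 3"
    proof -
      have "C * e \<le> (C + 1) * e" using e by (intro mult_right_mono) auto
      also have "\<dots> = r / 3" using C0 by (simp add: e_def field_simps)
      finally show ?thesis .
    qed
    define q where "q = r / (6 * (B + 1))"
    have q: "0 < q" using r B0 by (simp add: q_def)
    have Bq: "2 * B * q \<le> r / 3"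
    proof -
      have "2 * B * q \<le> 2 * (B + 1) * q" using q by (intro mult_right_mono) auto
      also have "\<dots> = r / 3" using B0 by (simp add: q_def field_simps)
      finally show ?thesis .
    qed
    define T where "T = nat \<lceil>1 / e\<rceil>"
    have T: "1 / e \<le> real T" unfolding T_def by linarith
    then have "0 < T" using e by (metis gr0I less_le_trans of_nat_0 order_less_irrefl zero_less_divide_1_iff)
    from close[OF this e q]
    show "\<forall>\<^sub>F n in sequentially. dist ((\<integral>w. H (?Z n w) \<partial>M) - path_mean H n) 0 < r"
      using eventually_gt_at_top[of 0]
    proof eventually_elim
      fix n assume p: "prob (deviates V (T * n) (e * real n powr a)) \<le> q" and n: "0 < n"
      define A where "A = deviates V (T * n) (e * real n powr a)"
      have A: "A \<in> events" unfolding A_def by measurable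
      have "\<bar>(\<integral>w. H (?Z n w) \<partial>M) - path_mean H n\<bar> \<le> r / 3 + 2 * B * prob A"
      proof (rule expectation_diff_le[OF _ _ A])
        fix w assume wA: "w \<in> space M" "w \<notin> A"
        have "jdist (?Z n w) (walk_path a n w) \<le> e"
        proof (rule jdist_le_uniform[OF e])
          fix t assume t: "0 \<le> t" "t \<le> 1 / e"
          define k where "k = nat \<lfloor>real n * t\<rfloor>"
          have "real k \<le> real n * t" using t by (simp add: k_def)
          also have "\<dots> \<le> real n * real T" using t T by (intro mult_left_mono) auto
          finally have "real k \<le> real (T * n)" by (simp add: mult.commute)
          then have "k \<le> T * n" by linarith
          then have "\<bar>V k w - S k w\<bar> \<le> e * real n powr a"
            using wA by (auto simp: A_def not_less)
          then show "\<bar>?Z n w t - walk_path a n w t\<bar> \<le> e" using t n unfolding walk_path_def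
            by (simp add: stepfun_apply k_def[symmetric] diff_divide_distrib[symmetric] divide_le_eq)
        qed
        then have "C * jdist (?Z n w) (walk_path a n w) \<le> C * e" using C0 by (intro mult_left_mono)
        with jlipschitzD(3)[OF H cad walk_path_cadlag] Ce
        show "\<bar>H (?Z n w) - H (walk_path a n w)\<bar> \<le> r / 3" by (meson order_trans)
      next
        show "(\<lambda>w. H (?Z n w)) \<in> borel_measurable M"
          by (rule measurable_compose[OF meas jlipschitz_measurable[OF H]])
        show "(\<lambda>w. H (walk_path a n w)) \<in> borel_measurable M"
          by (rule measurable_compose[OF walk_path_measurable jlipschitz_measurable[OF H]])
      qed (use r jlipschitzD(2)[OF H] walk_path_cadlag cad in auto)
      also have "\<dots> \<le> r / 3 + 2 * B * q" using p B0 unfolding A_def by (intro add_left_mono mult_left_mono) auto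
      also have "\<dots> < r" using Bq r by linarith
      finally show "dist ((\<integral>w. H (?Z n w) \<partial>M) - path_mean H n) 0 < r" by simp
    qed
  qed
  from tendsto_add[OF this walk_path_limit[OF H]] show ?thesis by simp
qed

end

section \<open>Random walk on a random medium\<close>

lemma (in prob_space) indep_vars_reindex:
  assumes inj: "inj_on g J" and X: "indep_vars M' X (g ` J)"
  shows "indep_vars (\<lambda>j. M' (g j)) (\<lambda>j. X (g j)) J"
proof (cases "J = {}")
  case False
  have rv: "X i \<in> measurable M (M' i)" if "i \<in> g ` J" for i using X that by (auto simp: indep_vars_def)
  let ?D = "\<lambda>i. distr M (M' i) (X i)"
  have sets: "sets (\<Pi>\<^sub>M j\<in>J. ?D (g j)) = sets (\<Pi>\<^sub>M j\<in>J. M' (g j))" by (simp cong: sets_PiM_cong)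
  have "(\<Pi>\<^sub>M j\<in>J. ?D (g j)) = distr (Pi\<^sub>M (g ` J) ?D) (\<Pi>\<^sub>M j\<in>J. ?D (g j)) (\<lambda>\<omega>. \<lambda>j\<in>J. \<omega> (g j))"
    using rv inj by (intro distr_PiM_reindex[symmetric]) (auto intro: prob_space_distr)
  also have "\<dots> = distr (distr M (Pi\<^sub>M (g ` J) M') (\<lambda>w. \<lambda>i\<in>g ` J. X i w)) (\<Pi>\<^sub>M j\<in>J. M' (g j)) (\<lambda>\<omega>. \<lambda>j\<in>J. \<omega> (g j))"
    using X rv False by (intro distr_cong) (simp_all add: sets indep_vars_iff_distr_eq_PiM')
  also have "\<dots> = distr M (\<Pi>\<^sub>M j\<in>J. M' (g j)) (\<lambda>w. \<lambda>j\<in>J. X (g j) w)"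
    using rv by (subst distr_distr) (auto simp: comp_def intro!: distr_cong measurable_restrict measurable_component_singleton)
  finally show ?thesis using rv False by (subst indep_vars_iff_distr_eq_PiM') auto
qed (simp add: indep_vars_def indep_sets_def)

text \<open>Every event generated by a constant is empty or the whole space. This gives a
  deterministic drift its independent increments.\<close>

lemma (in prob_space) indep_vars_const:
  "indep_vars (\<lambda>_. borel) (\<lambda>i _. c i) I" unfolding indep_vars_def2 indep_sets_def
proof (intro conjI ballI allI impI)
  fix J A assume J: "J \<subseteq> I" "J \<noteq> {}" "finite J"
    and A: "A \<in> (\<Pi> j\<in>J. {(\<lambda>_. c j) -` A \<inter> space M |A. A \<in> sets borel})"
  have A01: "A j = {} \<or> A j = space M" if "j \<in> J" for j
  proof -
    obtain S where "A j = (\<lambda>_. c j) -` S \<inter> space M" using A \<open>j \<in> J\<close> by blast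
    then show ?thesis by (cases "c j \<in> S") auto
  qed
  show "prob (\<Inter> (A ` J)) = (\<Prod>j\<in>J. prob (A j))"
  proof (cases "\<exists>j\<in>J. A j = {}")
    case True
    then obtain j where j: "j \<in> J" "A j = {}" by blast
    then have "\<Inter> (A ` J) = {}" by blast
    moreover have "(\<Prod>j\<in>J. prob (A j)) = 0" using j J by (intro prod_zero bexI[of _ j]) auto
    ultimately show ?thesis by simp
  next
    case False
    then have *: "A j = space M" if "j \<in> J" for j using A01 that by blast
    then have "\<Inter> (A ` J) = space M" using J by auto
    then show ?thesis using * by (simp add: prob_space)
  qed
qed auto

text \<open>The injection \<open>g\<close> renumbers from 0 a family that starts at 1 or, for the
  medium, runs to the right or to the left; \<open>f\<close> scales or centres the steps.\<close>

lemma iid_walkI: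
  assumes M: "prob_space M" and Y: "iid M E Y I" and g: "inj g" "range g \<subseteq> I"
    and f: "f \<in> borel_measurable E"
  shows "iid_walk M (\<lambda>i w. f (Y (g i) w))"
proof -
  interpret prob_space M by fact
  have ind: "indep_vars (\<lambda>_. E) Y (range g)"
    using Y g by (auto simp: iid_def intro: indep_vars_subset)
  have rv: "Y (g i) \<in> measurable M E" for i using ind by (auto simp: indep_vars_def2)
  show ?thesis
  proof
    show "indep_vars (\<lambda>_. borel) (\<lambda>i w. f (Y (g i) w)) UNIV"
      using indep_vars_compose2[OF indep_vars_reindex[OF g(1) ind], of "\<lambda>_. f" "\<lambda>_. borel"] f by simp
    fix i
    have "distr M borel (\<lambda>w. f (Y (g i) w)) = distr (distr M E (Y (g i))) borel f" for i
      using rv f by (simp add: distr_distr comp_def)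
    moreover have "distr M E (Y (g i)) = distr M E (Y (g 0))"
      using Y g(2) unfolding iid_def by blast
    ultimately show "distr M borel (\<lambda>w. f (Y (g i) w)) = distr M borel (\<lambda>w. f (Y (g 0) w))" by simp
  qed
qed

lemma cadlag_cmult:
  assumes f: "(\<lambda>t\<in>{0..}. f t) \<in> cadlag_fun"
  shows "(\<lambda>t\<in>{0..}. c * f t) \<in> cadlag_fun"
proof -
  let ?f = "\<lambda>t\<in>{0..}. f t"
  have "(\<lambda>t\<in>{0..}. c * ?f t) \<in> cadlag_fun"
  proof (rule cadlag_funI)
    show "((\<lambda>t. c * ?f t) \<longlongrightarrow> c * ?f t) (at_right t)" if "0 \<le> t" for t
    proof -
      have "continuous (at_right t) ?f" using f that unfolding cadlag_fun_def by blast
      then show ?thesis unfolding continuous_within by (rule tendsto_mult_left)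
    qed
    show "\<exists>l. ((\<lambda>t. c * ?f t) \<longlongrightarrow> l) (at_left t)" if "0 < t" for t
      using f that unfolding cadlag_fun_def by (blast intro: tendsto_mult_left)
  qed
  moreover have "(\<lambda>t\<in>{0..}. c * ?f t) = (\<lambda>t\<in>{0..}. c * f t)" by auto
  ultimately show ?thesis by simp
qed

lemma levy_process_cmult:
  assumes levy: "levy_process N W"
  shows "levy_process N (\<lambda>t v. c * W t v)"
proof -
  interpret N: prob_space N using levy by (simp add: levy_process_def)
  have W[measurable]: "W t \<in> borel_measurable N" if "0 \<le> t" for t by (rule levy_measurable[OF levy that])
  have "N.indep_vars (\<lambda>_. borel) (\<lambda>i v. c * W (t (Suc i)) v - c * W (t i) v) {..<k}"
    if t: "0 \<le> t 0" "mono t" for t :: "nat \<Rightarrow> real" and k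
  proof -
    have "N.indep_vars (\<lambda>_. borel) (\<lambda>i v. W (t (Suc i)) v - W (t i) v) {..<k}"
      using levy t by (simp add: levy_process_def)
    from N.indep_vars_compose2[OF this, of "\<lambda>_ x. c * x" "\<lambda>_. borel"] show ?thesis
      by (simp add: right_diff_distrib)
  qed
  moreover have "distr N borel (\<lambda>v. c * W (s + t) v - c * W s v) = distr N borel (\<lambda>v. c * W t v)"
    if st: "0 \<le> s" "0 \<le> t" for s t
  proof -
    have [measurable]: "W (s + t) \<in> borel_measurable N" "W s \<in> borel_measurable N" "W t \<in> borel_measurable N"
      using st by auto
    have "distr N borel (\<lambda>v. W (s + t) v - W s v) = distr N borel (W t)"
      using levy st by (simp add: levy_process_def)
    then have "distr (distr N borel (\<lambda>v. W (s + t) v - W s v)) borel (\<lambda>x. c * x) = distr (distr N borel (W t)) borel (\<lambda>x. c * x)"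
      by simp
    then show ?thesis by (simp add: distr_distr comp_def right_diff_distrib)
  qed
  moreover have "AE v in N. c * W 0 v = 0" using levy_AE_0[OF levy] by eventually_elim simp
  ultimately show ?thesis
    using levy cadlag_cmult[of "\<lambda>t. W t _"] unfolding levy_process_def by (auto intro!: borel_measurable_times)
qed

lemma cadlag_linear: "(\<lambda>t\<in>{0..}. c * t) \<in> cadlag_fun"
proof -
  have "((\<lambda>s. c * s) \<longlongrightarrow> c * t) (at t within A)" for t A by (intro tendsto_intros)
  then show ?thesis by (intro cadlag_funI) blast+
qed

lemma levy_process_linear:
  assumes "prob_space M"
  shows "levy_process M (\<lambda>t _. c * t)"
proof -
  interpret prob_space M by fact
  have "indep_vars (\<lambda>_. borel) (\<lambda>i _. c * t (Suc i) - c * t i) {..<k}" for t :: "nat \<Rightarrow> real" and k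
    by (rule indep_vars_const)
  then show ?thesis
    unfolding levy_process_def using prob_space_axioms cadlag_linear[of c] by (auto simp: distrib_left)
qed

lemma medium_nonneg:
  assumes "0 \<le> k"
  shows "medium \<zeta> k w - \<nu> * real_of_int k = (\<Sum>i<nat k. \<zeta> (int (Suc i)) w - \<nu>)"
proof -
  have "(\<Sum>i=1..int n. \<zeta> i w) = (\<Sum>i<n. \<zeta> (int (Suc i)) w)" for n
  proof (induction n)
    case (Suc n)
    have "{1..int (Suc n)} = insert (int (Suc n)) {1..int n}" by auto
    with Suc show ?case by simp
  qed simp
  from this[of "nat k"] assms show ?thesis
    by (cases "k = 0") (auto simp: medium_def sum_subtractf)
qed

lemma medium_neg:
  assumes "k < 0"
  shows "medium \<zeta> k w - \<nu> * real_of_int k = - (\<Sum>i<nat (- k). \<zeta> (- int (Suc i)) w - \<nu>)"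
proof -
  have "(\<Sum>i=- int n..-1. \<zeta> i w) = (\<Sum>i<n. \<zeta> (- int (Suc i)) w)" for n
  proof (induction n)
    case (Suc n)
    have "{- int (Suc n)..-1} = insert (- int (Suc n)) {- int n..-1}" by auto
    with Suc show ?case by simp
  qed simp
  from this[of "nat (- k)"] assms show ?thesis by (auto simp: medium_def sum_subtractf)
qed

text \<open>Here \<open>1 < \<beta>\<close> is decisive: over a window of order
  \<open>n powr a\<close> the medium fluctuates by the order of \<open>n powr (a / \<beta>)\<close>,
  which is lower than \<open>n powr a\<close>.\<close>

lemma eventually_powr_negligible:
  assumes a: "0 < a" and \<beta>: "1 < \<beta>" and K: "0 \<le> K" and e: "0 < e" and c: "0 \<le> c"
    and J: "\<And>n. 0 < n \<Longrightarrow> real (J n) \<le> c * real n powr a"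
  shows "\<forall>\<^sub>F n in sequentially. K * real (J n) powr (1 / \<beta>) \<le> e * real n powr a"
proof -
  have neg: "a / \<beta> - a < 0" using a \<beta> by (simp add: divide_less_eq)
  have "(\<lambda>n. real n powr (a / \<beta> - a)) \<longlonglongrightarrow> 0"
    by (rule tendsto_neg_powr[OF neg filterlim_real_sequentially])
  then have "(\<lambda>n. K * c powr (1 / \<beta>) * real n powr (a / \<beta> - a)) \<longlonglongrightarrow> 0"
    by (rule tendsto_mult_right_zero)
  then have "\<forall>\<^sub>F n in sequentially. K * c powr (1 / \<beta>) * real n powr (a / \<beta> - a) < e"
    using e by (rule order_tendstoD(2))
  then show ?thesis using eventually_gt_at_top[of 0]
  proof eventually_elim
    fix n :: nat assume less: "K * c powr (1 / \<beta>) * real n powr (a / \<beta> - a) < e" and n: "0 < n"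
    have "real (J n) powr (1 / \<beta>) \<le> (c * real n powr a) powr (1 / \<beta>)"
      using J[OF n] \<beta> by (intro powr_mono2) auto
    also have "\<dots> = c powr (1 / \<beta>) * real n powr (a / \<beta>)"
      using c by (simp add: powr_mult powr_powr)
    finally have "K * real (J n) powr (1 / \<beta>) \<le> K * (c powr (1 / \<beta>) * real n powr (a / \<beta>))"
      using K by (rule mult_left_mono)
    also have "\<dots> = (K * c powr (1 / \<beta>) * real n powr (a / \<beta> - a)) * real n powr a"
      using n by (simp add: powr_diff)
    also have "\<dots> \<le> e * real n powr a" using less by (intro mult_right_mono) auto
    finally show "K * real (J n) powr (1 / \<beta>) \<le> e * real n powr a" .
  qed
qed

lemma walk_eq_sum: "walk \<xi> n w = (\<Sum>i<n. \<xi> (Suc i) w)" unfolding walk_def by (induction n) auto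

lemma walk_measurable:
  assumes "\<And>i. i \<in> {1..} \<Longrightarrow> \<xi> i \<in> measurable M (count_space UNIV)"
  shows "walk \<xi> n \<in> measurable M (count_space UNIV)"
proof -
  have [measurable]: "(\<lambda>w. real_of_int (\<xi> (Suc i) w)) \<in> borel_measurable M" for i
    by (rule measurable_compose[OF assms]) auto
  have "(\<lambda>w. real_of_int (walk \<xi> n w)) \<in> borel_measurable M"
    unfolding walk_eq_sum of_int_sum by measurable
  \<comment> \<open>Taking the floor returns from the reals, where sums are measurable, to the
    integers.\<close>
  then have "(\<lambda>w. \<lfloor>real_of_int (walk \<xi> n w)\<rfloor>) \<in> measurable M (count_space UNIV)" by measurable
  then show ?thesis by simp
qed

text \<open>The reference walk has steps \<open>\<nu> * \<xi>\<close>, so its sums are the centring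
  of the medium at the position of the walk; \<open>perturbed_walk_limit\<close> then asks that the
  centred medium be small along the visited positions.\<close>

lemma walk_on_medium_limit:
  fixes \<zeta> :: "int \<Rightarrow> 'w \<Rightarrow> real" and \<xi> :: "nat \<Rightarrow> 'w \<Rightarrow> int"
  assumes M: "prob_space M" and \<zeta>: "iid M borel \<zeta> UNIV" and \<nu>: "0 < \<nu>" and \<beta>: "1 < \<beta>"
    and L: "real_distribution L"
    and w\<zeta>: "weak_conv_m (\<lambda>n. distr M borel (\<lambda>w. real n powr - (1 / \<beta>) * (\<Sum>i<n. \<zeta> (int (Suc i)) w - \<nu>))) L"
    and \<xi>: "iid M (count_space UNIV) \<xi> {1..}" and a: "0 < a" and levy: "levy_process N W"
    and w\<xi>: "weak_conv_m (\<lambda>n. distr M borel (\<lambda>w. real n powr - a * (\<Sum>i<n. real_of_int (\<xi> (Suc i) w)))) (distr N borel (W 1))"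
  shows "J1_converges_in_distribution M (scaled_path \<zeta> \<xi> (\<lambda>n. real n powr a)) N (\<lambda>v. \<lambda>t\<in>{0..}. \<nu> * W t v)"
proof -
  interpret prob_space M by fact
  interpret N: prob_space N using levy by (simp add: levy_process_def)
  define X where "X i w = \<nu> * real_of_int (\<xi> (Suc i) w)" for i w
  define Zp where "Zp i w = \<zeta> (int (Suc i)) w - \<nu>" for i w
  define Zm where "Zm i w = \<zeta> (- int (Suc i)) w - \<nu>" for i w
  interpret X: iid_walk M X
    unfolding X_def[abs_def] by (rule iid_walkI[OF M \<xi>]) (auto simp: inj_on_def)
  interpret Zp: iid_walk M Zp
    unfolding Zp_def[abs_def] by (rule iid_walkI[OF M \<zeta>, where g="\<lambda>i. int (Suc i)" and f="\<lambda>x. x - \<nu>"]) (auto simp: inj_on_def)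
  interpret Zm: iid_walk M Zm
    unfolding Zm_def[abs_def] by (rule iid_walkI[OF M \<zeta>, where g="\<lambda>i. - int (Suc i)" and f="\<lambda>x. x - \<nu>"]) (auto simp: inj_on_def)
  have [measurable]: "\<zeta> i \<in> borel_measurable M" for i
    using \<zeta> by (auto simp: iid_def indep_vars_def2)
  have "distr M borel (\<lambda>w. \<zeta> i w - \<nu>) = distr (distr M borel (\<zeta> i)) borel (\<lambda>x. x - \<nu>)" for i
    by (simp add: distr_distr comp_def)
  moreover have "distr M borel (\<zeta> (int (Suc 0))) = distr M borel (\<zeta> (- int (Suc 0)))"
    using \<zeta> unfolding iid_def by blast
  ultimately have Z0: "distr M borel (Zp 0) = distr M borel (Zm 0)"
    by (simp add: Zp_def[abs_def] Zm_def[abs_def] del: of_nat_Suc)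
  have tp: "Zp.tight_walk (1 / \<beta>)"
    by (rule Zp.tight_walkI[OF L]) (use w\<zeta> in \<open>simp add: Zp_def\<close>)
  \<comment> \<open>The medium to the left has the same step law, hence the same laws of partial
    sums, as the one to the right, for which convergence is assumed.\<close>
  have tm: "Zm.tight_walk (1 / \<beta>)" by (rule Zm.tight_walkI[OF L])
      (use w\<zeta> in \<open>simp add: walk_law_cong[OF Zp.iid_walk_axioms Zm.iid_walk_axioms Z0, symmetric] Zp_def\<close>)
  have [measurable]: "W 1 \<in> borel_measurable N" by (rule levy_measurable[OF levy]) simp
  have [measurable]: "(\<lambda>w. real_of_int (\<xi> (Suc i) w)) \<in> borel_measurable M" for i
  proof -
    have "\<xi> (Suc i) \<in> measurable M (count_space UNIV)"
      using \<xi> by (auto simp: iid_def indep_vars_def2)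
    then show ?thesis by (rule measurable_compose) simp
  qed
  have wX: "weak_conv_m (\<lambda>n. distr M borel (\<lambda>w. real n powr - a * (\<Sum>i<n. X i w))) (distr N borel (\<lambda>v. \<nu> * W 1 v))"
  proof -
    have "weak_conv_m (\<lambda>n. distr (distr M borel (\<lambda>w. real n powr - a * (\<Sum>i<n. real_of_int (\<xi> (Suc i) w)))) borel (\<lambda>x. \<nu> * x + 0))
      (distr (distr N borel (W 1)) borel (\<lambda>x. \<nu> * x + 0))"
      by (rule weak_conv_affine[OF _ _ w\<xi> filterlim_ident tendsto_const tendsto_const])
        (auto intro!: real_distribution_distr N.real_distribution_distr)
    then show ?thesis by (simp add: distr_distr comp_def X_def sum_distrib_left mult_ac)
  qed
  note levy' = levy_process_cmult[OF levy, of \<nu>]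
  interpret XW: walk_to_levy M X N "\<lambda>t v. \<nu> * W t v" a using levy' a wX by unfold_locales
  have tX: "X.tight_walk a"
    by (rule X.tight_walkI[OF _ wX]) (rule N.real_distribution_distr; measurable)
  have X_sum: "(\<Sum>i<k. X i w) = \<nu> * real_of_int (walk \<xi> k w)" for k w
    by (simp add: X_def walk_eq_sum sum_distrib_left)
  define V where "V k w = walk_on_medium \<zeta> \<xi> k w" for k w
  have V[measurable]: "V k \<in> borel_measurable M" for k
  proof -
    have med: "medium \<zeta> i \<in> borel_measurable M" for i
      unfolding medium_def[abs_def] by measurable
    have "walk \<xi> k \<in> measurable M (count_space UNIV)"
      using \<xi> by (intro walk_measurable) (auto simp: iid_def indep_vars_def2)
    \<comment> \<open>The random position takes countably many values, so measurability of each
      \<open>medium \<zeta> i\<close> is enough.\<close>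
    from measurable_compose_countable[OF med this] show ?thesis
      by (simp add: V_def[abs_def] walk_on_medium_def)
  qed
  have path: "scaled_path \<zeta> \<xi> (\<lambda>n. real n powr a) n w = stepfun (real n) (\<lambda>k. V k w / real n powr a)" for n w
    by (simp add: scaled_path_def stepfun_def V_def)
  have close: "\<forall>\<^sub>F n in sequentially. prob (XW.deviates V (T * n) (e * real n powr a)) \<le> q"
    if T: "0 < T" and e: "0 < e" and q: "0 < q" for T e q
  proof -
    have q3: "0 < q / 3" using q by simp
    obtain K1 where K1: "0 < K1" "\<And>n. prob (X.exits (K1 * real n powr a) n) \<le> q / 3"
      using X.tight_walk_max[OF tX a q3] by blast
    have b: "0 < 1 / \<beta>" using \<beta> by simp
    obtain K2 where K2: "0 < K2" "\<And>n. prob (Zp.exits (K2 * real n powr (1 / \<beta>)) n) \<le> q / 3"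
      using Zp.tight_walk_max[OF tp b q3] by blast
    obtain K3 where K3: "0 < K3" "\<And>n. prob (Zm.exits (K3 * real n powr (1 / \<beta>)) n) \<le> q / 3"
      using Zm.tight_walk_max[OF tm b q3] by blast
    \<comment> \<open>Half-width of the window containing the walk up to time \<open>T * n\<close>
      outside the event \<open>A1\<close> below; the division by \<open>\<nu>\<close> undoes the
      factor in \<open>X\<close>, and the \<open>+ 1\<close> in \<open>c\<close> absorbs the
      ceiling.\<close>
    define J where "J n = nat \<lceil>K1 * real (T * n) powr a / \<nu>\<rceil>" for n
    define c where "c = K1 * real T powr a / \<nu> + 1"
    have c0: "0 \<le> c" using K1(1) \<nu> by (simp add: c_def)
    have J_c: "real (J n) \<le> c * real n powr a" if "0 < n" for n
    proof -
      have "0 \<le> K1 * real (T * n) powr a / \<nu>" using K1(1) \<nu> by simp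
      then have "real (J n) \<le> K1 * real (T * n) powr a / \<nu> + 1" unfolding J_def by linarith
      also have "\<dots> \<le> K1 * real (T * n) powr a / \<nu> + real n powr a"
        using ge_one_powr_ge_zero[of "real n" a] that a by simp
      also have "\<dots> = c * real n powr a" by (simp add: c_def powr_mult field_simps)
      finally show ?thesis .
    qed
    have J_ge: "K1 * real (T * n) powr a \<le> \<nu> * real (J n)" for n
    proof -
      have "K1 * real (T * n) powr a / \<nu> \<le> real (J n)" unfolding J_def by linarith
      then show ?thesis using \<nu> by (simp add: field_simps)
    qed
    have "\<forall>\<^sub>F n in sequentially. K2 * real (J n) powr (1 / \<beta>) \<le> e * real n powr a"
      by (rule eventually_powr_negligible[OF a \<beta> _ e c0 J_c]) (use K2(1) in auto)
    moreover have "\<forall>\<^sub>F n in sequentially. K3 * real (J n) powr (1 / \<beta>) \<le> e * real n powr a"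
      by (rule eventually_powr_negligible[OF a \<beta> _ e c0 J_c]) (use K3(1) in auto)
    ultimately show ?thesis
    proof eventually_elim
      fix n assume small: "K2 * real (J n) powr (1 / \<beta>) \<le> e * real n powr a" "K3 * real (J n) powr (1 / \<beta>) \<le> e * real n powr a"
      define A1 where "A1 = X.exits (K1 * real (T * n) powr a) (T * n)"
      define A2 where "A2 = Zp.exits (K2 * real (J n) powr (1 / \<beta>)) (J n)"
      define A3 where "A3 = Zm.exits (K3 * real (J n) powr (1 / \<beta>)) (J n)"
      have [measurable]: "A1 \<in> events" "A2 \<in> events" "A3 \<in> events"
        unfolding A1_def A2_def A3_def by measurable
      \<comment> \<open>If the walk stays in the window, a deviation at position \<open>s\<close> is
        an exit of the centred medium sum to the right or to the left, according to the sign of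
        \<open>s\<close>.\<close>
      have "XW.deviates V (T * n) (e * real n powr a) \<subseteq> A1 \<union> A2 \<union> A3"
      proof
        fix w assume "w \<in> XW.deviates V (T * n) (e * real n powr a)"
        then obtain k where w: "w \<in> space M" and k: "k \<le> T * n" "e * real n powr a < \<bar>V k w - (\<Sum>i<k. X i w)\<bar>"
          by auto
        define s where "s = walk \<xi> k w"
        have diff: "e * real n powr a < \<bar>medium \<zeta> s w - \<nu> * real_of_int s\<bar>"
          using k(2) by (simp add: V_def X_sum walk_on_medium_def s_def)
        show "w \<in> A1 \<union> A2 \<union> A3"
        proof (cases "w \<in> A1")
          case False
          then have "\<bar>\<nu> * real_of_int s\<bar> \<le> \<nu> * real (J n)"
            using w k(1) J_ge[of n] unfolding A1_def X_sum s_def by force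
          then have sJ: "\<bar>real_of_int s\<bar> \<le> real (J n)" using \<nu> by (simp add: abs_mult)
          show ?thesis
          proof (cases "0 \<le> s")
            case True
            have "nat s \<le> J n" using sJ True by linarith
            moreover have "K2 * real (J n) powr (1 / \<beta>) < \<bar>\<Sum>i<nat s. Zp i w\<bar>"
              using diff small(1) medium_nonneg[OF True, of \<zeta> w \<nu>] by (simp add: Zp_def)
            ultimately show ?thesis using w by (auto simp: A2_def)
          next
            case neg: False
            have "nat (- s) \<le> J n" using sJ neg by linarith
            moreover have "K3 * real (J n) powr (1 / \<beta>) < \<bar>\<Sum>i<nat (- s). Zm i w\<bar>"
              using diff small(2) medium_neg[of s \<zeta> w \<nu>] neg by (simp add: Zm_def)
            ultimately show ?thesis using w by (auto simp: A3_def)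
          qed
        qed simp
      qed
      then have "prob (XW.deviates V (T * n) (e * real n powr a)) \<le> prob (A1 \<union> A2 \<union> A3)"
        by (intro finite_measure_mono) auto
      also have "\<dots> \<le> prob (A1 \<union> A2) + prob A3" by (intro measure_Un_le) auto
      also have "prob (A1 \<union> A2) \<le> prob A1 + prob A2" by (intro measure_Un_le) auto
      finally show "prob (XW.deviates V (T * n) (e * real n powr a)) \<le> q"
        using K1(2)[of "T * n"] K2(2)[of "J n"] K3(2)[of "J n"] unfolding A1_def A2_def A3_def by linarith
    qed
  qed
  show ?thesis
  proof (rule J1_converges_in_distributionI[OF M N.prob_space_axioms])
    show "scaled_path \<zeta> \<xi> (\<lambda>n. real n powr a) n \<in> measurable M J1_borel" for n
      unfolding path[abs_def] by (intro stepfun_measurable_compose) auto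
    show "(\<lambda>v. \<lambda>t\<in>{0..}. \<nu> * W t v) \<in> measurable N J1_borel"
      by (rule levy_path_measurable[OF levy'])
    fix C B H assume H: "jlipschitz C B H"
    show "(\<lambda>n. \<integral>w. H (scaled_path \<zeta> \<xi> (\<lambda>n. real n powr a) n w) \<partial>M) \<longlonglongrightarrow> (\<integral>v. H (\<lambda>t\<in>{0..}. \<nu> * W t v) \<partial>N)"
      unfolding path by (rule XW.perturbed_walk_limit[OF H V close])
  qed
qed

text \<open>A weak law of large numbers: the average is \<open>\<mu>\<close> plus the normalised
  centred sum times \<open>n powr (1 / \<alpha> - 1)\<close>, whose exponent is negative.\<close>

lemma normal_attraction_centred:
  assumes "prob_space M" and Y: "\<And>i. Y (Suc i) \<in> borel_measurable M" and \<alpha>: "1 < \<alpha>"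
    and na: "normal_attraction M Y \<mu> \<alpha> L"
  shows "weak_conv_m (\<lambda>n. distr M borel (\<lambda>w. real n powr - 1 * (\<Sum>i<n. Y (Suc i) w))) (distr M borel (\<lambda>w. \<mu>))"
proof -
  interpret prob_space M by fact
  note [measurable] = Y
  have L: "real_distribution L" using na by (simp add: normal_attraction_def stable_law_def)
  interpret L: real_distribution L by fact
  have w: "weak_conv_m (\<lambda>n. distr M borel (\<lambda>w. real n powr (- 1 / \<alpha>) * (\<Sum>i<n. Y (Suc i) w - \<mu>))) L"
    using na by (simp add: normal_attraction_def sum.atLeast1_atMost_eq)
  \<comment> \<open>At \<open>n = 0\<close> the normalised sum is 0, so the shift has to be 0 there
    for the identity below to hold for every \<open>n\<close>.\<close>
  define d where "d n = (if n = 0 then 0 else \<mu>)" for n :: nat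
  have d: "d \<longlonglongrightarrow> \<mu>"
    by (rule tendsto_eventually, rule eventually_mono[OF eventually_gt_at_top[of 0]]) (simp add: d_def)
  have "1 / \<alpha> - 1 < 0" using \<alpha> by simp
  then have c: "(\<lambda>n. real n powr (1 / \<alpha> - 1)) \<longlonglongrightarrow> 0"
    by (rule tendsto_neg_powr[OF _ filterlim_real_sequentially])
  have "weak_conv_m (\<lambda>n. distr (distr M borel (\<lambda>w. real n powr (- 1 / \<alpha>) * (\<Sum>i<n. Y (Suc i) w - \<mu>))) borel
      (\<lambda>x. real n powr (1 / \<alpha> - 1) * x + d n)) (distr L borel (\<lambda>x. 0 * x + \<mu>))"
    by (rule weak_conv_affine[OF _ L w filterlim_ident c d]) (auto intro!: real_distribution_distr)
  moreover have "real n powr (1 / \<alpha> - 1) * (real n powr (- 1 / \<alpha>) * (\<Sum>i<n. Y (Suc i) w - \<mu>)) + d n =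
    real n powr - 1 * (\<Sum>i<n. Y (Suc i) w)" for n w
  proof (cases "n = 0")
    case False
    then have "real n powr (1 / \<alpha> - 1) * real n powr (- 1 / \<alpha>) = real n powr - 1"
      by (simp add: powr_add[symmetric])
    then have "real n powr (1 / \<alpha> - 1) * (real n powr (- 1 / \<alpha>) * (\<Sum>i<n. Y (Suc i) w - \<mu>)) =
      real n powr - 1 * (\<Sum>i<n. Y (Suc i) w - \<mu>)" by (simp only: mult.assoc[symmetric])
    then show ?thesis using False by (simp add: d_def sum_subtractf powr_minus field_simps)
  qed (simp add: d_def)
  ultimately show ?thesis by (simp add: distr_distr comp_def)
qed

theorem theorem2p3:
  fixes M :: "'w measure"
    and \<zeta> :: "int \<Rightarrow> 'w \<Rightarrow> real" and \<xi> :: "nat \<Rightarrow> 'w \<Rightarrow> int"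
    and \<alpha> \<beta> \<nu> \<mu> :: real
  assumes "prob_space M"
    and "1 < \<beta>" and "\<beta> < 2"
    and "iid M borel \<zeta> UNIV"
    and "\<And>i. AE w in M. 0 < \<zeta> i w"
    and "integrable M (\<zeta> 1)" and "\<nu> = (\<integral>w. \<zeta> 1 w \<partial>M)" and "0 < \<nu>"
    and "\<exists>L. normal_attraction M (\<lambda>i. \<zeta> (int i)) \<nu> \<beta> L"
    and "iid M (count_space UNIV) \<xi> {1..}"
    and "medium_walk_indep M \<zeta> \<xi>"
    and "\<mu> = (\<integral>w. real_of_int (\<xi> 1 w) \<partial>M)"
  shows
    "(\<forall>(N :: 'v measure) W.
        ((0 < \<alpha> \<and> \<alpha> < 1) \<or>
         (1 < \<alpha> \<and> \<alpha> < 2 \<and> integrable M (\<lambda>w. real_of_int (\<xi> 1 w)) \<and> \<mu> = 0)) \<and>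
        levy_process N W \<and>
        normal_attraction M (\<lambda>i w. real_of_int (\<xi> i w)) 0 \<alpha> (distr N borel (W 1)) \<longrightarrow>
        J1_converges_in_distribution
          M (scaled_path \<zeta> \<xi> (\<lambda>n. real n powr (1 / \<alpha>)))
          N (\<lambda>v. \<lambda>t\<in>{0..}. \<nu> * W t v)) \<and>
     (1 < \<alpha> \<and> \<alpha> < 2 \<and> integrable M (\<lambda>w. real_of_int (\<xi> 1 w)) \<and> \<mu> \<noteq> 0 \<and>
      (\<exists>L. normal_attraction M (\<lambda>i w. real_of_int (\<xi> i w)) \<mu> \<alpha> L) \<longrightarrow>
        J1_converges_in_distribution
          M (scaled_path \<zeta> \<xi> (\<lambda>n. real n))
          M (\<lambda>w. \<lambda>t\<in>{0..}. \<nu> * \<mu> * t))"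
proof (intro conjI allI impI, goal_cases)
  obtain L where "normal_attraction M (\<lambda>i. \<zeta> (int i)) \<nu> \<beta> L" using assms(9) by blast
  then have L: "real_distribution L"
    and w\<zeta>: "weak_conv_m (\<lambda>n. distr M borel (\<lambda>w. real n powr - (1 / \<beta>) * (\<Sum>i<n. \<zeta> (int (Suc i)) w - \<nu>))) L"
    by (simp_all add: normal_attraction_def stable_law_def sum.atLeast1_atMost_eq)
  note limit = walk_on_medium_limit[OF assms(1,4,8,2) L w\<zeta> assms(10)]
  {
    \<comment> \<open>In both ranges of \<open>\<alpha>\<close> the attraction has centring 0, so
      the normalised sums converge to \<open>W 1\<close> with exponent
      \<open>1 / \<alpha>\<close>.\<close>
    case (1 N W)
    then have "0 < 1 / \<alpha>" by auto
    then show ?case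
      by (rule limit) (use 1 in \<open>simp_all add: normal_attraction_def sum.atLeast1_atMost_eq\<close>)
  next
    case 2
    then obtain L' where "1 < \<alpha>" and L': "normal_attraction M (\<lambda>i w. real_of_int (\<xi> i w)) \<mu> \<alpha> L'" by blast
    interpret prob_space M by fact
    have "(\<lambda>w. real_of_int (\<xi> (Suc i) w)) \<in> borel_measurable M" for i
    proof -
      have "\<xi> (Suc i) \<in> measurable M (count_space UNIV)"
        using assms(10) by (auto simp: iid_def indep_vars_def2)
      then show ?thesis by (rule measurable_compose) simp
    qed
    \<comment> \<open>The drift is a Levy process on \<open>M\<close> itself with the value
      \<open>\<mu>\<close> at time 1; the exponent is 1, and \<open>n powr 1\<close> simplifies to
      \<open>n\<close>.\<close>
    from normal_attraction_centred[OF assms(1) this \<open>1 < \<alpha>\<close> L']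
    have "J1_converges_in_distribution M (scaled_path \<zeta> \<xi> (\<lambda>n. real n powr 1)) M (\<lambda>w. \<lambda>t\<in>{0..}. \<nu> * (\<mu> * t))"
      by (intro limit levy_process_linear assms(1)) simp_all
    then show ?case by (simp add: mult.assoc)
  }
qed

end
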